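(* Let $K$ be a field, let $S = K[x_1,\dots,x_6]$ be the polynomial ring, and let $I = (f_1,\dots,f_6,g) \subset S$ be an almost complete intersection generated by quadrics, where $f_1,\dots,f_6 \in S_2$ form a regular sequence and $g \in S_2$. Then $I$ satisfies the Eisenbud--Green--Harris conjecture; that is, there exists a homogeneous ideal $L \subseteq S$ containing $x_1^2,\dots,x_6^2$ such that $\dim_K (S_t/I_t) = \dim_K (S_t/L_t)$ for all $t \geq 0$.
   Context: $S=K[x_1,\dots,x_6]$ carries the standard grading ($\deg x_i = 1$). $S_t$ denotes the $K$-vector space of homogeneous polynomials of degree $t$ (together with $0$), and for a homogeneous ideal $J \subseteq S$, $J_t = J \cap S_t$ denotes its degree-$t$ component. A quadric is an element of $S_2$. The Hilbert function of $S/J$ is $t \mapsto \dim_K(S_t/J_t)$. Eisenbud--Green--Harris (EGH) conjecture: if a homogeneous ideal $I \subseteq K[x_1,\dots,x_n]$ contains a regular sequence $f_1,\dots,f_n$ of homogeneous elements of degrees $2 \le a_1 \le \cdots \le a_n$, then $I$ has the same Hilbert function as a homogeneous ideal containing $x_1^{a_1},\dots,x_n^{a_n}$; here $n=6$ and all $a_i = 2$. "Almost complete intersection" means that $I$ is minimally generated by one more element than its height, i.e. here $g \notin (f_1,\dots,f_6)$. *)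

theory Defs
  imports Complex_Main "HOL-Library.Poly_Mapping" "HOL-Library.Numeral_Type"
begin

section \<open>Dimension of a quotient of vector spaces\<close>

text \<open>The cosets \<open>b + W\<close> for \<open>b \<in> B\<close> are pairwise distinct and form a (finite) basis of \<open>U / W\<close>.
  The argument \<open>sc\<close> is the scalar multiplication, as in the locale \<open>vector_space\<close>.\<close>

definition is_basis_mod ::
    "('a::field \<Rightarrow> 'b::ab_group_add \<Rightarrow> 'b) \<Rightarrow> 'b set \<Rightarrow> 'b set \<Rightarrow> 'b set \<Rightarrow> bool" where
  "is_basis_mod sc U W B \<longleftrightarrow> finite B \<and> B \<subseteq> U \<and>
     (\<forall>u\<in>U. \<exists>c. u - (\<Sum>b\<in>B. sc (c b) b) \<in> W) \<and>
     (\<forall>c. (\<Sum>b\<in>B. sc (c b) b) \<in> W \<longrightarrow> (\<forall>b\<in>B. c b = 0))"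

text \<open>Only meaningful if \<open>W \<subseteq> U\<close> are subspaces and \<open>U / W\<close> has finite dimension; the lemmas
  \<open>is_basis_mod_exists\<close> and \<open>is_basis_mod_card\<close> give well-definedness when \<open>U\<close> is finite-dimensional.\<close>

definition dim_quot ::
    "('a::field \<Rightarrow> 'b::ab_group_add \<Rightarrow> 'b) \<Rightarrow> 'b set \<Rightarrow> 'b set \<Rightarrow> nat" where
  "dim_quot sc U W = (THE n. \<exists>B. is_basis_mod sc U W B \<and> card B = n)"

context vector_space
begin

lemma is_basis_mod_card:
  assumes U: "subspace U" and W: "subspace W" and WU: "W \<subseteq> U"
    and fin: "U \<subseteq> span F" "finite F" and B: "is_basis_mod (*s) U W B"
  shows "card B + dim W = dim U"
proof -
  obtain A where A: "A \<subseteq> W" "independent A" "W \<subseteq> span A" "card A = dim W"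
    using basis_exists by blast
  have finA: "finite A"
    using independent_span_bound[OF fin(2) A(2)] A(1) WU fin(1) by blast
  have spA: "span A = W" using A W by (simp add: span_subspace)
  have finB: "finite B" and BU: "B \<subseteq> U"
    and gen: "\<And>u. u \<in> U \<Longrightarrow> \<exists>c. u - (\<Sum>b\<in>B. c b *s b) \<in> W"
    and ind: "\<And>c b. (\<Sum>b\<in>B. c b *s b) \<in> W \<Longrightarrow> b \<in> B \<Longrightarrow> c b = 0"
    using B unfolding is_basis_mod_def by auto
  have disj: "A \<inter> B = {}"
  proof (rule ccontr)
    assume "A \<inter> B \<noteq> {}"
    then obtain b where b: "b \<in> A" "b \<in> B" by blast
    have "(\<Sum>x\<in>B. (if x = b then 1 else 0) *s x) = (\<Sum>x\<in>B. if x = b then x else 0)"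
      by (rule sum.cong) auto
    also have "\<dots> = b" using finB b by simp
    finally have "(\<Sum>x\<in>B. (if x = b then 1 else 0) *s x) \<in> W" using A b by auto
    from ind[OF this b(2)] show False by simp
  qed
  have indep: "independent (A \<union> B)"
    unfolding independent_explicit_finite_subsets
  proof (intro allI impI ballI)
    fix T u v assume T: "T \<subseteq> A \<union> B" "finite T" and s: "(\<Sum>v\<in>T. u v *s v) = 0" and v: "v \<in> T"
    define c where "c x = (if x \<in> T then u x else 0)" for x
    have "(\<Sum>v\<in>A \<union> B. c v *s v) = (\<Sum>v\<in>T. u v *s v)"
      by (rule sum.mono_neutral_cong_right) (use T finA finB in \<open>auto simp: c_def\<close>)
    with s have z: "(\<Sum>v\<in>A. c v *s v) + (\<Sum>v\<in>B. c v *s v) = 0"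
      using sum.union_disjoint[OF finA finB disj, of "\<lambda>v. c v *s v"] by simp
    have "(\<Sum>v\<in>A. c v *s v) \<in> W"
      using A(1) W by (meson subspace_sum subspace_scale subsetD)
    then have "- (\<Sum>v\<in>A. c v *s v) \<in> W" using W by (simp add: subspace_neg)
    with z have "(\<Sum>v\<in>B. c v *s v) \<in> W" by (metis minus_unique)
    then have cB: "c b = 0" if "b \<in> B" for b using ind that by blast
    then have "(\<Sum>v\<in>B. c v *s v) = 0" by (intro sum.neutral) auto
    with z have "(\<Sum>v\<in>A. c v *s v) = 0" by simp
    then have "c a = 0" if "a \<in> A" for a
      using independentD[OF A(2) finA subset_refl] that by blast
    with cB v T show "u v = 0" by (metis Un_iff c_def subsetD)
  qed
  have "U \<subseteq> span (A \<union> B)"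
  proof
    fix u assume "u \<in> U"
    then obtain c where c: "u - (\<Sum>b\<in>B. c b *s b) \<in> W" using gen by blast
    have "u - (\<Sum>b\<in>B. c b *s b) \<in> span (A \<union> B)"
      using c spA span_mono[of A "A \<union> B"] by blast
    moreover have "(\<Sum>b\<in>B. c b *s b) \<in> span (A \<union> B)"
      by (intro span_sum span_scale span_base) auto
    ultimately show "u \<in> span (A \<union> B)" using span_add by fastforce
  qed
  then have "dim U = card (A \<union> B)"
    using basis_card_eq_dim[OF _ _ indep, of U] A(1) WU BU by auto
  then show ?thesis using card_Un_disjoint[OF finA finB disj] A(4) by simp
qed

lemma is_basis_mod_exists:
  assumes U: "subspace U" and W: "subspace W" and WU: "W \<subseteq> U"
    and fin: "U \<subseteq> span F" "finite F"
  obtains B where "is_basis_mod (*s) U W B"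
proof -
  obtain A where A: "A \<subseteq> W" "independent A" "W \<subseteq> span A"
    using basis_exists[of W] by metis
  have spA: "span A = W" using A W by (simp add: span_subspace)
  obtain C where C: "A \<subseteq> C" "C \<subseteq> U" "independent C" "U \<subseteq> span C"
    using maximal_independent_subset_extend[of A U] A WU by blast
  have finC: "finite C"
    using independent_span_bound[OF fin(2) C(3)] C(2) fin(1) by blast
  define B where "B = C - A"
  have finB: "finite B" and finA: "finite A" using finC C(1) finite_subset by (auto simp: B_def)
  have split: "(\<Sum>v\<in>C. c v *s v) = (\<Sum>v\<in>A. c v *s v) + (\<Sum>v\<in>B. c v *s v)" for c
    using sum.subset_diff[OF C(1) finC] by (simp add: B_def add.commute)
  have "is_basis_mod (*s) U W B"
    unfolding is_basis_mod_def
  proof (intro conjI ballI allI impI)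
    show "finite B" by (fact finB)
    show "B \<subseteq> U" using C by (auto simp: B_def)
  next
    fix u assume "u \<in> U"
    then have "u \<in> span C" using C by blast
    then obtain c where "u = (\<Sum>v\<in>C. c v *s v)"
      using span_finite[OF finC] by auto
    then have "u - (\<Sum>b\<in>B. c b *s b) = (\<Sum>v\<in>A. c v *s v)" by (simp add: split)
    also have "\<dots> \<in> W" using A(1) W by (meson subspace_sum subspace_scale subsetD)
    finally show "\<exists>c. u - (\<Sum>b\<in>B. c b *s b) \<in> W" by blast
  next
    fix c b assume s: "(\<Sum>b\<in>B. c b *s b) \<in> W" and b: "b \<in> B"
    then obtain d where d: "(\<Sum>b\<in>B. c b *s b) = (\<Sum>v\<in>A. d v *s v)"
      using span_finite[OF finA] spA by auto
    define e where "e x = (if x \<in> A then - d x else c x)" for x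
    have "(\<Sum>v\<in>A. e v *s v) = (\<Sum>v\<in>A. - (d v *s v))"
      by (rule sum.cong) (auto simp: e_def)
    moreover have "(\<Sum>v\<in>B. e v *s v) = (\<Sum>v\<in>B. c v *s v)"
      by (rule sum.cong) (auto simp: e_def B_def)
    ultimately have "(\<Sum>v\<in>C. e v *s v) = 0"
      using d by (simp add: split sum_negf)
    then have "e b = 0"
      using independentD[OF C(3) finC subset_refl] b by (auto simp: B_def)
    then show "c b = 0" using b by (auto simp: e_def B_def)
  qed
  then show thesis by (rule that)
qed

lemma dim_quot_eq:
  assumes "subspace U" "subspace W" "W \<subseteq> U" "U \<subseteq> span F" "finite F"
  shows "dim_quot (*s) U W + dim W = dim U"
proof -
  obtain B where B: "is_basis_mod (*s) U W B" using is_basis_mod_exists[OF assms] by blast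
  have "dim_quot (*s) U W = card B"
    unfolding dim_quot_def
  proof (rule the_equality)
    show "\<exists>B'. is_basis_mod (*s) U W B' \<and> card B' = card B" using B by blast
    fix n assume "\<exists>B'. is_basis_mod (*s) U W B' \<and> card B' = n"
    then show "n = card B"
      using is_basis_mod_card[OF assms] is_basis_mod_card[OF assms B] by (metis add_right_cancel)
  qed
  then show ?thesis using is_basis_mod_card[OF assms B] by simp
qed

end

section \<open>Ideals and regular sequences in commutative rings\<close>

text \<open>Ideals are the submodules of the ring; \<open>ideal_gen F\<close> is the ideal generated by \<open>F\<close>.\<close>

global_interpretation ring_ideal: module "(*) :: 'a::comm_ring_1 \<Rightarrow> 'a \<Rightarrow> 'a"
  defines ideal_gen = ring_ideal.span and is_ideal = ring_ideal.subspace
  by unfold_locales (auto simp: algebra_simps)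

definition regular_sequence :: "'a::comm_ring_1 list \<Rightarrow> bool" where
  "regular_sequence fs \<longleftrightarrow>
     (\<forall>i<length fs. \<forall>h. fs ! i * h \<in> ideal_gen (set (take i fs)) \<longrightarrow> h \<in> ideal_gen (set (take i fs))) \<and>
     ideal_gen (set fs) \<noteq> UNIV"

section \<open>Graded polynomial rings\<close>

text \<open>Polynomials over \<open>'k\<close> in the variables indexed by \<open>'n\<close>: finitely supported functions from
  exponent vectors to coefficients, with the convolution product.\<close>

type_synonym ('n, 'k) mpoly = "('n \<Rightarrow>\<^sub>0 nat) \<Rightarrow>\<^sub>0 'k"

definition mvar :: "'n \<Rightarrow> ('n, 'k::field) mpoly" where
  "mvar i = Poly_Mapping.single (Poly_Mapping.single i 1) 1"

definition mconst :: "'k \<Rightarrow> ('n, 'k::field) mpoly" where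
  "mconst c = Poly_Mapping.single 0 c"

global_interpretation mpoly: vector_space "\<lambda>(c::'k::field) (p::('n, 'k) mpoly). mconst c * p"
  by unfold_locales
    (auto simp: mconst_def distrib_left distrib_right single_add mult_single simp flip: mult.assoc)

definition mdeg :: "('n::finite \<Rightarrow>\<^sub>0 nat) \<Rightarrow> nat" where
  "mdeg m = (\<Sum>i\<in>UNIV. Poly_Mapping.lookup m i)"

definition homog :: "nat \<Rightarrow> ('n::finite, 'k::field) mpoly set" where
  "homog t = {p. \<forall>m\<in>Poly_Mapping.keys p. mdeg m = t}"

definition homogeneous_ideal :: "('n::finite, 'k::field) mpoly set \<Rightarrow> bool" where
  "homogeneous_ideal J \<longleftrightarrow> (\<exists>F. F \<subseteq> (\<Union>t. homog t) \<and> J = ideal_gen F)"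

definition hilbert_fun :: "('n::finite, 'k::field) mpoly set \<Rightarrow> nat \<Rightarrow> nat" where
  "hilbert_fun J t = dim_quot (\<lambda>c p. mconst c * p) (homog t) (J \<inter> homog t)"

lemma lookup_mconst_times:
  "Poly_Mapping.lookup (mconst c * p) m = c * Poly_Mapping.lookup p m"
  by (simp add: mconst_def flip: mult_map_scale_conv_mult) (simp add: map.rep_eq when_def)

lemma subspace_homog: "mpoly.subspace (homog t)"
  unfolding mpoly.subspace_def homog_def
  by (auto simp: in_keys_iff lookup_mconst_times lookup_add)

lemma subspace_ideal: "is_ideal J \<Longrightarrow> mpoly.subspace J"
  unfolding mpoly.subspace_def ring_ideal.subspace_def by blast

lemma finite_mdeg: "finite {m :: 'n::finite \<Rightarrow>\<^sub>0 nat. mdeg m = t}"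
proof (rule finite_imageD)
  show "inj_on Poly_Mapping.lookup {m :: 'n \<Rightarrow>\<^sub>0 nat. mdeg m = t}"
    by (rule inj_onI) simp
  have "Poly_Mapping.lookup m i \<le> mdeg m" for m :: "'n \<Rightarrow>\<^sub>0 nat" and i
    unfolding mdeg_def by (rule member_le_sum) auto
  then have "Poly_Mapping.lookup ` {m :: 'n \<Rightarrow>\<^sub>0 nat. mdeg m = t}
      \<subseteq> {f. \<forall>i. (i \<in> UNIV \<longrightarrow> f i \<in> {..t}) \<and> (i \<notin> UNIV \<longrightarrow> f i = 0)}"
    by auto
  then show "finite (Poly_Mapping.lookup ` {m :: 'n \<Rightarrow>\<^sub>0 nat. mdeg m = t})"
    by (rule finite_subset) (rule finite_set_of_finite_funs; simp)
qed

lemma homog_finite_span: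
  "\<exists>F. finite F \<and> (homog t :: ('n::finite, 'k::field) mpoly set) \<subseteq> mpoly.span F"
proof (intro exI conjI subsetI)
  let ?F = "(\<lambda>m. Poly_Mapping.single m (1::'k)) ` {m :: 'n \<Rightarrow>\<^sub>0 nat. mdeg m = t}"
  show "finite ?F" using finite_mdeg by blast
  fix p :: "('n, 'k) mpoly" assume p: "p \<in> homog t"
  have "p = (\<Sum>m\<in>Poly_Mapping.keys p. mconst (Poly_Mapping.lookup p m) * Poly_Mapping.single m 1)"
    by (rule poly_mapping_eqI)
      (auto simp: lookup_sum lookup_mconst_times lookup_single when_def in_keys_iff if_distrib cong: if_cong)
  also have "\<dots> \<in> mpoly.span ?F"
    by (intro mpoly.span_sum mpoly.span_scale mpoly.span_base) (use p in \<open>auto simp: homog_def\<close>)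
  finally show "p \<in> mpoly.span ?F" .
qed

lemma hilbert_fun_eq:
  fixes J :: "('n::finite, 'k::field) mpoly set"
  assumes "is_ideal J"
  shows "hilbert_fun J t + mpoly.dim (J \<inter> homog t) = mpoly.dim (homog t :: ('n, 'k) mpoly set)"
proof -
  obtain F :: "('n, 'k) mpoly set" where F: "finite F" "homog t \<subseteq> mpoly.span F"
    using homog_finite_span by metis
  have "mpoly.subspace (J \<inter> homog t)"
    by (intro mpoly.subspace_inter subspace_homog subspace_ideal[OF assms])
  from mpoly.dim_quot_eq[OF subspace_homog this _ F(2) F(1)] show ?thesis
    unfolding hilbert_fun_def by simp
qed

end

theory Submission
  imports "HOL-Algebra.Algebraic_Closure_Type" "HOL-Library.FuncSet" Defs
begin

text \<open>For a regular sequence \<open>f\<close> of six quadrics, \<open>S/(f)\<close> has Hilbert function \<open>6 choose t\<close>, and comparing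
  Koszul cohomology along the sequence shows that its socle lies in degree 6, so it is Gorenstein. Hence
  \<open>B = S/((f) : g)\<close> is Gorenstein with Hilbert function \<open>1, p, a, p, 1\<close>, and the Hilbert function of
  \<open>S/I\<close> is \<open>6 choose t\<close> minus that of \<open>B\<close> shifted by 2. As dimensions do not change under field
  extension, \<open>K\<close> may be taken algebraically closed.

  The pair \<open>(p, a)\<close> is constrained because \<open>B\<close> is a quotient by an ideal that contains quadrics without a
  common zero. Such an ideal needs at least as many quadrics as there are variables left; no nonzero quadric
  of \<open>B\<close> induces a form of rank one on linear forms, since the point defining that form would be a common zero;
  linear zero divisors \<open>l x = 0\<close> exist as soon as \<open>a < 2 p - 2\<close>, by the dimension of the Segre variety; and
  a square pencil of multiplications has a singular member. What remains is \<open>(4, 6)\<close>, \<open>(5, 8..10)\<close> and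
  \<open>(6, 9..15)\<close>, and each of these is attained by \<open>x\<^sub>1\<^sup>2, \<dots>, x\<^sub>6\<^sup>2\<close> together with squarefree monomials.\<close>

text \<open>The numbers come from the combinatorial side. A monomial ideal that contains all squares
  of variables and has the required Hilbert function is an upward closed family of subsets of the
  six variables with 1, p, a, p, 1 members of sizes 2, ..., 6. The supersets of one pair already
  number 4, 6, 4 in sizes 3, 4, 5; one or two further triples raise the number of quadruples to at
  least 8 for p = 5 and 9 for p = 6, and p(p-1)/2 is the upper bound. The algebra has to produce
  exactly these inequalities. The upper bound and p < 4 are easy. The obstacle is p >= 5 with 6 <= a
  <= 8, above all (6, 8). There, subspaces X, Y of linear forms with X Y = 0 make X V and Y V
  orthogonal in degree 2, where the pairing has rank a; this is played off against lower bounds for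
  products with V: 3 for one linear form, 5 for a pair of them, 3 for a pair of quadrics. Dimension
  theory enters only by comparing growth rates of numbers of monomials. Algebraic closedness enters
  only through common zeros of forms and eigenvalues of pencils.\<close>

no_notation Polynomials.var (\<open>X\<index>\<close>)

text \<open>As simplification rules these two reassociate products to the left and loop with \<open>mult_ac\<close>.\<close>

declare ring_ideal.scale_scale [simp del] mpoly.scale_scale [simp del]

section \<open>Finite-dimensional subspaces\<close>

context vector_space
begin

text \<open>\<open>dim\<close> is the cardinality of a basis, hence 0 for an infinite one, so
  comparisons of dimensions need this as a hypothesis.\<close>

definition fin_dim :: "'b set \<Rightarrow> bool" where
  "fin_dim X \<longleftrightarrow> (\<exists>F. finite F \<and> X \<subseteq> span F)"

end

context vector_space
begin

lemma fin_dim_basis: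
  assumes "fin_dim X"
  obtains B :: "'b set" where "B \<subseteq> X" "independent B" "X \<subseteq> span B" "card B = dim X" "finite B"
proof -
  obtain B where B: "B \<subseteq> X" "independent B" "X \<subseteq> span B" "card B = dim X"
    using basis_exists by blast
  obtain F where "finite F" "X \<subseteq> span F" using assms by (auto simp: fin_dim_def)
  then have "finite B" using independent_span_bound B by blast
  with B that show thesis by blast
qed

lemma fin_dim_mono: "fin_dim Y \<Longrightarrow> X \<subseteq> span Y \<Longrightarrow> fin_dim X"
  unfolding fin_dim_def by (meson order_trans span_minimal subspace_span)

lemma fin_dim_subset: "fin_dim Y \<Longrightarrow> X \<subseteq> Y \<Longrightarrow> fin_dim X"
  by (meson fin_dim_mono order_trans span_superset)

lemma fin_dim_finite: "finite F \<Longrightarrow> fin_dim F"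
  unfolding fin_dim_def using span_superset by blast

lemma fin_dim_span: "fin_dim F \<Longrightarrow> fin_dim (span F)"
  by (rule fin_dim_mono[of F]) auto

lemma dim_mono_span:
  assumes "fin_dim Y" "X \<subseteq> span Y"
  shows "dim X \<le> dim Y"
proof -
  obtain B where B: "Y \<subseteq> span B" "card B = dim Y" "finite B" using fin_dim_basis[OF assms(1)] by metis
  then have "X \<subseteq> span B" using assms(2) by (meson order_trans span_minimal subspace_span)
  then show ?thesis using dim_le_card B by metis
qed

lemma dim_mono_subset: "fin_dim Y \<Longrightarrow> X \<subseteq> Y \<Longrightarrow> dim X \<le> dim Y"
  by (meson dim_mono_span order_trans span_superset)

lemma independent_card_le:
  assumes "fin_dim Y" "B \<subseteq> Y" "independent B"
  shows "finite B" "card B \<le> dim Y"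
proof -
  obtain F where "finite F" "Y \<subseteq> span F" using assms by (auto simp: fin_dim_def)
  then show "finite B" using independent_span_bound assms by blast
  show "card B \<le> dim Y"
    using dim_mono_subset[OF assms(1,2)] dim_eq_card_independent[OF assms(3)] by simp
qed

lemma subspace_dim_eq:
  assumes "subspace X" "X \<subseteq> Y" "fin_dim Y" "dim Y \<le> dim X"
  shows "X = Y"
proof (rule ccontr)
  assume "X \<noteq> Y"
  then obtain y where y: "y \<in> Y" "y \<notin> X" using assms by blast
  obtain B where B: "B \<subseteq> X" "independent B" "X \<subseteq> span B" "card B = dim X" "finite B"
    using fin_dim_basis fin_dim_subset assms by metis
  have "span B = X" using B assms(1) by (simp add: span_subspace)
  then have "independent (insert y B)" using y B independent_insertI by blast
  moreover have "y \<notin> B" using y B by blast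
  ultimately have "Suc (dim X) \<le> dim Y"
    using independent_card_le(2)[OF assms(3), of "insert y B"] B y assms(2) by auto
  with assms(4) show False by simp
qed

lemma complement_exists:
  assumes X: "subspace X" "fin_dim X" and R: "subspace R" "R \<subseteq> X"
  obtains U where "subspace U" "U \<subseteq> X" "U \<inter> R = {0}" "dim X = dim U + dim R"
    "\<And>x. x \<in> X \<Longrightarrow> \<exists>u\<in>U. \<exists>r\<in>R. x = u + r"
proof -
  obtain A where A: "A \<subseteq> R" "independent A" "R \<subseteq> span A" "card A = dim R"
    using basis_exists by blast
  have spA: "span A = R" using A R by (simp add: span_subspace)
  obtain C where C: "A \<subseteq> C" "C \<subseteq> X" "independent C" "X \<subseteq> span C"
    using maximal_independent_subset_extend[of A X] A R by blast
  have finC: "finite C" using independent_card_le X C by blast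
  define B where "B = C - A"
  have CAB: "C = A \<union> B" "A \<inter> B = {}" using C by (auto simp: B_def)
  have fin: "finite A" "finite B" using finC CAB by auto
  have indB: "independent B" using C(3) CAB independent_mono by auto
  have cC: "card C = dim X" using basis_card_eq_dim C by blast
  show thesis
  proof
    show "subspace (span B)" by simp
    show "span B \<subseteq> X" using X C CAB by (metis Un_subset_iff span_minimal)
    show "dim X = dim (span B) + dim R"
      using cC card_Un_disjoint[OF fin CAB(2)] CAB(1) A(4) dim_eq_card_independent[OF indB] by simp
    show "span B \<inter> R = {0}"
    proof (intro equalityI subsetI)
      fix v assume "v \<in> span B \<inter> R"
      then have "v \<in> span B" "v \<in> span A" using spA by auto
      then obtain c d where v: "v = (\<Sum>b\<in>B. c b *s b)" "v = (\<Sum>a\<in>A. d a *s a)"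
        unfolding span_finite[OF fin(1)] span_finite[OF fin(2)] by blast
      define e where "e x = (if x \<in> A then - d x else c x)" for x
      have "(\<Sum>x\<in>C. e x *s x) = (\<Sum>x\<in>A. e x *s x) + (\<Sum>x\<in>B. e x *s x)"
        unfolding CAB(1) by (rule sum.union_disjoint) (use fin CAB in auto)
      also have "(\<Sum>x\<in>A. e x *s x) = (\<Sum>x\<in>A. - (d x *s x))"
        by (rule sum.cong) (auto simp: e_def)
      also have "(\<Sum>x\<in>B. e x *s x) = (\<Sum>x\<in>B. c x *s x)"
        by (rule sum.cong) (use CAB in \<open>auto simp: e_def\<close>)
      finally have "(\<Sum>x\<in>C. e x *s x) = 0" using v by (simp add: sum_negf)
      then have e0: "e b = 0" if "b \<in> C" for b
        using independentD[OF C(3) finC subset_refl] that by blast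
      have "c b = 0" if "b \<in> B" for b
      proof -
        have "b \<in> C" "b \<notin> A" using that CAB by blast+
        then show ?thesis using e0[of b] by (simp add: e_def)
      qed
      then have "v = 0" using v(1) by (simp add: sum.neutral)
      then show "v \<in> {0}" by simp
    qed (use subspace_0[OF R(1)] span_zero in auto)
    fix x assume "x \<in> X"
    then have "x \<in> span (B \<union> A)" using C CAB by (metis Un_commute subsetD)
    then show "\<exists>u\<in>span B. \<exists>r\<in>R. x = u + r" using spA by (auto simp: span_Un)
  qed
qed

lemma span_image_sum:
  assumes "v \<in> span (f ` I)" "finite I"
  shows "\<exists>c. v = (\<Sum>i\<in>I. c i *s f i)"
  using assms(1)
proof (induction rule: span_induct_alt)
  case base
  show ?case by (rule exI[of _ "\<lambda>_. 0"]) simp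
next
  case (step a x y)
  then obtain i c where i: "i \<in> I" "x = f i" "y = (\<Sum>i\<in>I. c i *s f i)" by blast
  have "(\<Sum>j\<in>I. (c j + (if j = i then a else 0)) *s f j)
      = y + (\<Sum>j\<in>I. if j = i then a *s f j else 0)"
    unfolding i by (subst sum.distrib[symmetric]) (rule sum.cong, auto simp: scale_left_distrib)
  also have "\<dots> = y + a *s x" using assms(2) i by simp
  finally have "a *s x + y = (\<Sum>j\<in>I. (c j + (if j = i then a else 0)) *s f j)"
    by (simp add: add.commute)
  then show ?case by (rule exI[of _ "\<lambda>j. c j + (if j = i then a else 0)"])
qed

text \<open>If no member lay in the span of its predecessors, X would contain independent families
  of every size. The relation is packed into a univariate polynomial because its roots are used
  later: as eigenvalues of a pencil and as coordinates of a zero.\<close>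

lemma sequence_dependent:
  assumes X: "fin_dim X" and wX: "\<And>k. w k \<in> X"
  shows "\<exists>p. p \<noteq> 0 \<and> (\<Sum>k\<le>Polynomial.degree p. coeff p k *s w k) = 0"
proof -
  have "\<exists>m. w m \<in> span (w ` {..<m})"
  proof (rule ccontr)
    assume no: "\<not> (\<exists>m. w m \<in> span (w ` {..<m}))"
    have "independent (w ` {..<m}) \<and> card (w ` {..<m}) = m" for m
    proof (induction m)
      case (Suc m)
      have "w m \<notin> w ` {..<m}" using no span_base[of "w m" "w ` {..<m}"] by metis
      then show ?case using Suc no independent_insertI[of "w m" "w ` {..<m}"] by (auto simp: lessThan_Suc)
    qed (simp add: independent_empty)
    then have "m \<le> dim X" for m using independent_card_le(2)[OF X, of "w ` {..<m}"] wX by force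
    from this[of "Suc (dim X)"] show False by simp
  qed
  then obtain m c where m: "w m = (\<Sum>i<m. c i *s w i)" using span_image_sum by blast
  define p where "p = monom 1 m - (\<Sum>i<m. monom (c i) i)"
  have co: "coeff p k = (if k = m then 1 else if k < m then - c k else 0)" for k
    by (auto simp: p_def coeff_sum)
  have "(\<Sum>k\<le>Polynomial.degree p. coeff p k *s w k) = (\<Sum>k\<le>m. coeff p k *s w k)"
  proof (rule sum.mono_neutral_left)
    show "{..Polynomial.degree p} \<subseteq> {..m}" by (auto intro!: degree_le simp: co)
  qed (auto simp: coeff_eq_0)
  also have "\<dots> = (\<Sum>k<m. coeff p k *s w k) + w m" by (simp add: co flip: lessThan_Suc_atMost)
  also have "(\<Sum>k<m. coeff p k *s w k) = (\<Sum>k<m. - (c k *s w k))"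
    by (rule sum.cong) (auto simp: co)
  finally have "(\<Sum>k\<le>Polynomial.degree p. coeff p k *s w k) = 0" using m by (simp add: sum_negf)
  moreover have "p \<noteq> 0" using co[of m] by auto
  ultimately show ?thesis by blast
qed

text \<open>Linear maps are described by additivity and homogeneity on the whole space, so that the same
  lemmas serve for endomorphisms and for functionals.\<close>

lemma functional_kernel_dim:
  fixes \<phi> :: "'i \<Rightarrow> 'b \<Rightarrow> 'a"
  assumes "finite I" "subspace X" "fin_dim X"
    and add: "\<And>i x y. \<phi> i (x + y) = \<phi> i x + \<phi> i y" and sc: "\<And>i c x. \<phi> i (c *s x) = c * \<phi> i x"
  shows "dim X \<le> dim {x\<in>X. \<forall>i\<in>I. \<phi> i x = 0} + card I"
  using assms(1)
proof (induction I)
  case empty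
  then show ?case by simp
next
  case (insert i I)
  define Y where "Y = {x\<in>X. \<forall>i\<in>I. \<phi> i x = 0}"
  define Z where "Z = {x\<in>X. \<forall>i\<in>insert i I. \<phi> i x = 0}"
  have z0: "\<phi> j 0 = 0" for j using sc[of j 0 0] by simp
  have minus: "\<phi> j (x - y) = \<phi> j x - \<phi> j y" for j x y
    using add[of j "x - y" y] by simp
  have sY: "subspace Y" unfolding Y_def
    using assms(2) by (auto simp: subspace_def add sc z0)
  have ZY: "Z \<subseteq> Y" by (auto simp: Z_def Y_def)
  have fY: "fin_dim Y" "fin_dim Z" using assms(3) fin_dim_subset by (auto simp: Y_def Z_def)
  have "dim Y \<le> Suc (dim Z)"
  proof (cases "\<exists>y\<in>Y. \<phi> i y \<noteq> 0")
    case False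
    then have "Y = Z" by (auto simp: Y_def Z_def)
    then show ?thesis by simp
  next
    case True
    then obtain y0 where y0: "y0 \<in> Y" "\<phi> i y0 \<noteq> 0" by blast
    obtain B where B: "B \<subseteq> Z" "Z \<subseteq> span B" "card B = dim Z" "finite B"
      using fin_dim_basis fY by metis
    have "Y \<subseteq> span (insert y0 B)"
    proof
      fix y assume y: "y \<in> Y"
      let ?c = "\<phi> i y / \<phi> i y0"
      have "y - ?c *s y0 \<in> Z"
        using y y0 sY subspace_diff[OF sY y subspace_scale[OF sY y0(1)], of ?c]
        by (auto simp: Z_def Y_def minus sc)
      then have "y - ?c *s y0 \<in> span (insert y0 B)"
        using B span_mono[of B "insert y0 B"] by blast
      moreover have "?c *s y0 \<in> span (insert y0 B)" by (intro span_scale span_base) simp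
      ultimately show "y \<in> span (insert y0 B)" using span_add by fastforce
    qed
    then have "dim Y \<le> card (insert y0 B)" using dim_le_card B by blast
    also have "\<dots> \<le> Suc (dim Z)" using B by (simp add: card_insert_if)
    finally show ?thesis .
  qed
  then show ?case using insert by (simp add: Y_def Z_def)
qed

section \<open>Ranks of bilinear pairings\<close>

lemma pairing_dim_le:
  fixes \<Phi> :: "'b \<Rightarrow> 'b \<Rightarrow> 'a"
  assumes X: "subspace X" "fin_dim X" and Y: "fin_dim Y"
    and bil: "\<And>x x' y. \<Phi> (x + x') y = \<Phi> x y + \<Phi> x' y" "\<And>c x y. \<Phi> (c *s x) y = c * \<Phi> x y"
      "\<And>x y y'. \<Phi> x (y + y') = \<Phi> x y + \<Phi> x y'" "\<And>c x y. \<Phi> x (c *s y) = c * \<Phi> x y"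
    and nd: "\<And>x. x \<in> X \<Longrightarrow> (\<And>y. y \<in> Y \<Longrightarrow> \<Phi> x y = 0) \<Longrightarrow> x = 0"
  shows "dim X \<le> dim Y"
proof -
  obtain B where B: "B \<subseteq> Y" "Y \<subseteq> span B" "card B = dim Y" "finite B"
    using fin_dim_basis Y by metis
  have "{x\<in>X. \<forall>b\<in>B. \<Phi> x b = 0} \<subseteq> {0}"
  proof
    fix x assume x: "x \<in> {x\<in>X. \<forall>b\<in>B. \<Phi> x b = 0}"
    have "\<Phi> x y = 0" if "y \<in> span B" for y
      using that
    proof (induction rule: span_induct_alt)
      case base show ?case using bil(4)[of x 0 0] by simp
    next
      case (step c b y) then show ?case using x by (simp add: bil)
    qed
    then show "x \<in> {0}" using nd x B by blast
  qed
  then have "dim {x\<in>X. \<forall>b\<in>B. \<Phi> x b = 0} \<le> dim {0}"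
    by (intro dim_mono_subset fin_dim_finite) auto
  also have "dim {0} = 0" using dim_le_card[of "{0}" "{}"] by simp
  finally show ?thesis
    using functional_kernel_dim[OF B(4) X, of "\<lambda>b x. \<Phi> x b"] bil B(3) by simp
qed

text \<open>Row rank is at most column rank: with both radicals split off by complements U and V,
  only 0 in U pairs to zero with all of V, so dim U <= dim V. Exchanging X and Y gives the equality
  \<open>pairing_rank\<close>.\<close>

lemma pairing_rank_le:
  fixes \<Phi> :: "'b \<Rightarrow> 'b \<Rightarrow> 'a"
  assumes X: "subspace X" "fin_dim X" and Y: "subspace Y" "fin_dim Y"
    and bil: "\<And>x x' y. \<Phi> (x + x') y = \<Phi> x y + \<Phi> x' y" "\<And>c x y. \<Phi> (c *s x) y = c * \<Phi> x y"
      "\<And>x y y'. \<Phi> x (y + y') = \<Phi> x y + \<Phi> x y'" "\<And>c x y. \<Phi> x (c *s y) = c * \<Phi> x y"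
  shows "dim X + dim {y\<in>Y. \<forall>x\<in>X. \<Phi> x y = 0} \<le> dim Y + dim {x\<in>X. \<forall>y\<in>Y. \<Phi> x y = 0}"
proof -
  have z: "\<Phi> 0 y = 0" "\<Phi> x 0 = 0" for x y using bil(2)[of 0 0 y] bil(4)[of x 0 0] by simp_all
  define X' where "X' = {x\<in>X. \<forall>y\<in>Y. \<Phi> x y = 0}"
  define Y' where "Y' = {y\<in>Y. \<forall>x\<in>X. \<Phi> x y = 0}"
  have s: "subspace X'" "subspace Y'"
    using X Y unfolding X'_def Y'_def by (auto simp: subspace_def bil z)
  have sub: "X' \<subseteq> X" "Y' \<subseteq> Y" by (auto simp: X'_def Y'_def)
  obtain U where U: "subspace U" "U \<subseteq> X" "U \<inter> X' = {0}" "dim X = dim U + dim X'"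
    using complement_exists[OF X s(1) sub(1)] by metis
  obtain V where V: "V \<subseteq> Y" "dim Y = dim V + dim Y'" "\<And>y. y \<in> Y \<Longrightarrow> \<exists>u\<in>V. \<exists>r\<in>Y'. y = u + r"
    using complement_exists[OF Y s(2) sub(2)] by metis
  have "dim U \<le> dim V"
  proof (rule pairing_dim_le[of U V \<Phi>])
    fix x assume x: "x \<in> U" "\<And>y. y \<in> V \<Longrightarrow> \<Phi> x y = 0"
    have "\<Phi> x y = 0" if "y \<in> Y" for y
      using V(3)[OF that] x U(2) by (auto simp: bil Y'_def)
    then show "x = 0" using x U by (auto simp: X'_def)
  qed (use U V X Y bil fin_dim_subset in auto)
  then show ?thesis using U V by (simp add: X'_def Y'_def)
qed

lemma pairing_rank:
  fixes \<Phi> :: "'b \<Rightarrow> 'b \<Rightarrow> 'a"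
  assumes X: "subspace X" "fin_dim X" and Y: "subspace Y" "fin_dim Y"
    and bil: "\<And>x x' y. \<Phi> (x + x') y = \<Phi> x y + \<Phi> x' y" "\<And>c x y. \<Phi> (c *s x) y = c * \<Phi> x y"
      "\<And>x y y'. \<Phi> x (y + y') = \<Phi> x y + \<Phi> x y'" "\<And>c x y. \<Phi> x (c *s y) = c * \<Phi> x y"
  shows "dim X + dim {y\<in>Y. \<forall>x\<in>X. \<Phi> x y = 0} = dim Y + dim {x\<in>X. \<forall>y\<in>Y. \<Phi> x y = 0}"
  using pairing_rank_le[OF X Y, of \<Phi>] pairing_rank_le[OF Y X, of "\<lambda>y x. \<Phi> x y"] bil by simp

section \<open>Linear endomorphisms on a subspace\<close>

context
  fixes f :: "'b \<Rightarrow> 'b"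
  assumes add: "\<And>x y. f (x + y) = f x + f y" and sc: "\<And>c x. f (c *s x) = c *s f x"
begin

lemma endo_0: "f 0 = 0" using sc[of 0 0] by simp

lemma endo_sum: "f (\<Sum>i\<in>I. g i) = (\<Sum>i\<in>I. f (g i))"
  by (induction I rule: infinite_finite_induct) (auto simp: endo_0 add)

lemma endo_diff: "f (x - y) = f x - f y"
  using add[of "x - y" y] by simp

lemma subspace_endo_image: "subspace X \<Longrightarrow> subspace (f ` X)"
  unfolding subspace_def
proof (intro conjI ballI allI)
  assume X: "0 \<in> X \<and> (\<forall>x\<in>X. \<forall>y\<in>X. x + y \<in> X) \<and> (\<forall>c. \<forall>x\<in>X. c *s x \<in> X)"
  show "0 \<in> f ` X" using X endo_0 by (metis image_eqI)
  show "x + y \<in> f ` X" if "x \<in> f ` X" "y \<in> f ` X" for x y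
    using that X by (metis (no_types, opaque_lifting) add imageE image_eqI)
  show "c *s x \<in> f ` X" if "x \<in> f ` X" for c x
    using that X by (metis (no_types, opaque_lifting) sc imageE image_eqI)
qed

lemma subspace_endo_kernel: "subspace X \<Longrightarrow> subspace {x\<in>X. f x = 0}"
  by (auto simp: subspace_def endo_0 add sc)

lemma endo_image_span: "f ` span X = span (f ` X)"
proof
  have "f x \<in> span (f ` X)" if "x \<in> span X" for x
    using that by (induction rule: span_induct_alt) (auto simp: endo_0 add sc intro: span_zero span_add span_scale span_base)
  then show "f ` span X \<subseteq> span (f ` X)" by blast
  show "span (f ` X) \<subseteq> f ` span X"
    by (rule span_minimal) (auto intro: span_base subspace_endo_image)
qed

lemma fin_dim_endo_image: "fin_dim X \<Longrightarrow> fin_dim (f ` X)"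
  unfolding fin_dim_def by (metis endo_image_span finite_imageI image_mono)

lemma rank_nullity:
  assumes X: "subspace X" "fin_dim X"
  shows "dim X = dim (f ` X) + dim {x\<in>X. f x = 0}"
proof -
  define N where "N = {x\<in>X. f x = 0}"
  have N: "subspace N" "N \<subseteq> X" using subspace_endo_kernel X by (auto simp: N_def)
  obtain U where U: "subspace U" "U \<subseteq> X" "U \<inter> N = {0}" "dim X = dim U + dim N"
    "\<And>x. x \<in> X \<Longrightarrow> \<exists>u\<in>U. \<exists>r\<in>N. x = u + r"
    using complement_exists[OF X N] by blast
  have img: "f ` X = f ` U" using U(2,5) by (force simp: N_def add)
  obtain B where B: "B \<subseteq> U" "independent B" "U \<subseteq> span B" "card B = dim U" "finite B"
    using fin_dim_basis[OF fin_dim_subset[OF X(2) U(2)]] by metis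
  have ker: "u = 0" if "u \<in> U" "f u = 0" for u using that U(2,3) by (auto simp: N_def)
  have inj: "inj_on f U"
  proof (rule inj_onI)
    fix x y assume "x \<in> U" "y \<in> U" "f x = f y"
    then show "x = y" using ker[of "x - y"] subspace_diff[OF U(1)] by (simp add: endo_diff)
  qed
  have injB: "inj_on f B" using inj B inj_on_subset by blast
  have "independent (f ` B)"
    unfolding independent_explicit_finite_subsets
  proof (intro allI impI ballI)
    fix T u v assume T: "T \<subseteq> f ` B" "finite T" "(\<Sum>v\<in>T. u v *s v) = 0" "v \<in> T"
    then obtain T' where T': "T' \<subseteq> B" "T = f ` T'" using subset_imageE by meson
    have "f (\<Sum>b\<in>T'. u (f b) *s b) = (\<Sum>b\<in>T'. u (f b) *s f b)" by (simp add: endo_sum sc)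
    also have "\<dots> = (\<Sum>v\<in>T. u v *s v)"
      unfolding T'(2) using inj_on_subset[OF injB T'(1)] by (simp add: sum.reindex)
    finally have "(\<Sum>b\<in>T'. u (f b) *s b) = 0"
      using T ker[of "\<Sum>b\<in>T'. u (f b) *s b"] subspace_sum[OF U(1), of T' "\<lambda>b. u (f b) *s b"]
        subspace_scale[OF U(1)] T' B(1) by (metis subsetD)
    then show "u v = 0"
      using independentD[OF B(2) finite_subset[OF T'(1) B(5)] T'(1), of "\<lambda>b. u (f b)"] T(4) T'(2) by auto
  qed
  then have "dim (f ` U) = card B"
    using basis_card_eq_dim[of "f ` B" "f ` U"] B endo_image_span[of B] card_image[OF injB] by (metis image_mono)
  then show ?thesis using U(4) B(4) img by (simp add: N_def)
qed

end

end

text \<open>A square pencil is singular somewhere: if \<open>\<beta>\<close> is injective then iterating \<open>\<beta>\<^sup>-\<^sup>1 \<alpha>\<close> on a vector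
  gives an annihilating polynomial, and a root of one of minimal degree is an eigenvalue.\<close>

lemma singular_pencil:
  fixes sc :: "'a::alg_closed_field \<Rightarrow> 'b::ab_group_add \<Rightarrow> 'b"
  assumes "vector_space sc"
  assumes X: "module.subspace sc X" "vector_space.fin_dim sc X" "X \<noteq> {0}"
    and Y: "module.subspace sc Y" "vector_space.fin_dim sc Y" "vector_space.dim sc Y \<le> vector_space.dim sc X"
    and add: "\<And>x y. \<alpha> (x + y) = \<alpha> x + \<alpha> y" "\<And>x y. \<beta> (x + y) = \<beta> x + \<beta> y"
    and scale: "\<And>c x. \<alpha> (sc c x) = sc c (\<alpha> x)" "\<And>c x. \<beta> (sc c x) = sc c (\<beta> x)"
    and maps: "\<And>x. x \<in> X \<Longrightarrow> \<alpha> x \<in> Y" "\<And>x. x \<in> X \<Longrightarrow> \<beta> x \<in> Y"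
  obtains s t x where "(s, t) \<noteq> (0, 0)" "x \<in> X" "x \<noteq> 0" "sc s (\<alpha> x) + sc t (\<beta> x) = 0"
proof -
  interpret V: vector_space sc by fact
  obtain x0 where x0: "x0 \<in> X" "x0 \<noteq> 0" using X V.subspace_0[OF X(1)] by blast
  show thesis
  proof (cases "\<exists>x\<in>X. x \<noteq> 0 \<and> \<beta> x = 0")
    case True
    then obtain x where "x \<in> X" "x \<noteq> 0" "\<beta> x = 0" by blast
    then show thesis using that[of 0 1 x] by simp
  next
    case False
    then have "{x\<in>X. \<beta> x = 0} = {0}"
      using V.subspace_0[OF X(1)] V.endo_0[of \<beta>] add scale by auto
    moreover have "V.dim {0} = 0" using V.dim_le_card[of "{0}" "{}"] by simp
    ultimately have "V.dim X = V.dim (\<beta> ` X)"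
      using V.rank_nullity[of \<beta> X] add scale X by simp
    \<comment> \<open>Injectivity and dim Y <= dim X make \<beta> onto, so \<open>T\<close> can pick
      preimages and stands for the inverse of \<beta> composed with \<alpha>.\<close>
    then have img: "\<beta> ` X = Y"
      using V.subspace_dim_eq[of "\<beta> ` X" Y] V.subspace_endo_image[of \<beta> X] add scale X Y maps
      by (metis image_subsetI)
    then have "\<forall>x\<in>X. \<exists>x'\<in>X. \<beta> x' = \<alpha> x" using maps by (metis imageE)
    then obtain T where T: "\<And>x. x \<in> X \<Longrightarrow> T x \<in> X \<and> \<beta> (T x) = \<alpha> x" by metis
    define w where "w k = (T ^^ k) x0" for k
    have wX: "w k \<in> X" for k unfolding w_def by (induction k) (use x0 T in auto)
    have w: "\<beta> (w (Suc k)) = \<alpha> (w k)" for k using T[OF wX[of k]] by (simp add: w_def)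
    define ev where "ev p = (\<Sum>k\<le>Polynomial.degree p. sc (coeff p k) (w k))" for p
    have "\<exists>p. p \<noteq> 0 \<and> ev p = 0"
      unfolding ev_def by (rule V.sequence_dependent[OF X(2) wX])
    then obtain p0 where "p0 \<noteq> 0 \<and> ev p0 = 0" by blast
    from arg_min_nat_lemma[of "\<lambda>p. p \<noteq> 0 \<and> ev p = 0", OF this, of Polynomial.degree]
    obtain p where p: "p \<noteq> 0" "ev p = 0" "\<And>q. q \<noteq> 0 \<Longrightarrow> ev q = 0 \<Longrightarrow> Polynomial.degree p \<le> Polynomial.degree q"
      by blast
    have "Polynomial.degree p \<noteq> 0"
    proof
      assume d: "Polynomial.degree p = 0"
      then have "sc (coeff p 0) x0 = 0" using p(2) by (simp add: ev_def w_def)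
      then show False using x0 p(1) d by (metis V.scale_eq_0_iff leading_coeff_0_iff)
    qed
    then obtain r where "poly p r = 0" using alg_closed_imp_poly_has_root by blast
    then obtain q where q: "p = [:- r, 1:] * q" using poly_eq_0_iff_dvd by (metis dvdE)
    have q0: "q \<noteq> 0" using q p by auto
    define n where "n = Polynomial.degree q"
    have degp: "Polynomial.degree p = Suc n"
      using q0 by (simp add: q n_def degree_mult_eq degree_pCons_eq_if del: mult_pCons_left)
    have evq: "ev q \<noteq> 0" using p(3)[OF q0] degp n_def by auto
    have "ev q = (\<Sum>k\<le>n. sc (coeff q k) (w k))" by (simp add: ev_def n_def)
    \<comment> \<open>For p = (X - r) q the left side is \<beta> applied to (T - r) q(T) x0, that is
      to \<open>ev p\<close>, which is 0. Minimality of the degree of p keeps \<open>ev q\<close>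
      nonzero.\<close>
    then have *: "\<alpha> (ev q) - sc r (\<beta> (ev q)) = \<beta> (\<Sum>k\<le>n. sc (coeff q k) (w (Suc k) - sc r (w k)))"
      by (simp add: V.endo_sum[of \<alpha>] V.endo_sum[of \<beta>] V.endo_diff[of \<beta>] add scale V.scale_sum_right w
          V.scale_right_diff_distrib V.scale_left_commute sum_subtractf mult.commute)
    have "(\<Sum>k\<le>n. sc (coeff q k) (w (Suc k) - sc r (w k)))
        = (\<Sum>k\<le>n. sc (coeff q k) (w (Suc k))) - (\<Sum>k\<le>n. sc (r * coeff q k) (w k))"
      by (simp add: V.scale_right_diff_distrib sum_subtractf mult.commute)
    also have "(\<Sum>k\<le>n. sc (coeff q k) (w (Suc k))) = (\<Sum>k\<le>Suc n. sc (coeff (pCons 0 q) k) (w k))"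
      by (simp add: sum.atMost_Suc_shift del: sum.atMost_Suc)
    also have "(\<Sum>k\<le>n. sc (r * coeff q k) (w k)) = (\<Sum>k\<le>Suc n. sc (r * coeff q k) (w k))"
      using coeff_eq_0[of q "Suc n"] n_def by simp
    also have "(\<Sum>k\<le>Suc n. sc (coeff (pCons 0 q) k) (w k)) - (\<Sum>k\<le>Suc n. sc (r * coeff q k) (w k))
        = (\<Sum>k\<le>Suc n. sc (coeff p k) (w k))"
      unfolding sum_subtractf[symmetric] V.scale_left_diff_distrib[symmetric]
      by (rule sum.cong) (auto simp: q)
    also have "\<dots> = 0" using p(2) degp by (simp add: ev_def)
    finally have "\<alpha> (ev q) - sc r (\<beta> (ev q)) = 0" using * V.endo_0[of \<beta>] add scale by simp
    moreover have "ev q \<in> X" unfolding ev_def by (intro V.subspace_sum X V.subspace_scale wX)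
    ultimately show thesis using that[of 1 "- r" "ev q"] evq by simp
  qed
qed

section \<open>Polynomials\<close>

abbreviation "lookup \<equiv> Poly_Mapping.lookup"
abbreviation "keys \<equiv> Poly_Mapping.keys"
abbreviation "single \<equiv> Poly_Mapping.single"
abbreviation mscale :: "'k::field \<Rightarrow> ('n, 'k) mpoly \<Rightarrow> ('n, 'k) mpoly" where
  "mscale c p \<equiv> mconst c * p"

lemma mconst_simps [simp]:
  "mconst 0 = 0" "mconst 1 = 1" "mconst (a + b) = mconst a + mconst b"
  "mconst (a * b) = mconst a * mconst b" "mconst (- a) = - mconst a" "mconst (a - b) = mconst a - mconst b"
  by (simp_all add: mconst_def single_add mult_single single_uminus single_diff)

lemma mconst_eq_0_iff [simp]: "mconst c = 0 \<longleftrightarrow> c = 0"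
  unfolding mconst_def by (metis lookup_single_eq single_zero)

lemma mconst_sum: "mconst (\<Sum>i\<in>I. f i) = (\<Sum>i\<in>I. mconst (f i))"
  by (induction I rule: infinite_finite_induct) auto

lemma mconst_mult_single: "mconst c * single m a = single m (c * a)"
  by (simp add: mconst_def mult_single)

lemma mpoly_eq_sum_single: "p = (\<Sum>m\<in>keys p. single m (lookup p m))"
  by (rule poly_mapping_eqI) (auto simp: lookup_sum lookup_single when_def in_keys_iff)

lemma mpoly_eq_sum_scale: "p = (\<Sum>m\<in>keys p. mscale (lookup p m) (single m 1))"
  using mpoly_eq_sum_single[of p] by (simp add: mconst_mult_single)

lemma additive_eq_sum:
  fixes F :: "('n, 'k::field) mpoly \<Rightarrow> 'b::ab_group_add"
  assumes "\<And>p q. F (p + q) = F p + F q"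
  shows "F (\<Sum>i\<in>I. g i) = (\<Sum>i\<in>I. F (g i))"
proof -
  have "F 0 = 0" using assms[of 0 0] by simp
  then show ?thesis by (induction I rule: infinite_finite_induct) (auto simp: assms)
qed

text \<open>Both sides are biadditive, so monomials suffice; this serves evaluation as well as base
  change.\<close>

lemma additive_mult_on_single:
  fixes F :: "('n, 'k::field) mpoly \<Rightarrow> 'b::comm_ring_1"
  assumes add: "\<And>p q. F (p + q) = F p + F q"
    and mult: "\<And>m m' c c'. F (single m c * single m' c') = F (single m c) * F (single m' c')"
  shows "F (p * q) = F p * F q"
proof -
  have "F (p * q) = F ((\<Sum>m\<in>keys p. single m (lookup p m)) * (\<Sum>m\<in>keys q. single m (lookup q m)))"
    using mpoly_eq_sum_single by metis
  also have "\<dots> = (\<Sum>m\<in>keys p. F (single m (lookup p m))) * (\<Sum>m\<in>keys q. F (single m (lookup q m)))"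
    by (simp only: sum_product additive_eq_sum[of F, OF add] mult)
  also have "\<dots> = F (\<Sum>m\<in>keys p. single m (lookup p m)) * F (\<Sum>m\<in>keys q. single m (lookup q m))"
    by (simp only: additive_eq_sum[of F, OF add])
  also have "\<dots> = F p * F q"
    using mpoly_eq_sum_single by metis
  finally show ?thesis .
qed

lemma independent_monomials: "mpoly.independent ((\<lambda>m. single m (1::'k::field)) ` (M :: ('n \<Rightarrow>\<^sub>0 nat) set))"
  unfolding mpoly.independent_explicit_finite_subsets
proof (intro allI impI ballI)
  fix T :: "('n, 'k) mpoly set" and u v
  assume T: "T \<subseteq> (\<lambda>m. single m 1) ` M" "finite T" "(\<Sum>v\<in>T. mscale (u v) v) = 0" "v \<in> T"
  then obtain M' where M': "T = (\<lambda>m. single m 1) ` M'" using subset_imageE by meson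
  have inj: "inj_on (\<lambda>m. single m (1::'k)) M'"
    by (rule inj_onI) (metis lookup_single_eq lookup_single_not_eq one_neq_zero)
  obtain m where m: "m \<in> M'" "v = single m 1" using T M' by blast
  have fin: "finite M'" using T(2) M' inj finite_imageD by blast
  have "(\<Sum>v\<in>T. mscale (u v) v) = (\<Sum>m\<in>M'. single m (u (single m 1)))"
    unfolding M' using inj by (simp add: sum.reindex mconst_mult_single)
  then have "lookup (\<Sum>m\<in>M'. single m (u (single m 1))) m = 0" using T(3) by simp
  then show "u v = 0" using fin m by (simp add: lookup_sum lookup_single when_def)
qed

lemma inj_single_one: "inj (\<lambda>m. single m (1::'k::zero_neq_one))"
  by (rule injI) (metis lookup_single_eq lookup_single_not_eq one_neq_zero)

lemma span_monomials:
  "p \<in> mpoly.span ((\<lambda>m. single m (1::'k::field)) ` M) \<longleftrightarrow> keys p \<subseteq> M"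
proof
  assume "p \<in> mpoly.span ((\<lambda>m. single m (1::'k)) ` M)"
  then show "keys p \<subseteq> M"
  proof (induction rule: mpoly.span_induct_alt)
    case (step c x y)
    have "keys (mconst c * x) \<subseteq> keys x" by (auto simp: in_keys_iff lookup_mconst_times)
    moreover have "keys x \<subseteq> M" using step(1) by auto
    ultimately show ?case using step(2) keys_add[of "mconst c * x" y] by blast
  qed simp
next
  assume "keys p \<subseteq> M"
  then have "(\<Sum>m\<in>keys p. mscale (lookup p m) (single m 1)) \<in> mpoly.span ((\<lambda>m. single m (1::'k)) ` M)"
    by (intro mpoly.span_sum mpoly.span_scale mpoly.span_base) auto
  then show "p \<in> mpoly.span ((\<lambda>m. single m (1::'k)) ` M)" using mpoly_eq_sum_scale[of p] by metis
qed

lemma dim_monomials: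
  fixes M :: "('n \<Rightarrow>\<^sub>0 nat) set"
  assumes "finite M"
  shows "mpoly.dim {p :: ('n, 'k::field) mpoly. keys p \<subseteq> M} = card M"
proof -
  have "{p :: ('n, 'k) mpoly. keys p \<subseteq> M} = mpoly.span ((\<lambda>m. single m 1) ` M)"
    using span_monomials by blast
  then show ?thesis
    using mpoly.dim_span_eq_card_independent[OF independent_monomials[where 'k = 'k], of M]
      card_image[OF inj_on_subset[OF inj_single_one[where 'k = 'k] subset_UNIV], of M] by simp
qed

subsection \<open>Evaluation\<close>

text \<open>The map on coefficients is a parameter so that evaluation at a point (the identity) and
  substitution of polynomials for variables (\<open>mconst\<close>) share one theory.\<close>

definition mpeval :: "('k::field \<Rightarrow> 'r::comm_ring_1) \<Rightarrow> ('n::finite \<Rightarrow> 'r) \<Rightarrow> ('n, 'k) mpoly \<Rightarrow> 'r" where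
  "mpeval \<phi> y p = (\<Sum>m\<in>keys p. \<phi> (lookup p m) * (\<Prod>i\<in>UNIV. y i ^ lookup m i))"

locale coeff_hom =
  fixes \<phi> :: "'k::field \<Rightarrow> 'r::comm_ring_1"
  assumes hom_add: "\<phi> (a + b) = \<phi> a + \<phi> b" and hom_mult: "\<phi> (a * b) = \<phi> a * \<phi> b" and hom_1: "\<phi> 1 = 1"
begin

lemma hom_0: "\<phi> 0 = 0" using hom_add[of 0 0] by simp

lemma mpeval_single: "mpeval \<phi> y (single m c) = \<phi> c * (\<Prod>i\<in>UNIV. y i ^ lookup m i)"
  by (cases "c = 0") (auto simp: mpeval_def hom_0)

lemma mpeval_superset:
  assumes "finite M" "keys p \<subseteq> M"
  shows "mpeval \<phi> y p = (\<Sum>m\<in>M. \<phi> (lookup p m) * (\<Prod>i\<in>UNIV. y i ^ lookup m i))"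
  unfolding mpeval_def by (rule sum.mono_neutral_left) (use assms in \<open>auto simp: in_keys_iff hom_0\<close>)

lemma mpeval_add: "mpeval \<phi> y (p + q) = mpeval \<phi> y p + mpeval \<phi> y q"
proof -
  have "keys (p + q) \<subseteq> keys p \<union> keys q" by (rule keys_add)
  then show ?thesis
    using mpeval_superset[of "keys p \<union> keys q"] by (simp add: lookup_add hom_add distrib_right sum.distrib)
qed

lemma mpeval_mult:
  fixes y :: "'n::finite \<Rightarrow> 'r"
  shows "mpeval \<phi> y (p * q) = mpeval \<phi> y p * mpeval \<phi> y q"
proof (rule additive_mult_on_single[of "mpeval \<phi> y"])
  fix m m' :: "'n \<Rightarrow>\<^sub>0 nat" and c c' :: 'k
  have "(\<Prod>i\<in>UNIV. y i ^ lookup (m + m') i) = (\<Prod>i\<in>UNIV. y i ^ lookup m i) * (\<Prod>i\<in>UNIV. y i ^ lookup m' i)"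
    by (simp add: lookup_add power_add prod.distrib)
  then show "mpeval \<phi> y (single m c * single m' c') = mpeval \<phi> y (single m c) * mpeval \<phi> y (single m' c')"
    unfolding mult_single mpeval_single hom_mult by (simp only: mult.assoc mult.left_commute)
qed (rule mpeval_add)

lemma mpeval_sum: "mpeval \<phi> y (\<Sum>i\<in>I. g i) = (\<Sum>i\<in>I. mpeval \<phi> y (g i))"
  by (rule additive_eq_sum) (rule mpeval_add)

lemma mpeval_const: "mpeval \<phi> y (mconst c) = \<phi> c"
  by (simp add: mconst_def mpeval_single)

lemma mpeval_0: "mpeval \<phi> y 0 = 0" and mpeval_1: "mpeval \<phi> y 1 = 1"
  using mpeval_const[of y 0] mpeval_const[of y 1] by (simp_all add: hom_0 hom_1)

lemma mpeval_power: "mpeval \<phi> y (p ^ n) = mpeval \<phi> y p ^ n"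
  by (induction n) (auto simp: mpeval_1 mpeval_mult)

lemma mpeval_var: "mpeval \<phi> y (mvar i) = y i"
proof -
  have "(\<Prod>j\<in>UNIV. y j ^ lookup (single i (1::nat)) j) = (\<Prod>j\<in>UNIV. if j = i then y j else 1)"
    by (rule prod.cong) (auto simp: lookup_single when_def)
  then show ?thesis by (simp add: mvar_def mpeval_single hom_1)
qed

end

interpretation eval_id: coeff_hom "\<lambda>c. c" by unfold_locales auto
interpretation eval_const: coeff_hom mconst by unfold_locales auto

abbreviation peval :: "('n::finite \<Rightarrow> 'k::field) \<Rightarrow> ('n, 'k) mpoly \<Rightarrow> 'k" where
  "peval \<equiv> mpeval (\<lambda>c. c)"

subsection \<open>Homogeneous components\<close>

lemma mdeg_add: "mdeg (m + m') = mdeg m + mdeg m'"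
  by (simp add: mdeg_def lookup_add sum.distrib)

lemma mdeg_0 [simp]: "mdeg 0 = 0" by (simp add: mdeg_def)

lemma mdeg_single [simp]: "mdeg (single i k) = k"
  by (simp add: mdeg_def lookup_single when_def)

lemma mdeg_eq_0_iff: "mdeg m = 0 \<longleftrightarrow> m = 0"
  by (auto simp: mdeg_def intro: poly_mapping_eqI)

lemma homog_0 [simp]: "0 \<in> homog t" by (simp add: homog_def)

lemma homog_add: "p \<in> homog t \<Longrightarrow> q \<in> homog t \<Longrightarrow> p + q \<in> homog t"
  using mpoly.subspace_add[OF subspace_homog] .

lemma homog_diff: "p \<in> homog t \<Longrightarrow> q \<in> homog t \<Longrightarrow> p - q \<in> homog t"
  using mpoly.subspace_diff[OF subspace_homog] .

lemma homog_scale: "p \<in> homog t \<Longrightarrow> mscale c p \<in> homog t"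
  using mpoly.subspace_scale[OF subspace_homog] .

lemma homog_uminus: "p \<in> homog t \<Longrightarrow> - p \<in> homog t"
  using homog_diff[of 0 t p] by simp

lemma homog_sum: "(\<And>i. i \<in> I \<Longrightarrow> f i \<in> homog t) \<Longrightarrow> (\<Sum>i\<in>I. f i) \<in> homog t"
  by (rule mpoly.subspace_sum[OF subspace_homog]) auto

lemma homog_single: "mdeg m = t \<Longrightarrow> single m c \<in> homog t"
  by (auto simp: homog_def)

lemma homog_mvar: "mvar i \<in> homog 1"
  by (simp add: mvar_def homog_single)

lemma homog_mconst: "mconst c \<in> homog 0"
  by (simp add: mconst_def homog_single)

lemma homog_1: "1 \<in> homog 0"
  using homog_mconst[of 1] by simp

lemma homog_mult: "p \<in> homog a \<Longrightarrow> q \<in> homog b \<Longrightarrow> p * q \<in> homog (a + b)"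
  unfolding homog_def using keys_mult[of p q] by (fastforce simp: mdeg_add)

lemma homog_mvar_power: "mvar i ^ k \<in> homog k"
proof (induction k)
  case (Suc k)
  then show ?case using homog_mult[OF homog_mvar[of i] Suc] by simp
qed (simp add: homog_1)

lemma homog_zero_iff: "p \<in> homog 0 \<Longrightarrow> p = mconst (lookup p 0)"
  by (rule poly_mapping_eqI)
    (auto simp: homog_def mconst_def lookup_single when_def in_keys_iff mdeg_eq_0_iff)

definition hcomp :: "nat \<Rightarrow> ('n::finite, 'k::field) mpoly \<Rightarrow> ('n, 'k) mpoly" where
  "hcomp t p = (\<Sum>m\<in>{m\<in>keys p. mdeg m = t}. single m (lookup p m))"

lemma lookup_hcomp: "lookup (hcomp t p) m = (if mdeg m = t then lookup p m else 0)"
  by (auto simp: hcomp_def lookup_sum lookup_single when_def in_keys_iff)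

lemma hcomp_homog: "hcomp t p \<in> homog t"
  by (auto simp: homog_def in_keys_iff lookup_hcomp split: if_splits)

lemma hcomp_add: "hcomp t (p + q) = hcomp t p + hcomp t q"
  by (rule poly_mapping_eqI) (simp add: lookup_hcomp lookup_add)

lemma hcomp_diff: "hcomp t (p - q) = hcomp t p - hcomp t q"
  by (rule poly_mapping_eqI) (simp add: lookup_hcomp lookup_minus)

lemma hcomp_0 [simp]: "hcomp t 0 = 0"
  by (rule poly_mapping_eqI) (simp add: lookup_hcomp)

lemma hcomp_sum: "hcomp t (\<Sum>i\<in>I. f i) = (\<Sum>i\<in>I. hcomp t (f i))"
  by (rule additive_eq_sum) (rule hcomp_add)

lemma hcomp_scale: "hcomp t (mscale c p) = mscale c (hcomp t p)"
  by (rule poly_mapping_eqI) (simp add: lookup_hcomp lookup_mconst_times)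

lemma hcomp_of_homog: "p \<in> homog u \<Longrightarrow> hcomp t p = (if t = u then p else 0)"
  by (rule poly_mapping_eqI) (auto simp: lookup_hcomp homog_def in_keys_iff)

lemma hcomp_same [simp]: "p \<in> homog t \<Longrightarrow> hcomp t p = p"
  by (simp add: hcomp_of_homog)

lemma sum_hcomp:
  assumes "\<And>m. m \<in> keys p \<Longrightarrow> mdeg m \<le> N"
  shows "p = (\<Sum>t\<le>N. hcomp t p)"
proof (rule poly_mapping_eqI)
  fix m
  have "lookup (\<Sum>t\<le>N. hcomp t p) m = (\<Sum>t\<le>N. if mdeg m = t then lookup p m else 0)"
    by (simp add: lookup_sum lookup_hcomp)
  also have "\<dots> = lookup p m" using assms[of m] by (auto simp: in_keys_iff)
  finally show "lookup p m = lookup (\<Sum>t\<le>N. hcomp t p) m" by simp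
qed

lemma sum_hcomp_ex: "\<exists>N. p = (\<Sum>t\<le>N. hcomp t p)"
  using sum_hcomp[of p "Max (mdeg ` keys p)"] by auto

lemma hcomp_mult:
  assumes q: "q \<in> homog a"
  shows "hcomp t (q * p) = (if a \<le> t then q * hcomp (t - a) p else 0)"
proof -
  obtain N where N: "p = (\<Sum>s\<le>N. hcomp s p)" using sum_hcomp_ex by blast
  \<comment> \<open>\<open>M\<close> is at least t, so the only surviving index t - a is in the
    range of summation.\<close>
  define M where "M = max N t"
  have p: "p = (\<Sum>s\<le>M. hcomp s p)"
  proof (rule sum_hcomp)
    fix m assume "m \<in> keys p"
    then have "lookup (\<Sum>s\<le>N. hcomp s p) m \<noteq> 0" using N by (metis in_keys_iff)
    then have "mdeg m \<le> N" by (auto simp: lookup_sum lookup_hcomp split: if_splits)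
    then show "mdeg m \<le> M" by (simp add: M_def)
  qed
  have "hcomp t (q * p) = (\<Sum>s\<le>M. hcomp t (q * hcomp s p))"
    by (subst p) (simp add: sum_distrib_left hcomp_sum)
  also have "\<dots> = (\<Sum>s\<le>M. if t = a + s then q * hcomp s p else 0)"
    by (rule sum.cong) (use hcomp_of_homog[OF homog_mult[OF q hcomp_homog]] in auto)
  also have "\<dots> = (\<Sum>s\<in>{..M}. if s = t - a \<and> a \<le> t then q * hcomp s p else 0)"
    by (rule sum.cong) auto
  also have "\<dots> = (if a \<le> t then q * hcomp (t - a) p else 0)"
    by (auto simp: M_def)
  finally show ?thesis .
qed

lemma fin_dim_homog: "mpoly.fin_dim (homog t :: ('n::finite, 'k::field) mpoly set)"
  unfolding mpoly.fin_dim_def using homog_finite_span by blast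

text \<open>Each monomial is assigned to one variable \<open>v m\<close> dividing it; grouping by
  that variable gives the cofactors \<open>q i\<close>.\<close>

lemma homog_Suc:
  assumes "p \<in> homog (Suc t)"
  obtains q where "p = (\<Sum>i\<in>UNIV. mvar i * q i)" "\<And>i. q i \<in> homog t"
proof -
  have ex: "\<exists>i. lookup m i \<noteq> 0" if "m \<in> keys p" for m
  proof (rule ccontr)
    assume "\<not> (\<exists>i. lookup m i \<noteq> 0)"
    then have "mdeg m = 0" by (simp add: mdeg_def)
    then show False using assms that by (auto simp: homog_def)
  qed
  define v where "v m = (SOME i. lookup m i \<noteq> 0)" for m :: "'a \<Rightarrow>\<^sub>0 nat"
  have v: "lookup m (v m) \<noteq> 0" if "m \<in> keys p" for m
    unfolding v_def using someI_ex[OF ex[OF that]] .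
  have m: "single (v m) 1 + (m - single (v m) 1) = m" if "m \<in> keys p" for m
    by (rule poly_mapping_eqI) (use v[OF that] in \<open>auto simp: lookup_add lookup_minus lookup_single when_def\<close>)
  define q where "q i = (\<Sum>m\<in>{m\<in>keys p. v m = i}. single (m - single i 1) (lookup p m))" for i
  have "(\<Sum>i\<in>UNIV. mvar i * q i) = (\<Sum>i\<in>UNIV. \<Sum>m\<in>{m\<in>keys p. v m = i}. single m (lookup p m))"
    unfolding q_def sum_distrib_left
    by (intro sum.cong refl) (use m in \<open>auto simp: mvar_def mult_single\<close>)
  also have "\<dots> = (\<Sum>m\<in>keys p. single m (lookup p m))"
    using sum.group[of "keys p" UNIV v "\<lambda>m. single m (lookup p m)"] by simp
  finally have "p = (\<Sum>i\<in>UNIV. mvar i * q i)" using mpoly_eq_sum_single by metis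
  moreover have "q i \<in> homog t" for i
    unfolding q_def
  proof (intro homog_sum homog_single)
    fix m' assume m': "m' \<in> {m\<in>keys p. v m = i}"
    then have "1 + mdeg (m' - single i 1) = mdeg m'" using m[of m'] mdeg_add[of "single i 1"] by (metis (mono_tags, lifting) mdeg_single mem_Collect_eq)
    then show "mdeg (m' - single i 1) = t" using assms m' by (auto simp: homog_def)
  qed
  ultimately show thesis using that by blast
qed

subsection \<open>Ideals generated by homogeneous polynomials\<close>

lemma ideal_mult: "p \<in> ideal_gen F \<Longrightarrow> q * p \<in> ideal_gen F"
  by (rule ring_ideal.span_scale)

lemma hcomp_in_ideal:
  assumes F: "F \<subseteq> (\<Union>t. homog t)" and p: "p \<in> ideal_gen F"
  shows "hcomp t p \<in> ideal_gen F"
  using p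
proof (induction rule: ring_ideal.span_induct_alt)
  case base
  then show ?case by (simp add: ring_ideal.span_zero)
next
  case (step c x y)
  then obtain a where a: "x \<in> homog a" using F by blast
  have "hcomp t (c * x) \<in> ideal_gen F"
    using hcomp_mult[OF a, of t c] ideal_mult[OF ring_ideal.span_base[OF step(1)], of "hcomp (t - a) c"]
    by (auto simp: mult.commute ring_ideal.span_zero)
  then show ?case using step by (simp add: hcomp_add ring_ideal.span_add)
qed

lemma ideal_gen_finite:
  assumes "finite A" "p \<in> ideal_gen (h ` A)"
  obtains q where "p = (\<Sum>a\<in>A. q a * h a)"
proof -
  have "p \<in> ideal_gen (h ` A) \<Longrightarrow> \<exists>q. p = (\<Sum>a\<in>A. q a * h a)"
  proof (induction rule: ring_ideal.span_induct_alt)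
    case base
    show ?case by (rule exI[of _ "\<lambda>_. 0"]) simp
  next
    case (step c x y)
    then obtain b q where b: "b \<in> A" "x = h b" "y = (\<Sum>a\<in>A. q a * h a)" by blast
    have "(\<Sum>a\<in>A. (q a + (if a = b then c else 0)) * h a) = y + (\<Sum>a\<in>A. if a = b then c * h a else 0)"
      unfolding b by (subst sum.distrib[symmetric]) (rule sum.cong, auto simp: distrib_right)
    also have "\<dots> = c * x + y" using b assms(1) by (simp add: add.commute)
    finally show ?case by metis
  qed
  then show thesis using that assms(2) by blast
qed

section \<open>The number of generators of a primary ideal\<close>

lemma monomial_eq_prod:
  "single m (1::'k::field) = (\<Prod>i\<in>UNIV. mvar i ^ lookup m i)" for m :: "'n::finite \<Rightarrow>\<^sub>0 nat"
proof -
  have p: "mvar i ^ k = single (single i k) (1::'k)" for i :: 'n and k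
    by (induction k) (auto simp: mvar_def mult_single single_one simp flip: single_add)
  have "(\<Prod>i\<in>I. single (e i) (1::'k)) = single (\<Sum>i\<in>I. e i) 1" for I :: "'n set" and e :: "'n \<Rightarrow> 'n \<Rightarrow>\<^sub>0 nat"
    by (induction I rule: infinite_finite_induct) (auto simp: mult_single)
  moreover have "(\<Sum>i\<in>UNIV. single i (lookup m i)) = m"
    by (rule poly_mapping_eqI) (simp add: lookup_sum lookup_single when_def)
  ultimately show ?thesis by (simp add: p)
qed

text \<open>A polynomial of degree m cannot dominate one of larger degree. The constants are
  collected in \<open>C\<close>, and s = C already contradicts the assumption.\<close>

lemma exp_growth_le:
  fixes e f m n :: nat
  assumes "\<And>s. (s + 1) ^ n \<le> (e * (s + 1) + 1) ^ m * f"
  shows "n \<le> m"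
proof (rule ccontr)
  assume "\<not> n \<le> m"
  then have mn: "Suc m \<le> n" by simp
  define C where "C = (e + 1) ^ m * f"
  have "(C + 1) ^ Suc m \<le> (C + 1) ^ n" using mn by (intro power_increasing) auto
  also have "\<dots> \<le> (e * (C + 1) + 1) ^ m * f" by (rule assms)
  also have "\<dots> \<le> ((e + 1) * (C + 1)) ^ m * f" by (intro mult_right_mono power_mono) auto
  also have "\<dots> = ((e + 1) ^ m * f) * (C + 1) ^ m" by (simp only: power_mult_distrib mult_ac)
  also have "\<dots> = C * (C + 1) ^ m" by (simp only: C_def[symmetric])
  finally show False by simp
qed

text \<open>If the forms \<open>h a\<close> generate everything in large degrees (modulo the kernel of \<open>\<psi>\<close>), then
  products of the \<open>h a\<close> times finitely many monomials span the image of \<open>\<psi>\<close>; compare the growth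
  of their number with that of the number of monomials in the image.\<close>

lemma generators_count:
  fixes \<psi> :: "('n::finite, 'k::field) mpoly \<Rightarrow> ('w, 'k) mpoly" and h :: "'i \<Rightarrow> ('n, 'k) mpoly"
  assumes add: "\<And>p q. \<psi> (p + q) = \<psi> p + \<psi> q" and mult: "\<And>p q. \<psi> (p * q) = \<psi> p * \<psi> q"
    and const: "\<And>c. \<psi> (mconst c) = mconst c"
    and A: "finite A" and h: "\<And>a. a \<in> A \<Longrightarrow> h a \<in> homog (d a)" "\<And>a. a \<in> A \<Longrightarrow> d a \<ge> 1"
    and G: "G \<subseteq> (\<Union>t. homog t)" "\<And>g. g \<in> G \<Longrightarrow> \<psi> g = 0"
    and prim: "\<And>t p. t \<ge> N \<Longrightarrow> p \<in> homog t \<Longrightarrow> p \<in> ideal_gen (h ` A \<union> G)"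
    and E: "\<And>s. finite (E s)" "\<And>s. (s + 1) ^ n \<le> card (E s)"
      "\<And>s m. m \<in> E s \<Longrightarrow> \<exists>t\<le>e * (s + 1). \<exists>q\<in>homog t. \<psi> q = single m 1"
  shows "n \<le> card A"
proof -
  define F where "F = (\<lambda>m. \<psi> (single m 1)) ` {m. mdeg m < N}"
  have "{m :: 'n \<Rightarrow>\<^sub>0 nat. mdeg m < N} = (\<Union>t<N. {m. mdeg m = t})" by auto
  then have finF: "finite F" unfolding F_def using finite_mdeg by (metis finite_UN finite_imageI finite_lessThan)
  \<comment> \<open>Exponents are bounded one at a time by t, not by total degree: this keeps the
    number of products at most (t+1)^|A| |F|, of growth degree |A|.\<close>
  define P where "P t = (\<lambda>(\<alpha>, f). (\<Prod>a\<in>A. \<psi> (h a) ^ \<alpha> a) * f) ` ((A \<rightarrow>\<^sub>E {..t}) \<times> F)" for t :: nat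
  have finP: "finite (P t)" for t unfolding P_def using finF A by (simp add: finite_PiE)
  have cardP: "card (P t) \<le> (t + 1) ^ card A * card F" for t
  proof -
    have "card (P t) \<le> card ((A \<rightarrow>\<^sub>E {..t}) \<times> F)"
      unfolding P_def by (rule card_image_le) (use finF A in \<open>simp add: finite_PiE\<close>)
    also have "\<dots> = (t + 1) ^ card A * card F"
      using A by (simp add: card_cartesian_product card_PiE)
    finally show ?thesis .
  qed
  have monoP: "P t \<subseteq> P t'" if "t \<le> t'" for t t'
    unfolding P_def by (intro image_mono Sigma_mono PiE_mono) (use that in auto)
  have scale: "\<psi> (mscale c p) = mscale c (\<psi> p)" for c p by (simp add: mult const)
  have sum: "\<psi> (\<Sum>i\<in>I. g i) = (\<Sum>i\<in>I. \<psi> (g i))" for g :: "'x \<Rightarrow> _" and I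
    by (rule additive_eq_sum) (rule add)
  have ker: "\<psi> r = 0" if "r \<in> ideal_gen G" for r
    using that
  proof (induction rule: ring_ideal.span_induct_alt)
    case base
    show ?case using add[of 0 0] by simp
  qed (simp add: add mult G)
  have shift: "p * \<psi> (h a) \<in> mpoly.span (P t)" if "p \<in> mpoly.span (P u)" "a \<in> A" "u < t" for p a u t
    using that(1)
  proof (induction rule: mpoly.span_induct_alt)
    case base
    show ?case by (simp add: mpoly.span_zero)
  next
    case (step c x y)
    then obtain \<alpha> f where x: "\<alpha> \<in> A \<rightarrow>\<^sub>E {..u}" "f \<in> F" "x = (\<Prod>a\<in>A. \<psi> (h a) ^ \<alpha> a) * f"
      by (auto simp: P_def)
    define \<alpha>' where "\<alpha>' = \<alpha>(a := Suc (\<alpha> a))"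
    have lt: "\<alpha> b < t" if "b \<in> A" for b
      using PiE_mem[OF x(1) that] \<open>u < t\<close> by auto
    have \<alpha>': "\<alpha>' \<in> A \<rightarrow>\<^sub>E {..t}"
    proof (rule PiE_I)
      show "\<alpha>' b \<in> {..t}" if "b \<in> A" for b using lt[OF that] by (auto simp: \<alpha>'_def)
      show "\<alpha>' b = undefined" if "b \<notin> A" for b
        using PiE_arb[OF x(1) that] that \<open>a \<in> A\<close> by (auto simp: \<alpha>'_def)
    qed
    have "(\<Prod>b\<in>A. \<psi> (h b) ^ \<alpha>' b) = \<psi> (h a) ^ \<alpha>' a * (\<Prod>b\<in>A - {a}. \<psi> (h b) ^ \<alpha>' b)"
      using A that(2) by (rule prod.remove)
    also have "(\<Prod>b\<in>A - {a}. \<psi> (h b) ^ \<alpha>' b) = (\<Prod>b\<in>A - {a}. \<psi> (h b) ^ \<alpha> b)"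
      by (rule prod.cong) (auto simp: \<alpha>'_def)
    also have "\<psi> (h a) ^ \<alpha>' a * \<dots> = \<psi> (h a) * (\<Prod>b\<in>A. \<psi> (h b) ^ \<alpha> b)"
      using prod.remove[OF A that(2), of "\<lambda>b. \<psi> (h b) ^ \<alpha> b"] by (simp add: \<alpha>'_def mult.assoc)
    finally have "x * \<psi> (h a) = (\<Prod>b\<in>A. \<psi> (h b) ^ \<alpha>' b) * f" by (simp add: x(3) mult_ac)
    then have "x * \<psi> (h a) \<in> P t" unfolding P_def using \<alpha>' x(2) by force
    then have "mscale c (x * \<psi> (h a)) + y * \<psi> (h a) \<in> mpoly.span (P t)"
      using step by (intro mpoly.span_add mpoly.span_scale) (auto intro: mpoly.span_base)
    then show ?case by (simp add: distrib_right mult.assoc)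
  qed
  \<comment> \<open>Below degree N the monomials themselves give elements of \<open>F\<close>. From
    N on, p is modulo the kernel of \<psi> a combination of the \<open>h a\<close> with coefficients
    of smaller degree, since \<open>d a\<close> is positive; multiplying by
    \<open>\<psi> (h a)\<close> raises one exponent by 1.\<close>
  have claim: "p \<in> homog t \<Longrightarrow> \<psi> p \<in> mpoly.span (P t)" for p t
  proof (induction t arbitrary: p rule: less_induct)
    case (less t)
    show ?case
    proof (cases "t < N")
      case True
      have "\<psi> (single m 1) \<in> P t" if "m \<in> keys p" for m
      proof -
        have "\<psi> (single m 1) \<in> F" using that less.prems True by (auto simp: F_def homog_def)
        then have "(\<Prod>a\<in>A. \<psi> (h a) ^ (restrict (\<lambda>_. 0) A) a) * \<psi> (single m 1) \<in> P t"
          unfolding P_def by (intro image_eqI[of _ _ "(restrict (\<lambda>_. 0) A, \<psi> (single m 1))"]) auto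
        then show ?thesis by simp
      qed
      then have "(\<Sum>m\<in>keys p. mscale (lookup p m) (\<psi> (single m 1))) \<in> mpoly.span (P t)"
        by (intro mpoly.span_sum mpoly.span_scale mpoly.span_base) auto
      also have "(\<Sum>m\<in>keys p. mscale (lookup p m) (\<psi> (single m 1))) = \<psi> p"
        by (subst (3) mpoly_eq_sum_scale) (simp add: sum scale)
      finally show ?thesis .
    next
      case False
      then have "p \<in> ideal_gen (h ` A \<union> G)" using prim less.prems by (metis not_less)
      then obtain x r where p: "p = x + r" "x \<in> ideal_gen (h ` A)" "r \<in> ideal_gen G"
        by (auto simp: ring_ideal.span_Un)
      obtain q where q: "x = (\<Sum>a\<in>A. q a * h a)" using ideal_gen_finite A p(2) by metis
      have "p = hcomp t x + hcomp t r" using less.prems p(1) hcomp_add hcomp_same by metis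
      then have "\<psi> p = \<psi> (hcomp t x)" using ker hcomp_in_ideal[OF G(1) p(3)] by (simp add: add)
      also have "hcomp t x = (\<Sum>a\<in>A. (if d a \<le> t then hcomp (t - d a) (q a) else 0) * h a)"
        unfolding q hcomp_sum
      proof (rule sum.cong)
        fix a assume "a \<in> A"
        then show "hcomp t (q a * h a) = (if d a \<le> t then hcomp (t - d a) (q a) else 0) * h a"
          using hcomp_mult[OF h(1)[of a], of t "q a"] by (simp add: mult.commute)
      qed simp
      finally have "\<psi> p = (\<Sum>a\<in>A. \<psi> (if d a \<le> t then hcomp (t - d a) (q a) else 0) * \<psi> (h a))"
        by (simp add: sum mult)
      also have "\<dots> \<in> mpoly.span (P t)"
      proof (rule mpoly.span_sum)
        fix a assume a: "a \<in> A"
        show "\<psi> (if d a \<le> t then hcomp (t - d a) (q a) else 0) * \<psi> (h a) \<in> mpoly.span (P t)"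
        proof (cases "d a \<le> t")
          case True
          then have "t - d a < t" using h(2)[OF a] by simp
          then show ?thesis using shift[OF less.IH[OF _ hcomp_homog] a] True by simp
        next
          case False
          then show ?thesis using add[of 0 0] by (simp add: mpoly.span_zero)
        qed
      qed
      finally show ?thesis .
    qed
  qed
  have "(s + 1) ^ n \<le> (e * (s + 1) + 1) ^ card A * card F" for s
  proof -
    have "(\<lambda>m. single m (1::'k)) ` E s \<subseteq> mpoly.span (P (e * (s + 1)))"
    proof (intro image_subsetI)
      fix m assume "m \<in> E s"
      then obtain t q where t: "t \<le> e * (s + 1)" "q \<in> homog t" "\<psi> q = single m 1" using E(3) by blast
      then show "single m 1 \<in> mpoly.span (P (e * (s + 1)))"
        using claim[OF t(2)] mpoly.span_mono[OF monoP[OF t(1)]] by auto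
    qed
    then have "card ((\<lambda>m. single m (1::'k)) ` E s) \<le> card (P (e * (s + 1)))"
      using mpoly.independent_span_bound[OF finP independent_monomials] by blast
    then show ?thesis
      using E(2)[of s] cardP[of "e * (s + 1)"] card_image[OF inj_on_subset[OF inj_single_one[where 'k='k] subset_UNIV], of "E s"]
      by simp
  qed
  then show ?thesis by (rule exp_growth_le)
qed

lemma lookup_Abs_finite: "lookup (Abs_poly_mapping f) = f" for f :: "'n::finite \<Rightarrow> nat"
  by (rule lookup_Abs_poly_mapping) simp

lemma card_bounded_exponents:
  "finite {m :: 'n::finite \<Rightarrow>\<^sub>0 nat. \<forall>i. lookup m i \<le> s}"
  "card {m :: 'n \<Rightarrow>\<^sub>0 nat. \<forall>i. lookup m i \<le> s} = (s + 1) ^ CARD('n)"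
proof -
  have bij: "bij_betw Abs_poly_mapping (UNIV \<rightarrow>\<^sub>E {..s}) {m :: 'n \<Rightarrow>\<^sub>0 nat. \<forall>i. lookup m i \<le> s}"
    by (rule bij_betw_byWitness[where f' = lookup])
      (auto simp: lookup_Abs_finite PiE_def extensional_def Pi_def)
  then show "finite {m :: 'n::finite \<Rightarrow>\<^sub>0 nat. \<forall>i. lookup m i \<le> s}"
    using bij_betw_finite finite_PiE[of "UNIV :: 'n set" "\<lambda>_. {..s}"] by auto
  show "card {m :: 'n \<Rightarrow>\<^sub>0 nat. \<forall>i. lookup m i \<le> s} = (s + 1) ^ CARD('n)"
    using bij_betw_same_card[OF bij] card_PiE[of "UNIV :: 'n set" "\<lambda>_. {..s}"] by simp
qed

text \<open>Krull's height theorem for ideals primary to the irrelevant ideal, by counting: \<psi>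
  is the identity, and the (s+1)^n monomials with exponents at most s have degree at most n
  s.\<close>

lemma primary_generators_ge:
  fixes h :: "'i \<Rightarrow> ('n::finite, 'k::field) mpoly"
  assumes "finite A" "\<And>a. a \<in> A \<Longrightarrow> h a \<in> homog (d a)" "\<And>a. a \<in> A \<Longrightarrow> d a \<ge> 1"
    and prim: "\<And>t p. t \<ge> N \<Longrightarrow> p \<in> homog t \<Longrightarrow> p \<in> ideal_gen (h ` A)"
  shows "CARD('n) \<le> card A"
proof (rule generators_count[where \<psi> = "\<lambda>p. p" and h = h and d = d and G = "{}" and N = N and e = "CARD('n)"
      and E = "\<lambda>s. {m. \<forall>i. lookup m i \<le> s}"])
  fix s :: nat and m :: "'n \<Rightarrow>\<^sub>0 nat" assume m: "m \<in> {m. \<forall>i. lookup m i \<le> s}"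
  have "mdeg m \<le> (\<Sum>i\<in>(UNIV::'n set). s)" unfolding mdeg_def by (rule sum_mono) (use m in auto)
  then have "mdeg m \<le> CARD('n) * (s + 1)" by simp
  then show "\<exists>t\<le>CARD('n) * (s + 1). \<exists>q\<in>homog t. q = (single m 1 :: ('n, 'k) mpoly)"
    using homog_single by blast
qed (use assms card_bounded_exponents[where 'n = 'n] in auto)

section \<open>Common zeros over an algebraically closed field\<close>

lemma mconst_inverse: "c \<noteq> 0 \<Longrightarrow> mconst (1 / c) * mconst c = 1"
  using mconst_simps(4)[of "1 / c" c] by (simp del: mconst_simps(4))

lemma mem_ideal_insert:
  "(p :: 'r::comm_ring_1) \<in> ideal_gen (insert a F) \<longleftrightarrow> (\<exists>c. p - c * a \<in> ideal_gen F)"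
  by (simp add: ring_ideal.span_breakdown_eq)

section \<open>Zeros of proper ideals modulo which the variables are algebraic\<close>

definition upoly :: "'k::field poly \<Rightarrow> ('n, 'k) mpoly \<Rightarrow> ('n, 'k) mpoly" where
  "upoly \<pi> x = poly (map_poly mconst \<pi>) x"

lemma upoly_simps [simp]:
  "upoly 0 x = 0" "upoly (pCons c q) x = mconst c + x * upoly q x"
  by (simp_all add: upoly_def map_poly_pCons)

lemma upoly_add:
  fixes x :: "('n, 'k::field) mpoly"
  shows "upoly (p + q) x = upoly p x + upoly q x"
proof -
  have "map_poly mconst (p + q) = map_poly mconst p + (map_poly mconst q :: ('n, 'k) mpoly poly)"
    by (rule poly_eqI) (simp add: coeff_map_poly)
  then show ?thesis by (simp add: upoly_def)
qed

lemma upoly_smult: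
  fixes x :: "('n, 'k::field) mpoly"
  shows "upoly (smult c p) x = mconst c * upoly p x"
proof -
  have "map_poly mconst (smult c p) = smult (mconst c) (map_poly mconst p :: ('n, 'k) mpoly poly)"
    by (rule poly_eqI) (simp add: coeff_map_poly)
  then show ?thesis by (simp add: upoly_def)
qed

lemma upoly_linear_mult: "upoly ([:- a, 1:] * q) x = (x - mconst a) * upoly q x"
proof -
  have "[:- a, 1:] * q = pCons 0 q + smult (- a) q" by simp
  then show ?thesis by (simp only: upoly_add upoly_smult) (simp add: algebra_simps)
qed

lemma upoly_eq_sum:
  fixes x :: "('n, 'k::field) mpoly"
  shows "upoly \<pi> x = (\<Sum>k\<le>Polynomial.degree \<pi>. mscale (coeff \<pi> k) (x ^ k))"
proof -
  have "Polynomial.degree (map_poly mconst \<pi> :: ('n, 'k) mpoly poly) = Polynomial.degree \<pi>"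
    by (rule degree_map_poly) simp
  then show ?thesis by (simp add: upoly_def poly_altdef coeff_map_poly)
qed

text \<open>Roots of \<pi> are tried one by one. If adding x - a makes the ideal trivial, then x - a
  is invertible modulo M, so the cofactor q of the root a also satisfies
  \<open>upoly q x \<in> ideal_gen M\<close>. At degree 0 a nonzero constant would lie in the proper
  ideal.\<close>

lemma proper_ideal_root:
  fixes x :: "('n, 'k::alg_closed_field) mpoly"
  assumes "1 \<notin> ideal_gen M" "\<pi> \<noteq> 0" "upoly \<pi> x \<in> ideal_gen M"
  shows "\<exists>a. 1 \<notin> ideal_gen (insert (x - mconst a) M)"
  using assms(2,3)
proof (induction "Polynomial.degree \<pi>" arbitrary: \<pi>)
  case 0
  then obtain c where c: "\<pi> = [:c:]" "c \<noteq> 0" by (metis degree_eq_zeroE pCons_0_0)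
  then have "mconst c \<in> ideal_gen M" using 0 by simp
  then have "mconst (1 / c) * mconst c \<in> ideal_gen M" by (rule ideal_mult)
  then show ?case using assms(1) c mconst_inverse by metis
next
  case (Suc n)
  then obtain a where "poly \<pi> a = 0" using alg_closed_imp_poly_has_root[of \<pi>] by auto
  then obtain q where q: "\<pi> = [:- a, 1:] * q" using poly_eq_0_iff_dvd by (metis dvdE)
  have q0: "q \<noteq> 0" using q Suc by auto
  have deg: "n = Polynomial.degree q"
    using Suc(2) q0 by (simp add: q degree_mult_eq degree_pCons_eq_if del: mult_pCons_left)
  show ?case
  proof (rule ccontr)
    assume "\<nexists>a. 1 \<notin> ideal_gen (insert (x - mconst a) M)"
    then have "1 \<in> ideal_gen (insert (x - mconst a) M)" by blast
    then obtain c where "1 - c * (x - mconst a) \<in> ideal_gen M" unfolding mem_ideal_insert by blast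
    then have "upoly q x * (1 - c * (x - mconst a)) + c * upoly \<pi> x \<in> ideal_gen M"
      using ideal_mult Suc(4) by (metis ring_ideal.span_add)
    also have "upoly q x * (1 - c * (x - mconst a)) + c * upoly \<pi> x = upoly q x"
      unfolding q upoly_linear_mult by (simp add: algebra_simps)
    finally show False using Suc(1)[OF deg q0] \<open>\<nexists>a. 1 \<notin> ideal_gen (insert (x - mconst a) M)\<close> by blast
  qed
qed

lemma ideal_gen_mono: "F \<subseteq> G \<Longrightarrow> ideal_gen F \<subseteq> ideal_gen G"
  by (rule ring_ideal.span_mono)

text \<open>Adjoin x_i - a_i for one variable after the other, keeping the ideal proper. In the end
  every polynomial is congruent to its value at a, so an element of the ideal with nonzero value
  would put a unit into a proper ideal.\<close>

lemma proper_ideal_zero: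
  fixes M :: "('n::finite, 'k::alg_closed_field) mpoly set"
  assumes M: "1 \<notin> ideal_gen M" and alg: "\<And>i. \<exists>\<pi>. \<pi> \<noteq> 0 \<and> upoly \<pi> (mvar i) \<in> ideal_gen M"
  obtains a where "\<And>p. p \<in> ideal_gen M \<Longrightarrow> peval a p = 0"
proof -
  define Q where "Q a V = M \<union> (\<lambda>i. mvar i - mconst (a i)) ` V" for a :: "'n \<Rightarrow> 'k" and V
  have "\<exists>a. 1 \<notin> ideal_gen (Q a V)" for V
    using finite[of V]
  proof (induction V)
    case empty
    then show ?case using M by (simp add: Q_def)
  next
    case (insert i V)
    then obtain a where a: "1 \<notin> ideal_gen (Q a V)" by blast
    obtain \<pi> where "\<pi> \<noteq> 0" "upoly \<pi> (mvar i) \<in> ideal_gen M" using alg by blast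
    moreover have "ideal_gen M \<subseteq> ideal_gen (Q a V)" by (rule ideal_gen_mono) (auto simp: Q_def)
    ultimately obtain b where "1 \<notin> ideal_gen (insert (mvar i - mconst b) (Q a V))"
      using proper_ideal_root[OF a] by blast
    moreover have "Q (a(i := b)) (insert i V) = insert (mvar i - mconst b) (Q a V)"
      using insert(2) by (auto simp: Q_def)
    ultimately show ?case by metis
  qed
  then obtain a where a: "1 \<notin> ideal_gen (Q a UNIV)" by blast
  let ?Q = "ideal_gen (Q a UNIV)"
  \<comment> \<open>The polynomials congruent to their value form a subring containing constants and
    variables, hence everything.\<close>
  define C where "C = {p. p - mconst (peval a p) \<in> ?Q}"
  have mult: "p * q \<in> C" if "p \<in> C" "q \<in> C" for p q
  proof -
    have "q * (p - mconst (peval a p)) + mconst (peval a p) * (q - mconst (peval a q)) \<in> ?Q"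
      using that ideal_mult by (auto simp: C_def intro: ring_ideal.span_add)
    then show ?thesis by (simp add: C_def eval_id.mpeval_mult algebra_simps)
  qed
  have add: "p + q \<in> C" if "p \<in> C" "q \<in> C" for p q
    using ring_ideal.span_add[of "p - mconst (peval a p)" "Q a UNIV" "q - mconst (peval a q)"] that
    by (simp add: C_def eval_id.mpeval_add algebra_simps)
  have const: "mconst c \<in> C" for c by (simp add: C_def eval_id.mpeval_const ring_ideal.span_zero)
  have var: "mvar i \<in> C" for i
    by (auto simp: C_def eval_id.mpeval_var Q_def intro: ring_ideal.span_base)
  have pow: "mvar i ^ k \<in> C" for i k
    using const[of 1] by (induction k) (auto intro: mult var)
  have prod: "(\<Prod>i\<in>I. mvar i ^ e i) \<in> C" for I e
    using const[of 1] by (induction I rule: infinite_finite_induct) (auto intro: mult pow)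
  then have mono: "mconst c * single m 1 \<in> C" for c m
    unfolding monomial_eq_prod by (intro mult const prod)
  have "(\<Sum>m\<in>K. mscale (c m) (single m 1)) \<in> C" for K c
    using const[of 0] by (induction K rule: infinite_finite_induct) (auto intro: add mono)
  then have all: "p \<in> C" for p using mpoly_eq_sum_scale[of p] by metis
  show thesis
  proof (rule that)
    fix p assume "p \<in> ideal_gen M"
    then have "p \<in> ?Q" using ideal_gen_mono[of M "Q a UNIV"] by (auto simp: Q_def)
    moreover have "p - mconst (peval a p) \<in> ?Q" using all[of p] by (simp add: C_def)
    ultimately have "p - (p - mconst (peval a p)) \<in> ?Q" by (rule ring_ideal.span_diff)
    then have c: "mconst (peval a p) \<in> ?Q" by simp
    show "peval a p = 0"
    proof (rule ccontr)
      assume "peval a p \<noteq> 0"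
      then show False using ideal_mult[OF c, of "mconst (1 / peval a p)"] a mconst_inverse by metis
    qed
  qed
qed

text \<open>Add variables to the ideal until it becomes primary to the irrelevant ideal, and set the last
  variable added equal to 1: the quotient is finite-dimensional and nonzero.\<close>

lemma nonprimary_zero:
  fixes F :: "('n::finite, 'k::alg_closed_field) mpoly set"
  assumes F: "F \<subseteq> (\<Union>t. homog t)" and np: "\<And>N. \<exists>t\<ge>N. \<not> homog t \<subseteq> ideal_gen F"
  obtains a i where "a i \<noteq> 0" "\<And>p. p \<in> ideal_gen F \<Longrightarrow> peval a p = 0"
proof -
  define prim where "prim G \<longleftrightarrow> (\<exists>N. \<forall>t\<ge>N. homog t \<subseteq> ideal_gen G)" for G :: "('n, 'k) mpoly set"
  \<comment> \<open>With no variable added the ideal is not primary, with all of them it is; so at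
    some point a single variable x makes the difference.\<close>
  have "\<exists>V x. \<not> prim (F \<union> mvar ` V) \<and> prim (insert (mvar x) (F \<union> mvar ` V))"
  proof (rule ccontr)
    assume no: "\<not> ?thesis"
    have "\<not> prim (F \<union> mvar ` V)" for V
      using finite[of V]
    proof (induction V)
      case empty
      then show ?case using np by (auto simp: prim_def)
    next
      case (insert x V)
      then show ?case using no by (metis Un_insert_right image_insert)
    qed
    moreover have "prim (F \<union> mvar ` UNIV)"
      unfolding prim_def
    proof (intro exI allI impI subsetI)
      fix t and p :: "('n, 'k) mpoly" assume "(1::nat) \<le> t" "p \<in> homog t"
      then obtain q :: "'n \<Rightarrow> ('n, 'k) mpoly" where "p = (\<Sum>i\<in>UNIV. mvar i * q i)"
        by (metis homog_Suc Suc_le_D One_nat_def)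
      also have "\<dots> = (\<Sum>i\<in>UNIV. q i * mvar i)" by (simp add: mult.commute)
      also have "\<dots> \<in> ideal_gen (F \<union> mvar ` UNIV)"
        by (intro ring_ideal.span_sum ring_ideal.span_scale ring_ideal.span_base) auto
      finally show "p \<in> ideal_gen (F \<union> mvar ` UNIV)" .
    qed
    ultimately show False by blast
  qed
  then obtain V x where V: "\<not> prim (F \<union> mvar ` V)" "prim (insert (mvar x) (F \<union> mvar ` V))" by blast
  define F' where "F' = F \<union> mvar ` V"
  define X :: "('n, 'k) mpoly" where "X = mvar x"
  have hX: "X \<in> homog 1" unfolding X_def by (rule homog_mvar)
  have F': "F' \<subseteq> (\<Union>t. homog t)" using F homog_mvar by (auto simp: F'_def)
  obtain N where N: "\<And>t. t \<ge> N \<Longrightarrow> homog t \<subseteq> ideal_gen (insert X F')"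
    using V(2) by (auto simp: prim_def F'_def X_def)
  have step: "\<exists>q\<in>homog (t - 1). p - X * q \<in> ideal_gen F'" if "t \<ge> N" "t \<ge> 1" "p \<in> homog t" for t p
  proof -
    have "p \<in> ideal_gen (insert X F')" using N that by blast
    then obtain c where c: "p - c * X \<in> ideal_gen F'" unfolding mem_ideal_insert by blast
    have "hcomp t (p - c * X) = p - X * hcomp (t - 1) c"
      using that hcomp_mult[OF hX, of t c] by (simp add: hcomp_diff mult.commute)
    then show ?thesis using hcomp_in_ideal[OF F' c, of t] hcomp_homog by metis
  qed
  define M where "M = insert (X - 1) F'"
  have FM: "ideal_gen F' \<subseteq> ideal_gen M" unfolding M_def by (rule ideal_gen_mono) auto
  \<comment> \<open>Suppose 1 = c (X - 1) modulo F'. Comparing components degree by degree gives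
    that -X^t is congruent to the component of c in degree t. This component vanishes for large t,
    so a power of X lies in the ideal of F'. By \<open>step\<close> every form of large degree is a
    multiple of that power modulo F', making F' primary.\<close>
  have proper: "1 \<notin> ideal_gen M"
  proof
    assume "1 \<in> ideal_gen M"
    then obtain c where c: "1 - c * (X - 1) \<in> ideal_gen F'" by (auto simp: M_def mem_ideal_insert)
    have c0: "1 + hcomp 0 c \<in> ideal_gen F'"
      using hcomp_in_ideal[OF F' c, of 0] hcomp_mult[OF hX, of 0 c] homog_1[where 'a='n and 'b='k]
      by (simp add: hcomp_diff hcomp_add right_diff_distrib mult.commute)
    have cS: "hcomp (Suc t) c - X * hcomp t c \<in> ideal_gen F'" for t
      using hcomp_in_ideal[OF F' c, of "Suc t"] hcomp_mult[OF hX, of "Suc t" c]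
        hcomp_of_homog[OF homog_1[where 'a='n and 'b='k], of "Suc t"]
      by (simp add: hcomp_diff hcomp_add right_diff_distrib mult.commute)
    have pow: "hcomp t c + X ^ t \<in> ideal_gen F'" for t
    proof (induction t)
      case 0
      then show ?case using c0 by (simp add: add.commute)
    next
      case (Suc t)
      have "(hcomp (Suc t) c - X * hcomp t c) + X * (hcomp t c + X ^ t) \<in> ideal_gen F'"
        using cS Suc ideal_mult by (intro ring_ideal.span_add) auto
      then show ?case by (simp add: algebra_simps)
    qed
    obtain T where "c = (\<Sum>t\<le>T. hcomp t c)" using sum_hcomp_ex by blast
    then have "hcomp (Suc T) c = (\<Sum>t\<le>T. hcomp (Suc T) (hcomp t c))" by (metis hcomp_sum)
    also have "\<dots> = 0" by (rule sum.neutral) (auto simp: hcomp_of_homog[OF hcomp_homog])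
    finally have XT: "X ^ Suc T \<in> ideal_gen F'" using pow[of "Suc T"] by simp
    have red: "\<exists>q. p - X ^ k * q \<in> ideal_gen F' \<and> q \<in> homog (t - k)" if "t \<ge> N + k" "p \<in> homog t" for k t p
      using that
    proof (induction k)
      case 0
      then show ?case using ring_ideal.span_zero by (intro exI[of _ p]) auto
    next
      case (Suc k)
      then obtain q where q: "p - X ^ k * q \<in> ideal_gen F'" "q \<in> homog (t - k)" by auto
      obtain r where r: "q - X * r \<in> ideal_gen F'" "r \<in> homog (t - k - 1)"
        using step[OF _ _ q(2)] Suc.prems(1) by fastforce
      have "(p - X ^ k * q) + X ^ k * (q - X * r) \<in> ideal_gen F'"
        using q r ideal_mult by (intro ring_ideal.span_add) auto
      then show ?case using r by (intro exI[of _ r]) (auto simp: algebra_simps)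
    qed
    have "prim F'" unfolding prim_def
    proof (intro exI allI impI subsetI)
      fix t and p :: "('n, 'k) mpoly" assume "N + Suc T \<le> t" "p \<in> homog t"
      then obtain q where "p - X ^ Suc T * q \<in> ideal_gen F'" using red by blast
      then have "(p - X ^ Suc T * q) + q * X ^ Suc T \<in> ideal_gen F'"
        using ideal_mult XT by (intro ring_ideal.span_add) auto
      then show "p \<in> ideal_gen F'" by (simp add: mult.commute)
    qed
    then show False using V(1) by (simp add: F'_def)
  qed
  \<comment> \<open>Setting X = 1 turns a form of degree above N into one of lower degree, so
    \<open>W\<close> spans modulo \<open>M\<close>. The powers of each variable are therefore
    dependent modulo \<open>M\<close>.\<close>
  define W where "W = mpoly.span (\<Union>t\<le>N. homog t :: ('n, 'k) mpoly set)"
  have finW: "mpoly.fin_dim W"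
  proof -
    have "\<exists>E. finite E \<and> (homog t :: ('n, 'k) mpoly set) \<subseteq> mpoly.span E" for t by (rule homog_finite_span)
    then obtain E where E: "\<And>t. finite (E t)" "\<And>t. (homog t :: ('n, 'k) mpoly set) \<subseteq> mpoly.span (E t)" by metis
    have "(\<Union>t\<le>N. homog t) \<subseteq> mpoly.span (\<Union>t\<le>N. E t)" 
    proof (rule UN_least)
      fix t assume "t \<in> {..N}"
      then have "mpoly.span (E t) \<subseteq> mpoly.span (\<Union>t\<le>N. E t)" by (intro mpoly.span_mono) auto
      then show "homog t \<subseteq> mpoly.span (\<Union>t\<le>N. E t)" using E(2) by blast
    qed
    then have "W \<subseteq> mpoly.span (\<Union>t\<le>N. E t)" unfolding W_def by (simp add: mpoly.span_minimal)
    then show ?thesis unfolding mpoly.fin_dim_def using E(1) by blast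
  qed
  have sM: "mpoly.subspace (ideal_gen M)" by (rule subspace_ideal) simp
  have redW: "\<exists>w\<in>W. p - w \<in> ideal_gen M" if "p \<in> homog t" for p t
    using that
  proof (induction t arbitrary: p)
    case 0
    then have "p \<in> W" unfolding W_def by (intro mpoly.span_base) auto
    then show ?case using ring_ideal.span_zero by (intro bexI[of _ p]) auto
  next
    case (Suc t)
    show ?case
    proof (cases "Suc t \<le> N")
      case True
      then have "p \<in> W" unfolding W_def by (intro mpoly.span_base) (use Suc in auto)
      then show ?thesis using ring_ideal.span_zero by (intro bexI[of _ p]) auto
    next
      case False
      then obtain q where q: "q \<in> homog t" "p - X * q \<in> ideal_gen F'" using step[of "Suc t" p] Suc by auto
      obtain w where w: "w \<in> W" "q - w \<in> ideal_gen M" using Suc q by blast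
      have "q * (X - 1) \<in> ideal_gen M" by (intro ideal_mult ring_ideal.span_base) (simp add: M_def)
      then have "(p - X * q) + q * (X - 1) + (q - w) \<in> ideal_gen M"
        using q w FM by (intro ring_ideal.span_add) auto
      then show ?thesis using w by (intro bexI[of _ w]) (auto simp: algebra_simps)
    qed
  qed
  have "\<exists>\<pi>. \<pi> \<noteq> 0 \<and> upoly \<pi> (mvar i) \<in> ideal_gen M" for i
  proof -
    have "\<forall>k. \<exists>w. w \<in> W \<and> (mvar i ^ k :: ('n, 'k) mpoly) - w \<in> ideal_gen M"
      using redW homog_mvar_power by blast
    then obtain w where w: "\<And>k. w k \<in> W" "\<And>k. (mvar i ^ k :: ('n, 'k) mpoly) - w k \<in> ideal_gen M" by metis
    obtain \<pi> where \<pi>: "\<pi> \<noteq> 0" "(\<Sum>k\<le>Polynomial.degree \<pi>. mscale (coeff \<pi> k) (w k)) = 0"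
      using mpoly.sequence_dependent[of W w, OF finW w(1)] by metis
    have "(\<Sum>k\<le>Polynomial.degree \<pi>. mscale (coeff \<pi> k) (mvar i ^ k - w k)) \<in> ideal_gen M"
      by (intro ring_ideal.span_sum ideal_mult w)
    then have "upoly \<pi> (mvar i) \<in> ideal_gen M"
      using \<pi>(2) by (simp add: upoly_eq_sum right_diff_distrib sum_subtractf)
    then show ?thesis using \<pi> by blast
  qed
  then obtain a where a: "\<And>p. p \<in> ideal_gen M \<Longrightarrow> peval a p = 0"
    using proper_ideal_zero[OF proper] by blast
  have "peval a (X - 1) = 0" by (intro a ring_ideal.span_base) (simp add: M_def)
  then have "a x = 1"
    using eval_id.mpeval_add[of a "X - 1" 1] by (simp add: X_def eval_id.mpeval_var eval_id.mpeval_1)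
  then show thesis using that[of a x] a FM ideal_gen_mono[of F F'] by (auto simp: F'_def)
qed

text \<open>Pass to the Segre embedding: a nonzero common zero of the forms \<open>\<beta>(z)\<close> and of the \<open>2 \<times> 2\<close> minors
  of \<open>z = (z\<^sub>i\<^sub>j)\<close> is a matrix of rank one, and substituting \<open>z\<^sub>i\<^sub>j \<mapsto> l\<^sub>i x\<^sub>j\<close> counts dimensions.\<close>

lemma bilinear_zero:
  fixes \<beta> :: "'i \<Rightarrow> 'p::finite \<Rightarrow> 'p \<Rightarrow> 'k::alg_closed_field"
  assumes A: "finite A" "card A < 2 * CARD('p) - 2"
  obtains l x where "\<exists>i. l i \<noteq> 0" "\<exists>i. x i \<noteq> 0"
    "\<And>a. a \<in> A \<Longrightarrow> (\<Sum>i\<in>UNIV. \<Sum>j\<in>UNIV. \<beta> a i j * l i * x j) = 0"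
proof -
  define z :: "'p \<Rightarrow> 'p \<Rightarrow> ('p \<times> 'p, 'k) mpoly" where "z i j = mvar (i, j)" for i j
  define h where "h a = (\<Sum>i\<in>UNIV. \<Sum>j\<in>UNIV. mconst (\<beta> a i j) * z i j)" for a
  define G where "G = {z i j * z k l - z i l * z k j |i j k l. True}"
  have hz: "z i j \<in> homog 1" for i j unfolding z_def by (rule homog_mvar)
  have hh: "h a \<in> homog 1" for a unfolding h_def by (intro homog_sum homog_scale hz)
  have zz: "z i j * z k l \<in> homog 2" for i j k l using homog_mult[OF hz hz] by (simp add: numeral_2_eq_2)
  have G: "G \<subseteq> homog 2" by (auto simp: G_def intro: homog_diff zz)
  have "\<exists>t\<ge>N. \<not> homog t \<subseteq> ideal_gen (h ` A \<union> G)" for N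
  proof (rule ccontr)
    assume "\<not> ?thesis"
    then have prim: "\<And>t p. t \<ge> N \<Longrightarrow> p \<in> homog t \<Longrightarrow> p \<in> ideal_gen (h ` A \<union> G)" by blast
    \<comment> \<open>The Segre parametrization: \<open>Inl i\<close> stands for l_i and
      \<open>Inr j\<close> for x_j, so the minors in \<open>G\<close> map to 0.\<close>
    define y :: "'p \<times> 'p \<Rightarrow> ('p + 'p, 'k) mpoly" where "y = (\<lambda>(i, j). mvar (Inl i) * mvar (Inr j))"
    define \<psi> where "\<psi> = mpeval mconst y"
    have \<psi>z: "\<psi> (z i j) = mvar (Inl i) * mvar (Inr j)" for i j
      by (simp add: \<psi>_def z_def eval_const.mpeval_var y_def)
    define i0 :: 'p where "i0 = undefined"
    define ex where "ex \<gamma> \<delta> = (\<Sum>i\<in>UNIV. single (Inl i) (\<gamma> i)) + (\<Sum>j\<in>UNIV. single (Inr j) (\<delta> j))"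
      for \<gamma> \<delta> :: "'p \<Rightarrow> nat"
    have exl: "lookup (ex \<gamma> \<delta>) (Inl i) = \<gamma> i" "lookup (ex \<gamma> \<delta>) (Inr i) = \<delta> i" for \<gamma> \<delta> i
      by (simp_all add: ex_def lookup_add lookup_sum lookup_single when_def)
    have exadd: "ex (\<lambda>k. (if k = i then 1 else 0) + \<gamma> k) (\<lambda>k. (if k = j then 1 else 0) + \<delta> k)
        = single (Inl i) 1 + single (Inr j) 1 + ex \<gamma> \<delta>" for i j \<gamma> \<delta>
    proof (rule poly_mapping_eqI)
      fix k show "lookup (ex (\<lambda>k. (if k = i then 1 else 0) + \<gamma> k) (\<lambda>k. (if k = j then 1 else 0) + \<delta> k)) k
        = lookup (single (Inl i) 1 + single (Inr j) 1 + ex \<gamma> \<delta>) k"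
        by (cases k) (auto simp: exl lookup_add lookup_single when_def)
    qed
    \<comment> \<open>Factors l_i x_j are split off one at a time.\<close>
    have pre: "\<exists>q\<in>homog d. \<psi> q = single (ex \<gamma> \<delta>) 1" if "sum \<gamma> UNIV = d" "sum \<delta> UNIV = d" for d \<gamma> \<delta>
      using that
    proof (induction d arbitrary: \<gamma> \<delta>)
      case 0
      then have "ex \<gamma> \<delta> = 0" by (simp add: ex_def)
      then show ?case using homog_1 eval_const.mpeval_1 by (intro bexI[of _ 1]) (auto simp: \<psi>_def)
    next
      case (Suc d)
      then obtain i j where ij: "\<gamma> i \<noteq> 0" "\<delta> j \<noteq> 0" by (metis Zero_not_Suc sum.neutral)
      define \<gamma>' \<delta>' where "\<gamma>' = \<gamma>(i := \<gamma> i - 1)" and "\<delta>' = \<delta>(j := \<delta> j - 1)"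
      have e: "\<gamma> = (\<lambda>k. (if k = i then 1 else 0) + \<gamma>' k)" "\<delta> = (\<lambda>k. (if k = j then 1 else 0) + \<delta>' k)"
        using ij by (auto simp: \<gamma>'_def \<delta>'_def fun_eq_iff)
      have "sum \<gamma> UNIV = 1 + sum \<gamma>' UNIV" by (subst e(1)) (simp add: sum.distrib)
      moreover have "sum \<delta> UNIV = 1 + sum \<delta>' UNIV" by (subst e(2)) (simp add: sum.distrib)
      ultimately obtain q where q: "q \<in> homog d" "\<psi> q = single (ex \<gamma>' \<delta>') 1" using Suc by fastforce
      have "\<psi> (z i j * q) = single (ex \<gamma> \<delta>) 1"
        unfolding e(1) e(2) exadd using q(2) \<psi>z[of i j]
        by (simp add: \<psi>_def eval_const.mpeval_mult mvar_def mult_single)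
      then show ?case using homog_mult[OF hz q(1), of i j] by auto
    qed
    \<comment> \<open>The exponents other than that of \<open>i0\<close> range freely over 0..s and
      \<open>i0\<close> absorbs the rest, so both groups of variables have total degree
      \<open>CARD('p) * s\<close>. With one degree for each s the growth exponent is 2 p - 2, one
      less than the dimension of the Segre cone.\<close>
    define ext where "ext s u = (\<lambda>i. if i = i0 then CARD('p) * s - sum u (UNIV - {i0}) else u i)" for s :: nat and u :: "'p \<Rightarrow> nat"
    define D where "D s = ((UNIV - {i0}) \<rightarrow>\<^sub>E {..s})" for s :: nat
    have sumext: "sum (ext s u) UNIV = CARD('p) * s" if "u \<in> D s" for s u
    proof -
      have "sum u (UNIV - {i0}) \<le> (\<Sum>i\<in>UNIV - {i0}. s)" by (rule sum_mono) (use that in \<open>auto simp: D_def\<close>)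
      also have "\<dots> \<le> CARD('p) * s" by (simp add: card_Diff_singleton)
      finally have le: "sum u (UNIV - {i0}) \<le> CARD('p) * s" .
      have "sum (ext s u) UNIV = ext s u i0 + sum (ext s u) (UNIV - {i0})" by (rule sum.remove) auto
      also have "sum (ext s u) (UNIV - {i0}) = sum u (UNIV - {i0})" by (rule sum.cong) (auto simp: ext_def)
      finally show ?thesis using le by (simp add: ext_def)
    qed
    define E where "E s = (\<lambda>(u, v). ex (ext s u) (ext s v)) ` (D s \<times> D s)" for s
    have finD: "finite (D s)" for s unfolding D_def by (intro finite_PiE) auto
    have cardD: "card (D s) = (s + 1) ^ (CARD('p) - 1)" for s
      by (simp add: D_def card_PiE card_Diff_singleton)
    have injE: "inj_on (\<lambda>(u, v). ex (ext s u) (ext s v)) (D s \<times> D s)" for s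
    proof (rule inj_onI, clarify)
      fix u v u' v' assume D: "u \<in> D s" "v \<in> D s" "u' \<in> D s" "v' \<in> D s"
        and eq: "ex (ext s u) (ext s v) = ex (ext s u') (ext s v')"
      have "ext s u i = ext s u' i" "ext s v i = ext s v' i" for i using eq exl by metis+
      then have "u i = u' i" "v i = v' i" if "i \<in> UNIV - {i0}" for i
        using that unfolding ext_def by (metis DiffE singletonI)+
      then show "u = u' \<and> v = v'" using D unfolding D_def by (metis PiE_ext)
    qed
    have "2 * CARD('p) - 2 \<le> card A"
    proof (rule generators_count[where \<psi> = \<psi> and h = h and d = "\<lambda>_. 1" and G = G and N = N and E = E and e = "CARD('p)"])
      show "\<psi> g = 0" if "g \<in> G" for g
      proof -
        obtain i j k l where "g = z i j * z k l - z i l * z k j" using \<open>g \<in> G\<close> by (auto simp: G_def)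
        then have "g + z i l * z k j = z i j * z k l" by simp
        then have "\<psi> g + \<psi> (z i l * z k j) = \<psi> (z i j * z k l)" unfolding \<psi>_def by (metis eval_const.mpeval_add)
        moreover have "\<psi> (z i l * z k j) = \<psi> (z i j * z k l)"
          using \<psi>z by (simp add: \<psi>_def eval_const.mpeval_mult mult_ac)
        ultimately show ?thesis by simp
      qed
      show "finite (E s)" for s using finD by (simp add: E_def)
      show "(s + 1) ^ (2 * CARD('p) - 2) \<le> card (E s)" for s
      proof -
        have "card (E s) = card (D s) * card (D s)"
          unfolding E_def using card_image[OF injE] by (simp add: card_cartesian_product)
        also have "\<dots> = (s + 1) ^ (2 * CARD('p) - 2)"
          by (simp add: cardD mult_2 numeral_2_eq_2 flip: power_add)
        finally show ?thesis by simp
      qed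
      fix s m assume "m \<in> E s"
      then obtain u v where uv: "u \<in> D s" "v \<in> D s" "m = ex (ext s u) (ext s v)" by (auto simp: E_def)
      show "\<exists>t\<le>CARD('p) * (s + 1). \<exists>q\<in>homog t. \<psi> q = single m 1"
        using pre[OF sumext[OF uv(1)] sumext[OF uv(2)]] uv(3) by (intro exI[of _ "CARD('p) * s"]) auto
    qed (use A G hh prim in \<open>auto simp: \<psi>_def eval_const.mpeval_add eval_const.mpeval_mult eval_const.mpeval_const\<close>)
    then show False using A by simp
  qed
  moreover have "h ` A \<union> G \<subseteq> (\<Union>t. homog t)" using hh G by auto
  ultimately obtain a ij where a: "a ij \<noteq> 0" "\<And>p. p \<in> ideal_gen (h ` A \<union> G) \<Longrightarrow> peval a p = 0"
    using nonprimary_zero by metis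
  obtain i0 j0 where ij: "ij = (i0, j0)" by fastforce
  have ez: "peval a (z i j) = a (i, j)" for i j by (simp add: z_def eval_id.mpeval_var)
  have minor: "a (i, j) * a (k, l) = a (i, l) * a (k, j)" for i j k l
  proof -
    have "z i j * z k l - z i l * z k j \<in> ideal_gen (h ` A \<union> G)"
      unfolding G_def by (rule ring_ideal.span_base) blast
    then have "peval a (z i j * z k l - z i l * z k j) = 0" by (rule a)
    then have "peval a (z i j * z k l) = peval a (z i l * z k j)"
      using eval_id.mpeval_add[of a "z i j * z k l - z i l * z k j" "z i l * z k j"] by simp
    then show ?thesis by (simp add: eval_id.mpeval_mult ez)
  qed
  \<comment> \<open>The matrix of coordinates of the zero has rank one: its factors are the column
    \<open>j0\<close> and the row \<open>i0\<close>, the latter divided by the nonzero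
    entry.\<close>
  define l where "l i = a (i, j0)" for i
  define x where "x j = a (i0, j) / a (i0, j0)" for j
  have lx: "l i * x j = a (i, j)" for i j
    using minor[of i j0 i0 j] a(1) by (simp add: l_def x_def ij field_simps)
  show thesis
  proof (rule that)
    show "\<exists>i. l i \<noteq> 0" using a(1) by (auto simp: l_def ij)
    show "\<exists>i. x i \<noteq> 0" using a(1) by (auto simp: x_def ij)
    fix b assume "b \<in> A"
    then have "peval a (h b) = 0" by (intro a ring_ideal.span_base) auto
    then show "(\<Sum>i\<in>UNIV. \<Sum>j\<in>UNIV. \<beta> b i j * l i * x j) = 0"
      by (simp add: h_def eval_id.mpeval_sum eval_id.mpeval_mult eval_id.mpeval_const ez mult.assoc lx)
  qed
qed

section \<open>Quartic functionals vanishing on quadrics without common zeros\<close>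

definition mprod :: "('n, 'k::field) mpoly set \<Rightarrow> ('n, 'k) mpoly set \<Rightarrow> ('n, 'k) mpoly set" where
  "mprod X Y = mpoly.span {x * y |x y. x \<in> X \<and> y \<in> Y}"

lemma mprodI: "x \<in> X \<Longrightarrow> y \<in> Y \<Longrightarrow> x * y \<in> mprod X Y"
  unfolding mprod_def by (rule mpoly.span_base) blast

lemma subspace_mprod [simp]: "mpoly.subspace (mprod X Y)"
  by (simp add: mprod_def)

lemma mprod_mono: "X \<subseteq> X' \<Longrightarrow> Y \<subseteq> Y' \<Longrightarrow> mprod X Y \<subseteq> mprod X' Y'"
  unfolding mprod_def by (rule mpoly.span_mono) blast

lemma mprod_least:
  assumes "mpoly.subspace W" "\<And>x y. x \<in> X \<Longrightarrow> y \<in> Y \<Longrightarrow> x * y \<in> W"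
  shows "mprod X Y \<subseteq> W"
  unfolding mprod_def by (rule mpoly.span_minimal) (use assms in auto)

lemma mprod_homog: "X \<subseteq> homog a \<Longrightarrow> Y \<subseteq> homog b \<Longrightarrow> mprod X Y \<subseteq> homog (a + b)"
  by (rule mprod_least) (auto simp: subspace_homog intro: homog_mult)

lemma homog_mprod: "homog (Suc t) \<subseteq> mprod (homog 1) (homog t)"
proof
  fix p :: "('n::finite, 'k::field) mpoly" assume "p \<in> homog (Suc t)"
  then obtain q where p: "p = (\<Sum>i\<in>UNIV. mvar i * q i)" "\<And>i. q i \<in> homog t" by (metis homog_Suc)
  show "p \<in> mprod (homog 1) (homog t)"
    unfolding p(1) by (intro mpoly.subspace_sum subspace_mprod mprodI homog_mvar p(2))
qed

lemma mult_lin: "m * (x + y) = m * x + m * y" "m * mscale c x = mscale c (m * x)"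
  for m :: "('m, 'f::field) mpoly"
  by (simp_all add: algebra_simps)

lemma mprod_single: "mpoly.subspace X \<Longrightarrow> mprod {m} X = (\<lambda>x. m * x) ` X"
proof (rule equalityI)
  assume X: "mpoly.subspace X"
  show "mprod {m} X \<subseteq> (\<lambda>x. m * x) ` X"
    by (rule mprod_least) (auto intro!: mpoly.subspace_endo_image X mult_lin)
qed (auto intro: mprodI)

lemma mult_image_mprod: "(\<lambda>x. m * x) ` mprod X Y = mprod ((\<lambda>x. m * x) ` X) Y"
proof -
  have "(\<lambda>x. m * x) ` mpoly.span {x * y |x y. x \<in> X \<and> y \<in> Y}
      = mpoly.span ((\<lambda>x. m * x) ` {x * y |x y. x \<in> X \<and> y \<in> Y})"
    by (rule mpoly.endo_image_span) (rule mult_lin)+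
  also have "(\<lambda>x. m * x) ` {x * y |x y. x \<in> X \<and> y \<in> Y} = {x * y |x y. x \<in> (\<lambda>x. m * x) ` X \<and> y \<in> Y}"
  proof (intro Set.set_eqI iffI)
    fix p assume "p \<in> (\<lambda>x. m * x) ` {x * y |x y. x \<in> X \<and> y \<in> Y}"
    then obtain a b where "a \<in> X" "b \<in> Y" "p = (m * a) * b" by (auto simp: mult.assoc)
    then show "p \<in> {x * y |x y. x \<in> (\<lambda>x. m * x) ` X \<and> y \<in> Y}" by blast
  next
    fix p assume "p \<in> {x * y |x y. x \<in> (\<lambda>x. m * x) ` X \<and> y \<in> Y}"
    then obtain a b where "a \<in> X" "b \<in> Y" "p = m * (a * b)" by (auto simp: mult.assoc)
    then show "p \<in> (\<lambda>x. m * x) ` {x * y |x y. x \<in> X \<and> y \<in> Y}" by blast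
  qed
  finally show ?thesis by (simp add: mprod_def)
qed

lemma fin_dim_homog_subset: "X \<subseteq> homog t \<Longrightarrow> mpoly.fin_dim X"
  by (rule mpoly.fin_dim_subset[OF fin_dim_homog])

lemma dim_homog_1_le: "mpoly.dim (homog 1 :: ('n::finite, 'k::field) mpoly set) \<le> CARD('n)"
proof -
  have "(homog 1 :: ('n, 'k) mpoly set) \<subseteq> mpoly.span (range mvar)"
  proof
    fix p :: "('n, 'k) mpoly" assume "p \<in> homog 1"
    then obtain q where p: "p = (\<Sum>i\<in>UNIV. mvar i * q i)" "\<And>i. q i \<in> homog 0" by (metis homog_Suc One_nat_def)
    have q: "mvar i * q i \<in> mpoly.span (range mvar)" for i
    proof -
      have "mvar i * q i = mconst (lookup (q i) 0) * mvar i"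
        using homog_zero_iff[OF p(2)[of i]] by (metis mult.commute)
      then show ?thesis by (simp only:) (intro mpoly.span_scale mpoly.span_base, simp)
    qed
    then show "p \<in> mpoly.span (range mvar)" unfolding p(1) by (intro mpoly.span_sum q)
  qed
  then have "mpoly.dim (homog 1 :: ('n, 'k) mpoly set) \<le> card (range (mvar :: 'n \<Rightarrow> ('n, 'k) mpoly))"
    by (rule mpoly.dim_le_card) simp
  also have "\<dots> \<le> CARD('n)" by (rule card_image_le) simp
  finally show ?thesis .
qed

lemma card_pairwise_products:
  fixes B :: "'r::comm_ring_1 set"
  assumes "finite B"
  shows "finite {x * y |x y. x \<in> B \<and> y \<in> B}"
    "2 * card {x * y |x y. x \<in> B \<and> y \<in> B} \<le> card B * (card B + 1)"
proof -
  have "finite {x * y |x y. x \<in> B \<and> y \<in> B} \<and> 2 * card {x * y |x y. x \<in> B \<and> y \<in> B} \<le> card B * (card B + 1)"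
    using assms
  proof (induction B)
    case (insert b B)
    let ?P = "\<lambda>B. {x * y |x y. x \<in> B \<and> y \<in> B}"
    have eq: "?P (insert b B) = ?P B \<union> (\<lambda>y. b * y) ` insert b B"
      by (auto simp: image_iff) (metis mult.commute)
    have "card (?P (insert b B)) \<le> card (?P B) + card ((\<lambda>y. b * y) ` insert b B)"
      unfolding eq by (rule card_Un_le)
    also have "card ((\<lambda>y. b * y) ` insert b B) \<le> card (insert b B)"
      by (rule card_image_le) (use insert in simp)
    also have "card (insert b B) = card B + 1" using insert by simp
    finally have "2 * card (?P (insert b B)) \<le> 2 * card (?P B) + 2 * (card B + 1)" by simp
    also have "\<dots> \<le> card B * (card B + 1) + 2 * (card B + 1)" using insert.IH by simp
    also have "\<dots> = card (insert b B) * (card (insert b B) + 1)"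
      using insert by (simp add: algebra_simps)
    finally show ?case using insert eq by simp
  qed simp
  then show "finite {x * y |x y. x \<in> B \<and> y \<in> B}"
    "2 * card {x * y |x y. x \<in> B \<and> y \<in> B} \<le> card B * (card B + 1)" by auto
qed

text \<open>Modulo the linear forms in \<open>R\<close> there are \<open>c\<close> variables left, so \<open>Q\<close> must contain at least \<open>c\<close>
  quadrics that are independent modulo \<open>R\<close>.\<close>

lemma quadric_codim:
  fixes R Q Fs :: "('n::finite, 'k::field) mpoly set"
  assumes R: "mpoly.subspace R" "R \<subseteq> homog 1" and Q: "mpoly.subspace Q" "Q \<subseteq> homog 2"
    and RQ: "\<And>r v. r \<in> R \<Longrightarrow> v \<in> homog 1 \<Longrightarrow> r * v \<in> Q"
    and Fs: "Fs \<subseteq> Q" "\<And>t. t \<ge> N \<Longrightarrow> homog t \<subseteq> ideal_gen Fs"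
    and c: "mpoly.dim (homog 1 :: ('n, 'k) mpoly set) = c + mpoly.dim R"
  shows "2 * mpoly.dim (homog 2 :: ('n, 'k) mpoly set) \<le> 2 * mpoly.dim Q + c * (c - 1)"
proof -
  let ?V = "homog 1 :: ('n, 'k) mpoly set"
  obtain U where U: "mpoly.subspace U" "U \<subseteq> ?V" "mpoly.dim ?V = mpoly.dim U + mpoly.dim R"
    "\<And>x. x \<in> ?V \<Longrightarrow> \<exists>u\<in>U. \<exists>r\<in>R. x = u + r"
    using mpoly.complement_exists[OF subspace_homog fin_dim_homog R] by metis
  obtain B where B: "B \<subseteq> U" "U \<subseteq> mpoly.span B" "card B = c" "finite B"
    using mpoly.fin_dim_basis[OF fin_dim_homog_subset[OF U(2)]] U(3) c by (metis add_right_cancel)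
  obtain Br where Br: "Br \<subseteq> R" "mpoly.independent Br" "R \<subseteq> mpoly.span Br" "card Br = mpoly.dim R" "finite Br"
    using mpoly.fin_dim_basis[OF fin_dim_homog_subset[OF R(2)]] by metis
  define P where "P = {x * y |x y. x \<in> B \<and> y \<in> B}"
  have BV: "B \<subseteq> ?V" using B U by blast
  have PV: "mpoly.span P \<subseteq> homog 2"
    by (rule mpoly.span_minimal) (use BV homog_mult in \<open>fastforce simp: P_def subspace_homog numeral_2_eq_2\<close>)+
  have finP: "finite P" "2 * card P \<le> c * (c + 1)"
    using card_pairwise_products[OF B(4)] B(3) by (auto simp: P_def)
  define RV where "RV = mprod R ?V"
  have RVQ: "RV \<subseteq> Q" unfolding RV_def by (rule mprod_least[OF Q(1) RQ])
  have uu: "x * y \<in> mpoly.span P" if "x \<in> mpoly.span B" "y \<in> mpoly.span B" for x y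
  proof -
    have s1: "b * y \<in> mpoly.span P" if "b \<in> B" for b
      using \<open>y \<in> mpoly.span B\<close>
    proof (induction rule: mpoly.span_induct_alt)
      case (step c x z)
      have "b * x \<in> P" using step that by (auto simp: P_def)
      then have "mscale c (b * x) + b * z \<in> mpoly.span P"
        using step by (intro mpoly.span_add mpoly.span_scale) (auto intro: mpoly.span_base)
      then show ?case by (simp add: algebra_simps)
    qed (simp add: mpoly.span_zero)
    show ?thesis
      using \<open>x \<in> mpoly.span B\<close>
    proof (induction rule: mpoly.span_induct_alt)
      case (step c x z)
      have "mscale c (x * y) + z * y \<in> mpoly.span P"
        using step s1 by (intro mpoly.span_add mpoly.span_scale) auto
      then show ?case by (simp add: algebra_simps)
    qed (simp add: mpoly.span_zero)
  qed
  \<comment> \<open>Each linear form is u + r with u in U and r in R; in a product of two of them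
    everything except u u' lies in R V.\<close>
  have dec: "\<exists>w\<in>mpoly.span P. \<exists>r\<in>RV. p = w + r" if "p \<in> homog 2" for p
  proof -
    define D where "D = {p. \<exists>w\<in>mpoly.span P. \<exists>r\<in>RV. p = w + r}"
    have D: "D = {x + y |x y. x \<in> mpoly.span P \<and> y \<in> RV}" by (auto simp: D_def)
    have "mpoly.subspace D" unfolding D by (rule mpoly.subspace_sums) (auto simp: RV_def)
    moreover have "x * y \<in> D" if xy: "x \<in> ?V" "y \<in> ?V" for x y
    proof -
      obtain u r u' r' where *: "u \<in> U" "r \<in> R" "x = u + r" "u' \<in> U" "r' \<in> R" "y = u' + r'"
        using U(4) xy by metis
      have "r * y + r' * u \<in> RV"
        unfolding RV_def by (intro mpoly.subspace_add subspace_mprod mprodI) (use * xy U in auto)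
      moreover have "u * u' \<in> mpoly.span P" by (rule uu) (use * B in auto)
      moreover have "x * y = u * u' + (r * y + r' * u)" by (simp add: * algebra_simps)
      ultimately show ?thesis by (auto simp: D_def)
    qed
    ultimately have "mprod ?V ?V \<subseteq> D" by (rule mprod_least)
    moreover have "p \<in> mprod ?V ?V" using that homog_mprod[of 1] by (auto simp: numeral_2_eq_2)
    ultimately show ?thesis by (auto simp: D_def)
  qed
  \<comment> \<open>Since R V is contained in Q, only the part of Q inside \<open>span P\<close>
    needs generators of its own.\<close>
  define Q' where "Q' = Q \<inter> mpoly.span P"
  have Q': "mpoly.subspace Q'" "Q' \<subseteq> mpoly.span P" "Q' \<subseteq> homog 2"
    using Q by (auto simp: Q'_def intro: mpoly.subspace_inter)
  have finsP: "mpoly.fin_dim (mpoly.span P)" using finP mpoly.fin_dim_finite mpoly.fin_dim_span by blast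
  obtain C where C: "mpoly.subspace C" "C \<subseteq> mpoly.span P" "mpoly.dim (mpoly.span P) = mpoly.dim C + mpoly.dim Q'"
    "\<And>x. x \<in> mpoly.span P \<Longrightarrow> \<exists>u\<in>C. \<exists>r\<in>Q'. x = u + r"
    using mpoly.complement_exists[OF _ finsP Q'(1,2)] by (metis mpoly.subspace_span)
  obtain BC where BC: "C \<subseteq> mpoly.span BC" "card BC = mpoly.dim C" "finite BC"
    using mpoly.fin_dim_basis[OF mpoly.fin_dim_subset[OF finsP C(2)]] by metis
  obtain BQ where BQ: "Q \<subseteq> mpoly.span BQ" "card BQ = mpoly.dim Q" "finite BQ"
    using mpoly.fin_dim_basis[OF fin_dim_homog_subset[OF Q(2)]] by metis
  obtain BQ' where BQ': "BQ' \<subseteq> Q'" "Q' \<subseteq> mpoly.span BQ'" "card BQ' = mpoly.dim Q'" "finite BQ'"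
    using mpoly.fin_dim_basis[OF fin_dim_homog_subset[OF Q'(3)]] by metis
  have "homog 2 \<subseteq> mpoly.span (BC \<union> BQ)"
  proof
    fix p :: "('n, 'k) mpoly" assume "p \<in> homog 2"
    then obtain w r where w: "w \<in> mpoly.span P" "r \<in> RV" "p = w + r" using dec by blast
    obtain u q where u: "u \<in> C" "q \<in> Q'" "w = u + q" using C(4) w by blast
    have "q + r \<in> Q" using u w RVQ Q(1) by (auto simp: Q'_def intro: mpoly.subspace_add)
    moreover have "p = u + (q + r)" using u w by (simp add: add.assoc)
    ultimately show "p \<in> mpoly.span (BC \<union> BQ)" using u BC BQ unfolding mpoly.span_Un by blast
  qed
  then have "mpoly.dim (homog 2 :: ('n, 'k) mpoly set) \<le> card (BC \<union> BQ)"
    by (rule mpoly.dim_le_card) (use BC BQ in simp)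
  also have "\<dots> \<le> mpoly.dim C + mpoly.dim Q" using card_Un_le[of BC BQ] BC BQ by simp
  finally have d2: "mpoly.dim (homog 2 :: ('n, 'k) mpoly set) \<le> mpoly.dim C + mpoly.dim Q" .
  have spanI: "mpoly.span X \<subseteq> ideal_gen X" for X :: "('n, 'k) mpoly set"
    by (rule mpoly.span_minimal) (auto intro: ring_ideal.span_base subspace_ideal)
  have RI: "R \<subseteq> ideal_gen (Br \<union> BQ')"
    using Br(3) spanI[of Br] ideal_gen_mono[of Br "Br \<union> BQ'"] by blast
  have RVI: "RV \<subseteq> ideal_gen (Br \<union> BQ')"
    unfolding RV_def
  proof (rule mprod_least)
    show "mpoly.subspace (ideal_gen (Br \<union> BQ'))" by (rule subspace_ideal) simp
    fix x y assume "x \<in> R"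
    then show "x * y \<in> ideal_gen (Br \<union> BQ')" using RI ideal_mult by (metis mult.commute subsetD)
  qed
  have "Q \<subseteq> ideal_gen (Br \<union> BQ')"
  proof
    fix q assume q: "q \<in> Q"
    then obtain w r where w: "w \<in> mpoly.span P" "r \<in> RV" "q = w + r" using dec Q by blast
    have "q - r \<in> Q" using mpoly.subspace_diff[OF Q(1) q] w RVQ by blast
    then have "w \<in> Q'" using w by (simp add: Q'_def)
    then have "w \<in> ideal_gen (Br \<union> BQ')"
      using BQ'(2) spanI[of BQ'] ideal_gen_mono[of BQ' "Br \<union> BQ'"] by blast
    then show "q \<in> ideal_gen (Br \<union> BQ')" using w RVI by (auto intro: ring_ideal.span_add)
  qed
  then have FI: "ideal_gen Fs \<subseteq> ideal_gen (Br \<union> BQ')"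
    using Fs(1) by (intro ring_ideal.span_minimal) auto
  \<comment> \<open>The ideal of \<open>Br\<close> and \<open>BQ'\<close> contains
    \<open>Fs\<close>, hence all large degrees, and so needs n generators. At most dim R of them are
    linear, which leaves at least c quadrics in \<open>BQ'\<close>; the codimension of Q is thus at
    most c(c+1)/2 - c = c(c-1)/2.\<close>
  have "CARD('n) \<le> card (Br \<union> BQ')"
  proof (rule primary_generators_ge[where h = "\<lambda>x. x" and d = "\<lambda>x. if x \<in> Br then 1 else 2"])
    show "p \<in> ideal_gen ((\<lambda>x. x) ` (Br \<union> BQ'))" if "t \<ge> N" "p \<in> homog t" for t p
      using that Fs(2) FI by auto
  qed (use Br BQ' R Q' in auto)
  also have "\<dots> \<le> mpoly.dim R + mpoly.dim Q'" using card_Un_le[of Br BQ'] Br BQ' by simp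
  finally have "c \<le> mpoly.dim Q'" using c dim_homog_1_le[where 'n='n and 'k='k] by simp
  moreover have "mpoly.dim (mpoly.span P) \<le> card P" using mpoly.dim_le_card[OF mpoly.span_superset finP(1)] by simp
  ultimately have "2 * (mpoly.dim C + mpoly.dim Q) + 2 * c \<le> 2 * mpoly.dim Q + c * (c + 1)"
    using C(3) finP(2) by simp
  moreover have "2 * mpoly.dim (homog 2 :: ('n, 'k) mpoly set) + 2 * c \<le> 2 * (mpoly.dim C + mpoly.dim Q) + 2 * c"
    using d2 by simp
  ultimately have "2 * mpoly.dim (homog 2 :: ('n, 'k) mpoly set) + 2 * c \<le> 2 * mpoly.dim Q + c * (c + 1)"
    by (rule order_trans[rotated])
  then show ?thesis by (cases c) auto
qed

text \<open>For a functional \<open>\<Phi>\<close> on quartic forms, \<open>\<tau>\<close> is the passage to the Gorenstein quotient of \<open>S\<close> by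
  \<open>{s. \<forall>v. \<Phi> (s v) = 0}\<close>, realized inside the polynomial ring, and \<open>br X\<close> is the
  dimension of the image of \<open>X\<close> in that quotient.\<close>

locale quartic =
  fixes \<Phi> :: "('n::finite, 'k::alg_closed_field) mpoly \<Rightarrow> 'k" and Fs :: "('n, 'k) mpoly set"
  assumes \<Phi>_add: "\<Phi> (p + q) = \<Phi> p + \<Phi> q" and \<Phi>_scale: "\<Phi> (mscale c p) = c * \<Phi> p"
    and \<Phi>_homog: "p \<in> homog t \<Longrightarrow> t \<noteq> 4 \<Longrightarrow> \<Phi> p = 0"
    and Fs: "Fs \<subseteq> homog 2" and \<Phi>_Fs: "f \<in> Fs \<Longrightarrow> \<Phi> (f * p) = 0"
    and primary: "\<exists>N. \<forall>t\<ge>N. homog t \<subseteq> ideal_gen Fs"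
    and nonzero: "\<exists>p. \<Phi> p \<noteq> 0"
begin

text \<open>Macaulay's inverse system: the coefficients of \<open>\<tau> s\<close> are the values of
  v -> \<Phi> (s v) on monomials. Only degrees up to 4 can give nonzero values, so the sum is finite
  and still determines the functional.\<close>

definition \<tau> :: "('n, 'k) mpoly \<Rightarrow> ('n, 'k) mpoly" where
  "\<tau> s = (\<Sum>m\<in>(\<Union>t\<le>4. {m. mdeg m = t}). single m (\<Phi> (s * single m 1)))"

abbreviation V :: "('n, 'k) mpoly set" where "V \<equiv> homog 1"

definition br :: "('n, 'k) mpoly set \<Rightarrow> nat" where "br X = mpoly.dim (\<tau> ` X)"

definition tind :: "('n, 'k) mpoly \<Rightarrow> ('n, 'k) mpoly \<Rightarrow> bool" where
  "tind x y \<longleftrightarrow> (\<forall>s t. \<tau> (mscale s x + mscale t y) = 0 \<longrightarrow> s = 0 \<and> t = 0)"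

lemma \<Phi>_0 [simp]: "\<Phi> 0 = 0" using \<Phi>_scale[of 0 0] by simp

lemma \<Phi>_sum: "\<Phi> (\<Sum>i\<in>I. g i) = (\<Sum>i\<in>I. \<Phi> (g i))"
  by (rule additive_eq_sum) (rule \<Phi>_add)

lemma \<tau>_add: "\<tau> (p + q) = \<tau> p + \<tau> q"
  by (simp add: \<tau>_def distrib_right \<Phi>_add single_add sum.distrib)

lemma \<tau>_scale: "\<tau> (mscale c p) = mscale c (\<tau> p)"
  by (simp add: \<tau>_def mult.assoc \<Phi>_scale sum_distrib_left mconst_mult_single)

lemma \<tau>_0 [simp]: "\<tau> 0 = 0" using \<tau>_add[of 0 0] by simp

lemma finite_small: "finite (\<Union>t\<le>4. {m :: 'n \<Rightarrow>\<^sub>0 nat. mdeg m = t})"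
  using finite_mdeg by blast

lemma lookup_\<tau>: "lookup (\<tau> s) m = (if mdeg m \<le> 4 then \<Phi> (s * single m 1) else 0)"
  unfolding \<tau>_def using finite_small by (simp add: lookup_sum lookup_single when_def)

lemma \<Phi>_mult_large:
  assumes "v \<in> homog u" "u > 4"
  shows "\<Phi> (s * v) = 0"
proof -
  obtain N where N: "s = (\<Sum>t\<le>N. hcomp t s)" using sum_hcomp_ex by blast
  have "\<Phi> (hcomp t s * v) = 0" for t
    by (rule \<Phi>_homog[OF homog_mult[OF hcomp_homog assms(1)]]) (use assms in simp)
  then have "\<Phi> ((\<Sum>t\<le>N. hcomp t s) * v) = 0" by (simp add: sum_distrib_right \<Phi>_sum)
  then show ?thesis using N by simp
qed

lemma \<tau>_eq_0_iff: "\<tau> s = 0 \<longleftrightarrow> (\<forall>v. \<Phi> (s * v) = 0)"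
proof
  assume z: "\<tau> s = 0"
  have m: "\<Phi> (s * single m 1) = 0" for m
  proof (cases "mdeg m \<le> 4")
    case True
    then show ?thesis using lookup_\<tau>[of s m] z by simp
  next
    case False
    then show ?thesis using \<Phi>_mult_large[OF homog_single[of m]] by simp
  qed
  show "\<forall>v. \<Phi> (s * v) = 0"
  proof
    fix v
    have "\<Phi> (s * v) = \<Phi> (s * (\<Sum>m\<in>keys v. mscale (lookup v m) (single m 1)))"
      using mpoly_eq_sum_scale[of v] by simp
    also have "\<dots> = (\<Sum>m\<in>keys v. lookup v m * \<Phi> (s * single m 1))"
      by (simp add: sum_distrib_left \<Phi>_sum mult.left_commute[of s] \<Phi>_scale)
    finally show "\<Phi> (s * v) = 0" by (simp add: m)
  qed
next
  assume "\<forall>v. \<Phi> (s * v) = 0"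
  then show "\<tau> s = 0" by (simp add: \<tau>_def)
qed

lemma \<tau>_eq_0_homog:
  assumes "s \<in> homog t" "t \<le> 4"
  shows "\<tau> s = 0 \<longleftrightarrow> (\<forall>v\<in>homog (4 - t). \<Phi> (s * v) = 0)"
proof
  assume *: "\<forall>v\<in>homog (4 - t). \<Phi> (s * v) = 0"
  have "\<Phi> (s * v) = 0" for v
  proof -
    obtain N where N: "v = (\<Sum>u\<le>N. hcomp u v)" using sum_hcomp_ex by blast
    have "\<Phi> (s * hcomp u v) = 0" for u
    proof (cases "u = 4 - t")
      case True
      then show ?thesis using * hcomp_homog by blast
    next
      case False
      then show ?thesis using \<Phi>_homog[OF homog_mult[OF assms(1) hcomp_homog]] assms(2) by simp
    qed
    then have "\<Phi> (s * (\<Sum>u\<le>N. hcomp u v)) = 0" by (simp add: sum_distrib_left \<Phi>_sum)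
    then show ?thesis using N by simp
  qed
  then show "\<tau> s = 0" by (simp add: \<tau>_eq_0_iff)
qed (simp add: \<tau>_eq_0_iff)

lemma \<tau>_mult: "\<tau> s = 0 \<Longrightarrow> \<tau> (s * v) = 0"
  by (simp add: \<tau>_eq_0_iff mult.assoc)

lemma \<tau>_mult': "\<tau> s = 0 \<Longrightarrow> \<tau> (v * s) = 0"
  using \<tau>_mult by (simp add: mult.commute)

text \<open>The quotient has no socle below degree 4: a form of the complementary degree 4 - t >= 1
  is a combination of multiples of variables.\<close>

lemma \<tau>_eq_0_linear:
  assumes "s \<in> homog t" "t < 4" "\<And>v. v \<in> V \<Longrightarrow> \<tau> (s * v) = 0"
  shows "\<tau> s = 0"
proof -
  have "\<Phi> (s * v) = 0" if "v \<in> homog (4 - t)" for v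
  proof -
    have "4 - t = Suc (3 - t)" using assms(2) by simp
    then obtain q where v: "v = (\<Sum>i\<in>UNIV. mvar i * q i)" using \<open>v \<in> homog (4 - t)\<close> by (metis homog_Suc)
    have "\<Phi> (s * v) = (\<Sum>i\<in>UNIV. \<Phi> ((s * mvar i) * q i))"
      unfolding v by (simp add: sum_distrib_left \<Phi>_sum mult.assoc)
    also have "\<dots> = 0" using assms(3)[OF homog_mvar] by (simp add: \<tau>_eq_0_iff)
    finally show ?thesis .
  qed
  then show ?thesis using \<tau>_eq_0_homog[OF assms(1)] assms(2) by simp
qed

lemmas \<tau>_lin = \<tau>_add \<tau>_scale

section \<open>Dimension counts in the Gorenstein quotient\<close>

lemma br_nullity:
  "mpoly.subspace X \<Longrightarrow> X \<subseteq> homog t \<Longrightarrow> mpoly.dim X = br X + mpoly.dim {x\<in>X. \<tau> x = 0}"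
  unfolding br_def by (rule mpoly.rank_nullity[of \<tau>]) (auto simp: \<tau>_lin fin_dim_homog_subset)

lemma mult_nullity:
  assumes "mpoly.subspace X" "X \<subseteq> homog t"
  shows "mpoly.dim X = br ((\<lambda>x. m * x) ` X) + mpoly.dim {x\<in>X. \<tau> (m * x) = 0}"
  using mpoly.rank_nullity[of "\<lambda>x. \<tau> (m * x)" X] assms
  by (simp add: \<tau>_lin mult_lin fin_dim_homog_subset br_def image_image)

lemma br_mono: "X \<subseteq> Y \<Longrightarrow> Y \<subseteq> homog t \<Longrightarrow> br X \<le> br Y"
  unfolding br_def
  by (intro mpoly.dim_mono_subset mpoly.fin_dim_endo_image image_mono)
    (auto simp: \<tau>_lin fin_dim_homog_subset)

text \<open>Equality of row and column rank for the pairing of X with degree 4 - t; its left radical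
  is the kernel of \<tau> on X because only the complementary degree has to be tested.\<close>

lemma perp_dim:
  assumes "mpoly.subspace X" "X \<subseteq> homog t" "t \<le> 4"
  shows "mpoly.dim (homog (4 - t) :: ('n, 'k) mpoly set)
    = br X + mpoly.dim {v\<in>homog (4 - t). \<forall>x\<in>X. \<Phi> (x * v) = 0}"
proof -
  have "{x\<in>X. \<forall>v\<in>homog (4 - t). \<Phi> (x * v) = 0} = {x\<in>X. \<tau> x = 0}"
    using \<tau>_eq_0_homog assms by auto
  then show ?thesis
    using mpoly.pairing_rank[of X "homog (4 - t)" "\<lambda>x v. \<Phi> (x * v)"] br_nullity[OF assms(1,2)] assms
    by (simp add: fin_dim_homog_subset fin_dim_homog subspace_homog distrib_right distrib_left \<Phi>_add
        \<Phi>_scale mult.assoc mult.left_commute[of _ "mconst _"])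
qed

text \<open>Y lies in the orthogonal space of X, whose image has dimension
  \<open>br (homog 2) - br X\<close>.\<close>

lemma orthogonal_br:
  assumes X: "mpoly.subspace X" "X \<subseteq> homog 2" and Y: "Y \<subseteq> homog 2"
    and orth: "\<And>x y. x \<in> X \<Longrightarrow> y \<in> Y \<Longrightarrow> \<Phi> (x * y) = 0"
  shows "br X + br Y \<le> br (homog 2)"
proof -
  define X' where "X' = {v\<in>homog 2. \<forall>x\<in>X. \<Phi> (x * v) = 0}"
  have X': "mpoly.subspace X'"
    unfolding X'_def using subspace_homog[of 2]
    by (auto simp: mpoly.subspace_def distrib_left \<Phi>_add \<Phi>_scale mult.left_commute[of _ "mconst _"])
  have "{x\<in>X'. \<tau> x = 0} = {x\<in>homog 2. \<tau> x = 0}"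
    by (auto simp: X'_def \<tau>_eq_0_iff mult.commute)
  then have "br X + br X' = br (homog 2)"
    using perp_dim[OF X] br_nullity[OF X', of 2] br_nullity[OF subspace_homog order_refl, of 2]
    by (simp add: X'_def)
  moreover have "br Y \<le> br X'" by (rule br_mono[of _ _ 2]) (use Y orth in \<open>auto simp: X'_def\<close>)
  ultimately show ?thesis by simp
qed

text \<open>Multiplication by m acts on the image of X in the quotient and kills that of X'; this is
  rank and nullity there.\<close>

lemma mult_br:
  assumes X: "mpoly.subspace X" "X \<subseteq> homog t" and X': "X' \<subseteq> X" "\<And>x. x \<in> X' \<Longrightarrow> \<tau> (m * x) = 0"
  shows "br ((\<lambda>x. m * x) ` X) + br X' \<le> br X"
proof -
  define K where "K = {x\<in>X. \<tau> (m * x) = 0}"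
  have K: "mpoly.subspace K" "K \<subseteq> homog t"
    unfolding K_def using mpoly.subspace_endo_kernel[of "\<lambda>x. \<tau> (m * x)" X] X by (auto simp: \<tau>_lin mult_lin)
  have "{x\<in>K. \<tau> x = 0} = {x\<in>X. \<tau> x = 0}" by (auto simp: K_def \<tau>_mult')
  then have "br ((\<lambda>x. m * x) ` X) + br K = br X"
    using mult_nullity[OF X, of m] br_nullity[OF X] br_nullity[OF K] by (simp add: K_def)
  moreover have "br X' \<le> br K" by (rule br_mono[OF _ K(2)]) (use X' in \<open>auto simp: K_def\<close>)
  ultimately show ?thesis by simp
qed

lemma tind_exists:
  assumes "br X \<ge> 2" "X \<subseteq> homog t"
  obtains x y where "x \<in> X" "y \<in> X" "tind x y"
proof -
  have "mpoly.fin_dim (\<tau> ` X)"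
    by (rule mpoly.fin_dim_endo_image) (use assms in \<open>auto simp: \<tau>_lin fin_dim_homog_subset\<close>)
  then obtain B where B: "B \<subseteq> \<tau> ` X" "mpoly.independent B" "card B = br X" "finite B"
    unfolding br_def using mpoly.fin_dim_basis by metis
  obtain b b' where b: "b \<in> B" "b' \<in> B" "b \<noteq> b'"
    using assms(1) B(3) by (metis (no_types, lifting) One_nat_def card_le_Suc0_iff_eq B(4) not_less_eq_eq numeral_2_eq_2)
  obtain x y where xy: "x \<in> X" "y \<in> X" "b = \<tau> x" "b' = \<tau> y" using b B(1) by blast
  have "tind x y" unfolding tind_def
  proof (intro allI impI)
    fix s t assume "\<tau> (mscale s x + mscale t y) = 0"
    then have z: "mscale s b + mscale t b' = 0" by (simp add: \<tau>_lin xy)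
    have "(\<Sum>v\<in>{b, b'}. mscale (if v = b then s else t) v) = 0" using b(3) z by simp
    then have "(if v = b then s else t) = 0" if "v \<in> {b, b'}" for v
      using mpoly.independentD[OF B(2), of "{b, b'}" "\<lambda>v. if v = b then s else t" v] b that by auto
    from this[of b] this[of b'] show "s = 0 \<and> t = 0" using b(3) by auto
  qed
  then show thesis using that xy by blast
qed

lemma tindD: "tind x y \<Longrightarrow> (s, t) \<noteq> (0, 0) \<Longrightarrow> \<tau> (mscale s x + mscale t y) \<noteq> 0"
  unfolding tind_def by auto

text \<open>A quadric \<open>q\<close> for which the bilinear form \<open>\<Phi> (q v w)\<close> has rank one would make the coefficients of
  that linear form a common zero of \<open>Fs\<close>.\<close>

lemma rank_one_zero:
  assumes q: "q \<in> homog 2" and r: "br ((\<lambda>v. q * v) ` V) \<le> 1"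
  shows "\<tau> q = 0"
proof (rule ccontr)
  assume nz: "\<tau> q \<noteq> 0"
  then obtain v0 where v0: "v0 \<in> V" "\<tau> (q * v0) \<noteq> 0" using \<tau>_eq_0_linear[OF q] by auto
  define T where "T = \<tau> ` (\<lambda>v. q * v) ` V"
  have T: "mpoly.subspace T" "mpoly.fin_dim T"
    unfolding T_def image_image
    by (intro mpoly.subspace_endo_image mpoly.fin_dim_endo_image; simp add: \<tau>_lin mult_lin subspace_homog fin_dim_homog)+
  have "mpoly.span {\<tau> (q * v0)} = T"
  proof (rule mpoly.subspace_dim_eq)
    show "mpoly.span {\<tau> (q * v0)} \<subseteq> T" by (rule mpoly.span_minimal) (use v0 T in \<open>auto simp: T_def\<close>)
    have "mpoly.dim (mpoly.span {\<tau> (q * v0)}) = 1"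
      using v0 mpoly.dim_eq_card_independent[of "{\<tau> (q * v0)}"] by simp
    then show "mpoly.dim T \<le> mpoly.dim (mpoly.span {\<tau> (q * v0)})" using r by (simp add: br_def T_def)
  qed (use T in auto)
  then have "\<tau> (q * v) \<in> mpoly.span {\<tau> (q * v0)}" if "v \<in> V" for v
    using that by (auto simp: T_def)
  then have "\<exists>c. \<tau> (q * v) = mscale c (\<tau> (q * v0))" if "v \<in> V" for v
    using that by (auto simp: mpoly.span_singleton)
  then obtain lam where lam: "\<And>v. v \<in> V \<Longrightarrow> \<tau> (q * v) = mscale (lam v) (\<tau> (q * v0))" by metis
  have *: "\<Phi> (q * v * w) = lam v * \<Phi> (q * v0 * w)" if "v \<in> V" for v w
  proof -
    have "\<tau> (q * v + mscale (- lam v) (q * v0)) = 0"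
      by (simp only: \<tau>_lin lam[OF that]) (simp add: algebra_simps)
    then have "\<Phi> ((q * v + mscale (- lam v) (q * v0)) * w) = 0" unfolding \<tau>_eq_0_iff by blast
    then have "\<Phi> (q * v * w) + (- lam v) * \<Phi> (q * v0 * w) = 0"
      by (simp only: distrib_right \<Phi>_add mult.assoc \<Phi>_scale)
    then show ?thesis by simp
  qed
  \<comment> \<open>Symmetry of \<Phi> (q v w) in v and w turns rank one into c times the square of
    the functional \<open>lam\<close>.\<close>
  define c where "c = \<Phi> (q * v0 * v0)"
  have form: "\<Phi> (q * v * w) = c * lam v * lam w" if "v \<in> V" "w \<in> V" for v w
    using *[OF that(1), of w] *[OF that(2), of v0] by (simp add: c_def mult_ac)
  have form': "\<Phi> (q * (v * w)) = c * lam v * lam w" if "v \<in> V" "w \<in> V" for v w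
    using form[OF that] by (simp add: mult.assoc)
  have "c \<noteq> 0"
  proof
    assume "c = 0"
    then have "\<Phi> (q * v0 * w) = 0" if "w \<in> homog (4 - 3)" for w using form[OF v0(1)] that by simp
    then have "\<tau> (q * v0) = 0"
      using \<tau>_eq_0_homog[OF homog_mult[OF q v0(1)]] by simp
    then show False using v0 by simp
  qed
  define a where "a i = lam (mvar i)" for i
  \<comment> \<open>On quadrics s, \<Phi> (q s) is thus c times the value of s at the point a with
    coordinates \<open>lam\<close> of the variables. As \<Phi> (q f) = 0 for f in \<open>Fs\<close>,
    the point is a common zero; a power of each variable lies in the ideal, so a = 0 and \<Phi> (q
    s) = 0 after all.\<close>
  have ev: "\<Phi> (q * s) = c * peval a s" if "s \<in> homog 2" for s
  proof -
    obtain w where w: "s = (\<Sum>i\<in>UNIV. mvar i * w i)" "\<And>i. w i \<in> homog 1"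
      using \<open>s \<in> homog 2\<close> by (metis homog_Suc One_nat_def numeral_2_eq_2)
    have "\<exists>u. w i = (\<Sum>j\<in>UNIV. mvar j * u j) \<and> (\<forall>j. u j \<in> homog 0)" for i
      using w(2)[of i] by (metis homog_Suc One_nat_def)
    then obtain u where u: "\<And>i. w i = (\<Sum>j\<in>UNIV. mvar j * u i j)" "\<And>i j. u i j \<in> homog 0" by metis
    define d where "d i j = lookup (u i j) 0" for i j
    have s: "s = (\<Sum>i\<in>UNIV. \<Sum>j\<in>UNIV. mconst (d i j) * (mvar i * mvar j))"
      unfolding w(1) u(1) sum_distrib_left
      by (intro sum.cong refl) (metis d_def homog_zero_iff[OF u(2)] mult.commute mult.assoc)
    have "\<Phi> (q * s) = (\<Sum>i\<in>UNIV. \<Sum>j\<in>UNIV. d i j * \<Phi> (q * (mvar i * mvar j)))"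
      unfolding s by (simp add: sum_distrib_left \<Phi>_sum mult.left_commute[of q "mconst _"] \<Phi>_scale mult.assoc)
    also have "\<dots> = c * peval a s"
      unfolding s by (simp add: form'[OF homog_mvar homog_mvar] eval_id.mpeval_sum eval_id.mpeval_mult
          eval_id.mpeval_const eval_id.mpeval_var a_def sum_distrib_left mult_ac)
    finally show ?thesis .
  qed
  have zf: "peval a f = 0" if "f \<in> Fs" for f
    using ev[of f] that Fs \<Phi>_Fs[OF that, of q] \<open>c \<noteq> 0\<close> by (auto simp: mult.commute)
  have zI: "peval a p = 0" if "p \<in> ideal_gen Fs" for p
    using that by (induction rule: ring_ideal.span_induct_alt)
      (auto simp: eval_id.mpeval_0 eval_id.mpeval_add eval_id.mpeval_mult zf)
  obtain N where N: "\<And>t. t \<ge> N \<Longrightarrow> (homog t :: ('n, 'k) mpoly set) \<subseteq> ideal_gen Fs" using primary by blast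
  have "a i = 0" for i
  proof -
    have "peval a (mvar i ^ N) = 0" using zI N homog_mvar_power by blast
    then show ?thesis by (simp add: eval_id.mpeval_power eval_id.mpeval_var)
  qed
  then have "\<Phi> (q * s) = 0" if "s \<in> homog 2" for s
  proof -
    obtain w where w: "s = (\<Sum>i\<in>UNIV. mvar i * w i)"
      using \<open>s \<in> homog 2\<close> by (metis homog_Suc One_nat_def numeral_2_eq_2)
    have "peval a s = 0" using \<open>\<And>i. a i = 0\<close>
      unfolding w by (simp add: eval_id.mpeval_sum eval_id.mpeval_mult eval_id.mpeval_var)
    then show ?thesis using ev[OF that] by simp
  qed
  then have "\<tau> q = 0" using \<tau>_eq_0_homog[OF q] by simp
  then show False using nz by simp
qed

end

lemma mpoly_dim_0 [simp]: "mpoly.dim ({0} :: ('n, 'k::field) mpoly set) = 0"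
  using mpoly.dim_le_card[of "{0} :: ('n, 'k) mpoly set" "{}"] by simp

context quartic
begin

section \<open>Lower bounds for products with linear forms\<close>

lemma dim_V_kernel: "mpoly.dim V = br V + mpoly.dim {v\<in>V. \<tau> v = 0}"
  by (rule br_nullity[OF subspace_homog order_refl])

lemma \<tau>_mult_zero_iff:
  assumes "x \<in> homog 2" "v \<in> V"
  shows "\<tau> (x * v) = 0 \<longleftrightarrow> (\<forall>w\<in>V. \<Phi> (x * (v * w)) = 0)"
  using \<tau>_eq_0_homog[OF homog_mult[OF assms]] by (simp add: mult.assoc)

text \<open>The annihilator of Z contains \<open>Fs\<close> and has codimension c in degree 1, so
  \<open>quadric_codim\<close> bounds its codimension in degree 2 by c(c-1)/2. Its quadrics are
  exactly those orthogonal to Z V, so this codimension is \<open>br (mprod Z V)\<close>.\<close>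

lemma annihilator_codim:
  assumes Z: "Z \<subseteq> V" and c: "mpoly.dim V = c + mpoly.dim {v\<in>V. \<forall>z\<in>Z. \<tau> (z * v) = 0}"
  shows "2 * br (mprod Z V) \<le> c * (c - 1)"
proof -
  define R where "R = {v\<in>V. \<forall>z\<in>Z. \<tau> (z * v) = 0}"
  define Q where "Q = {q\<in>homog 2. \<forall>z\<in>Z. \<tau> (z * q) = 0}"
  have R: "mpoly.subspace R" "R \<subseteq> V" and Q: "mpoly.subspace Q" "Q \<subseteq> homog 2"
    using subspace_homog[of 1] subspace_homog[of 2]
    by (auto simp: R_def Q_def mpoly.subspace_def mult_lin \<tau>_lin)
  have RQ: "r * v \<in> Q" if "r \<in> R" "v \<in> V" for r v
    using that homog_mult[of r 1 v 1] \<tau>_mult[of "_ * r" v]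
    by (auto simp: R_def Q_def numeral_2_eq_2 mult.assoc)
  have FsQ: "Fs \<subseteq> Q"
  proof
    fix f assume f: "f \<in> Fs"
    have "\<tau> f = 0" using \<Phi>_Fs[OF f] by (simp add: \<tau>_eq_0_iff)
    then show "f \<in> Q" using f Fs \<tau>_mult' by (auto simp: Q_def)
  qed
  obtain N where N: "\<And>t. t \<ge> N \<Longrightarrow> (homog t :: ('n, 'k) mpoly set) \<subseteq> ideal_gen Fs" using primary by blast
  have "{q\<in>homog (4 - 2). \<forall>x\<in>mprod Z V. \<Phi> (x * q) = 0} = Q"
  proof (intro Set.set_eqI iffI)
    fix q assume q: "q \<in> {q\<in>homog (4 - 2). \<forall>x\<in>mprod Z V. \<Phi> (x * q) = 0}"
    have "\<tau> (z * q) = 0" if z: "z \<in> Z" for z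
    proof -
      have "\<Phi> (z * q * v) = 0" if "v \<in> V" for v
        using q mprodI[OF z that] by (auto simp: mult.assoc mult.commute[of q])
      moreover have "z * q \<in> homog (1 + 2)" using z Z q by (intro homog_mult) auto
      ultimately show ?thesis using \<tau>_eq_0_homog by fastforce
    qed
    then show "q \<in> Q" using q by (simp add: Q_def)
  next
    fix q assume q: "q \<in> Q"
    have "mprod Z V \<subseteq> {x. \<Phi> (x * q) = 0}"
    proof (rule mprod_least)
      show "mpoly.subspace {x. \<Phi> (x * q) = 0}"
        by (auto simp: mpoly.subspace_def distrib_right \<Phi>_add \<Phi>_scale mult.assoc)
      fix z v assume "z \<in> Z" "v \<in> V"
      then have "\<tau> (z * q) = 0" using q by (simp add: Q_def)
      then have "\<Phi> (z * q * v) = 0" by (simp add: \<tau>_eq_0_iff)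
      then show "z * v \<in> {x. \<Phi> (x * q) = 0}" by (simp add: mult_ac)
    qed
    then show "q \<in> {q\<in>homog (4 - 2). \<forall>x\<in>mprod Z V. \<Phi> (x * q) = 0}" using q by (auto simp: Q_def)
  qed
  then have "mpoly.dim (homog 2 :: ('n, 'k) mpoly set) = br (mprod Z V) + mpoly.dim Q"
    using perp_dim[OF subspace_mprod, of Z V 2] mprod_homog[OF Z order_refl] by (simp add: numeral_2_eq_2)
  moreover have "2 * mpoly.dim (homog 2 :: ('n, 'k) mpoly set) \<le> 2 * mpoly.dim Q + c * (c - 1)"
    using quadric_codim[OF R Q RQ FsQ N] c by (simp add: R_def)
  ultimately show ?thesis by simp
qed

text \<open>\<open>quadric_codim\<close> for the ideal of the quotient itself: a <=
  p(p-1)/2.\<close>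

lemma br_homog_2_le: "2 * br (homog 2) \<le> br V * (br V - 1)"
proof -
  define R where "R = {v\<in>V. \<tau> v = 0}"
  define Q where "Q = {q\<in>homog 2. \<tau> q = 0}"
  have R: "mpoly.subspace R" "R \<subseteq> V" and Q: "mpoly.subspace Q" "Q \<subseteq> homog 2"
    using mpoly.subspace_endo_kernel[OF _ _ subspace_homog, of \<tau>] by (auto simp: R_def Q_def \<tau>_lin)
  have RQ: "r * v \<in> Q" if "r \<in> R" "v \<in> V" for r v
    using that homog_mult[of r 1 v 1] \<tau>_mult by (auto simp: R_def Q_def numeral_2_eq_2)
  have FsQ: "Fs \<subseteq> Q" using Fs \<Phi>_Fs by (auto simp: Q_def \<tau>_eq_0_iff)
  obtain N where N: "\<And>t. t \<ge> N \<Longrightarrow> (homog t :: ('n, 'k) mpoly set) \<subseteq> ideal_gen Fs" using primary by blast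
  show ?thesis
    using quadric_codim[OF R Q RQ FsQ N] dim_V_kernel br_nullity[OF subspace_homog order_refl, of 2]
    by (simp add: R_def Q_def)
qed

text \<open>For Z = {l} the number c = \<open>br (mprod {l} V)\<close> occurs on both sides of
  \<open>annihilator_codim\<close>: c <= c(c-1)/2, so c = 0 or c >= 3. The value 0 would make l a
  socle element of degree 1.\<close>

lemma br_mult_V:
  assumes l: "l \<in> V" "\<tau> l \<noteq> 0"
  shows "br (mprod {l} V) \<ge> 3"
proof -
  define c where "c = br (mprod {l} V)"
  have d: "mpoly.dim V = c + mpoly.dim {v\<in>V. \<tau> (l * v) = 0}"
    using mult_nullity[OF subspace_homog order_refl, of 1 l] by (simp add: c_def mprod_single subspace_homog)
  then have le: "2 * c \<le> c * (c - 1)"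
    using annihilator_codim[of "{l}" c] l by (simp add: c_def)
  have "c \<noteq> 0"
  proof
    assume "c = 0"
    then have "{v\<in>V. \<tau> (l * v) = 0} = V"
      using d mpoly.subspace_endo_kernel[OF _ _ subspace_homog, of "\<lambda>v. \<tau> (l * v)" 1]
      by (intro mpoly.subspace_dim_eq) (auto simp: fin_dim_homog mult_lin \<tau>_lin)
    then have "\<tau> (l * v) = 0" if "v \<in> V" for v using that by blast
    then show False using \<tau>_eq_0_linear[OF l(1)] l(2) by simp
  qed
  then have "2 \<le> c - 1" using le mult.commute[of c] by (metis mult_le_cancel2 neq0_conv)
  then show ?thesis by (simp add: c_def)
qed

lemma pencil:
  assumes U: "mpoly.subspace U" "U \<subseteq> V" "U \<noteq> {0}" and Y: "mpoly.subspace Y" "Y \<subseteq> homog t" "br Y \<le> mpoly.dim U"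
    and m: "\<And>u. u \<in> U \<Longrightarrow> x * u \<in> Y" "\<And>u. u \<in> U \<Longrightarrow> y * u \<in> Y" and ind: "tind x y"
  obtains a b u where "\<tau> (mscale a x + mscale b y) \<noteq> 0" "u \<in> U" "u \<noteq> 0"
    "\<tau> ((mscale a x + mscale b y) * u) = 0"
proof -
  obtain a b u where s: "(a, b) \<noteq> (0, 0)" "u \<in> U" "u \<noteq> 0" "mscale a (\<tau> (x * u)) + mscale b (\<tau> (y * u)) = 0"
  proof (rule singular_pencil[of mscale U "\<tau> ` Y" "\<lambda>u. \<tau> (x * u)" "\<lambda>u. \<tau> (y * u)"])
    show "vector_space (mscale :: 'k \<Rightarrow> ('n, 'k) mpoly \<Rightarrow> _)" by (rule mpoly.vector_space_axioms)
    show "mpoly.subspace (\<tau> ` Y)" by (rule mpoly.subspace_endo_image) (auto simp: \<tau>_lin Y)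
    show "mpoly.fin_dim (\<tau> ` Y)"
      by (rule mpoly.fin_dim_endo_image) (use Y in \<open>auto simp: \<tau>_lin fin_dim_homog_subset\<close>)
    show "mpoly.dim (\<tau> ` Y) \<le> mpoly.dim U" using Y(3) by (simp add: br_def)
    show "mpoly.fin_dim U" using U(2) by (rule fin_dim_homog_subset)
  qed (use U m in \<open>auto simp: \<tau>_lin mult_lin\<close>)
  have "(mscale a x + mscale b y) * u = mscale a (x * u) + mscale b (y * u)"
    by (simp add: distrib_right mult.assoc)
  then have "\<tau> ((mscale a x + mscale b y) * u) = 0" using s(4) by (simp only: \<tau>_lin)
  then show thesis using that tindD[OF ind s(1)] s by blast
qed

lemma kernel2:
  assumes "mpoly.dim V = c + mpoly.dim {v\<in>V. \<tau> (x * v) = 0 \<and> \<tau> (y * v) = 0}"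
  obtains U where "mpoly.subspace U" "U \<subseteq> V" "mpoly.dim U = c"
    "\<And>u. u \<in> U \<Longrightarrow> \<tau> (x * u) = 0 \<Longrightarrow> \<tau> (y * u) = 0 \<Longrightarrow> u = 0"
proof -
  define R where "R = {v\<in>V. \<tau> (x * v) = 0 \<and> \<tau> (y * v) = 0}"
  have R: "mpoly.subspace R" "R \<subseteq> V"
    using subspace_homog[of 1] by (auto simp: R_def mpoly.subspace_def mult_lin \<tau>_lin)
  obtain U where U: "mpoly.subspace U" "U \<subseteq> V" "U \<inter> R = {0}" "mpoly.dim V = mpoly.dim U + mpoly.dim R"
    using mpoly.complement_exists[OF subspace_homog fin_dim_homog R] by metis
  have "mpoly.dim U = c" using U(4) assms by (simp add: R_def)
  moreover have "u = 0" if "u \<in> U" "\<tau> (x * u) = 0" "\<tau> (y * u) = 0" for u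
    using that U(2,3) by (auto simp: R_def)
  ultimately show thesis using that U by blast
qed

lemma mprod2_V:
  assumes "u \<in> V"
  shows "x * u \<in> mprod {x, y} V" "y * u \<in> mprod {x, y} V" "(mscale a x + mscale b y) * u \<in> mprod {x, y} V"
proof -
  show *: "x * u \<in> mprod {x, y} V" "y * u \<in> mprod {x, y} V" using assms by (auto intro: mprodI)
  show "(mscale a x + mscale b y) * u \<in> mprod {x, y} V"
    using mpoly.subspace_add[OF subspace_mprod mpoly.subspace_scale[OF subspace_mprod *(1), of a]
        mpoly.subspace_scale[OF subspace_mprod *(2), of b]]
    by (simp add: distrib_right mult.assoc)
qed

text \<open>If x V + y V had dimension at most 2, then by duality the common annihilator R of x and
  y in V would have codimension equal to this dimension. On a complement of R the pencil of x and y
  has a singular member, which kills R and one more vector, hence has rank at most one;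
  \<open>rank_one_zero\<close> excludes this.\<close>

lemma quadric_pair_br:
  assumes q: "x \<in> homog 2" "y \<in> homog 2" "tind x y"
  shows "br (mprod {x, y} V) \<ge> 3"
proof (rule ccontr)
  assume "\<not> br (mprod {x, y} V) \<ge> 3"
  define Y where "Y = mprod {x, y} V"
  have br: "br Y \<le> 2" using \<open>\<not> br (mprod {x, y} V) \<ge> 3\<close> by (simp add: Y_def)
  have Y: "mpoly.subspace Y" "Y \<subseteq> homog 3" using mprod_homog[of "{x, y}" 2 V 1] q by (auto simp: Y_def)
  have "{v\<in>homog (4 - 3). \<forall>z\<in>Y. \<Phi> (z * v) = 0} = {v\<in>V. \<tau> (x * v) = 0 \<and> \<tau> (y * v) = 0}" (is "?L = ?R")
  proof (intro Set.set_eqI iffI)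
    fix v assume v: "v \<in> ?L"
    have "\<Phi> (z * (v * w)) = 0" if "z \<in> {x, y}" "w \<in> V" for z w
      using v mprodI[OF that] unfolding Y_def by (auto simp: mult_ac)
    then show "v \<in> ?R" using v q \<tau>_mult_zero_iff by auto
  next
    fix v assume v: "v \<in> ?R"
    have "Y \<subseteq> {z. \<Phi> (z * v) = 0}"
      unfolding Y_def
    proof (rule mprod_least)
      show "mpoly.subspace {z. \<Phi> (z * v) = 0}"
        by (auto simp: mpoly.subspace_def distrib_right \<Phi>_add \<Phi>_scale mult.assoc)
      fix z w assume "z \<in> {x, y}" "w \<in> V"
      then have "\<Phi> (z * v * w) = 0" using v by (auto simp: \<tau>_eq_0_iff)
      then show "z * w \<in> {z. \<Phi> (z * v) = 0}" by (simp add: mult_ac)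
    qed
    then show "v \<in> ?L" using v by auto
  qed
  then have d: "mpoly.dim V = br Y + mpoly.dim {v\<in>V. \<tau> (x * v) = 0 \<and> \<tau> (y * v) = 0}"
    using perp_dim[OF Y] by simp
  from kernel2[OF d] obtain U where U: "mpoly.subspace U" "U \<subseteq> V" "mpoly.dim U = br Y"
    "\<And>u. u \<in> U \<Longrightarrow> \<tau> (x * u) = 0 \<Longrightarrow> \<tau> (y * u) = 0 \<Longrightarrow> u = 0" by blast
  define R where "R = {v\<in>V. \<tau> (x * v) = 0 \<and> \<tau> (y * v) = 0}"
  have R: "mpoly.subspace R" "R \<subseteq> V"
    using subspace_homog[of 1] by (auto simp: R_def mpoly.subspace_def mult_lin \<tau>_lin)
  have U0: "U \<noteq> {0}"
  proof
    assume "U = {0}"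
    then have "br Y = 0" using U(3) by simp
    then have "R = V" using d R by (intro mpoly.subspace_dim_eq) (auto simp: fin_dim_homog R_def)
    then have "\<tau> x = 0" using \<tau>_eq_0_linear[OF q(1)] by (auto simp: R_def)
    then show False using tindD[OF q(3), of 1 0] by simp
  qed
  have m: "\<And>u. u \<in> U \<Longrightarrow> x * u \<in> Y" "\<And>u. u \<in> U \<Longrightarrow> y * u \<in> Y"
    using U(2) mprod2_V(1,2) by (auto simp: Y_def)
  have "br Y \<le> mpoly.dim U" using U(3) by simp
  from pencil[OF U(1,2) U0 Y this m q(3)]
  obtain a b u where u: "\<tau> (mscale a x + mscale b y) \<noteq> 0" "u \<in> U" "u \<noteq> 0"
    "\<tau> ((mscale a x + mscale b y) * u) = 0" by blast
  define p where "p = mscale a x + mscale b y"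
  have p: "p \<in> homog 2" using q by (auto simp: p_def intro: homog_add homog_scale)
  define K where "K = {v\<in>V. \<tau> (p * v) = 0}"
  have "R \<subseteq> K" unfolding R_def K_def p_def by (auto simp: distrib_right \<tau>_lin mult.assoc)
  moreover have "u \<in> K" using u U by (auto simp: K_def p_def)
  moreover have "u \<notin> R" using u U(4) by (auto simp: R_def)
  moreover have "mpoly.fin_dim K" by (rule fin_dim_homog_subset[of _ 1]) (auto simp: K_def)
  ultimately have "mpoly.dim R < mpoly.dim K"
    using mpoly.subspace_dim_eq[OF R(1), of K] by (metis not_less)
  then have "br ((\<lambda>v. p * v) ` V) \<le> 1"
    using mult_nullity[OF subspace_homog order_refl, of 1 p] d br by (simp add: K_def R_def)
  then have "\<tau> p = 0" by (rule rank_one_zero[OF p])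
  then show False using u by (simp add: p_def)
qed

text \<open>With Y = x V + y V of dimension at most 4, anything killed by one member of the pencil
  turns out to be killed by both x and y. Then Y is no larger than a complement U of the common
  annihilator, and the pencil on U has a singular member, a contradiction.\<close>

lemma linear_pair_br:
  assumes z: "x \<in> V" "y \<in> V" "tind x y"
  shows "br (mprod {x, y} V) \<ge> 5"
proof (rule ccontr)
  assume "\<not> br (mprod {x, y} V) \<ge> 5"
  define Y where "Y = mprod {x, y} V"
  have br: "br Y \<le> 4" using \<open>\<not> br (mprod {x, y} V) \<ge> 5\<close> by (simp add: Y_def)
  have Y: "mpoly.subspace Y" "Y \<subseteq> homog 2" using mprod_homog[of "{x, y}" 1 V 1] z by (auto simp: Y_def numeral_2_eq_2)
  \<comment> \<open>m kills w V, which has dimension at least 3 inside Y, so m Y has dimension at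
    most 4 - 3 = 1. It contains z' m V, so the quadric z' m has rank at most one and
    vanishes.\<close>
  have all: "\<tau> (z' * m) = 0"
    if m: "m \<in> V" and w: "w = mscale a x + mscale b y" "\<tau> w \<noteq> 0" "\<tau> (w * m) = 0" and z': "z' \<in> {x, y}" for m w a b z'
  proof (rule rank_one_zero)
    show "z' * m \<in> homog 2" using homog_mult[of z' 1 m 1] z' z m by (auto simp: numeral_2_eq_2)
    have wV: "w \<in> V" using z by (auto simp: w intro: homog_add homog_scale)
    have sub: "mprod {w} V \<subseteq> Y"
      by (rule mprod_least) (use mprod2_V(3)[of _ a x b y] w(1) in \<open>auto simp: Y_def\<close>)
    have "\<tau> (m * v) = 0" if "v \<in> mprod {w} V" for v
    proof -
      have "v \<in> (\<lambda>x. w * x) ` V" using that mprod_single[OF subspace_homog] by blast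
      then obtain u where "v = w * u" by blast
      then have "m * v = w * m * u" by (simp add: mult_ac)
      then show ?thesis using \<tau>_mult[OF w(3)] by simp
    qed
    then have "br ((\<lambda>v. m * v) ` Y) + br (mprod {w} V) \<le> br Y" using mult_br[OF Y sub] by blast
    then have "br ((\<lambda>v. m * v) ` Y) \<le> 1" using br_mult_V[OF wV w(2)] br by simp
    moreover have "(\<lambda>v. z' * m * v) ` V \<subseteq> (\<lambda>v. m * v) ` Y"
    proof (rule image_subsetI)
      fix v assume "v \<in> V"
      then have "z' * v \<in> Y" using mprodI[of z' "{x, y}" v V] z' by (simp add: Y_def)
      moreover have "z' * m * v = m * (z' * v)" by (simp add: mult_ac)
      ultimately show "z' * m * v \<in> (\<lambda>v. m * v) ` Y" by (metis imageI)
    qed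
    moreover have "(\<lambda>v. m * v) ` Y \<subseteq> homog 3" using Y(2) homog_mult[OF m] by (fastforce simp: numeral_3_eq_3 numeral_2_eq_2)
    ultimately show "br ((\<lambda>v. z' * m * v) ` V) \<le> 1" using br_mono by (meson le_trans)
  qed
  have x0: "\<tau> x \<noteq> 0" using tindD[OF z(3), of 1 0] by simp
  have "{v\<in>V. \<tau> (x * v) = 0} = {v\<in>V. \<tau> (x * v) = 0 \<and> \<tau> (y * v) = 0}"
    using all[of _ x 1 0] x0 by auto
  moreover define c where "c = br (mprod {x} V)"
  ultimately have d: "mpoly.dim V = c + mpoly.dim {v\<in>V. \<tau> (x * v) = 0 \<and> \<tau> (y * v) = 0}"
    using mult_nullity[OF subspace_homog order_refl, of 1 x] by (simp add: mprod_single subspace_homog)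
  have c: "3 \<le> c" "c \<le> br Y"
    using br_mult_V[OF z(1) x0] br_mono[of "mprod {x} V" Y 2] mprod_mono[of "{x}" "{x, y}" V V] Y
    by (auto simp: c_def Y_def)
  have "2 * br Y \<le> c * (c - 1)" using annihilator_codim[of "{x, y}" c] z d by (simp add: Y_def)
  moreover have "c = 3 \<or> c = 4" using c br by linarith
  \<comment> \<open>For c = 3 the bound c(c-1)/2 equals c; for c = 4 the assumption on Y
    suffices.\<close>
  ultimately have brc: "br Y \<le> c" using br by auto
  from kernel2[OF d] obtain U where U: "mpoly.subspace U" "U \<subseteq> V" "mpoly.dim U = c"
    "\<And>u. u \<in> U \<Longrightarrow> \<tau> (x * u) = 0 \<Longrightarrow> \<tau> (y * u) = 0 \<Longrightarrow> u = 0" by blast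
  have U0: "U \<noteq> {0}" using U(3) c by auto
  have m: "\<And>u. u \<in> U \<Longrightarrow> x * u \<in> Y" "\<And>u. u \<in> U \<Longrightarrow> y * u \<in> Y"
    using U(2) mprod2_V(1,2) by (auto simp: Y_def)
  have "br Y \<le> mpoly.dim U" using U(3) brc by simp
  from pencil[OF U(1,2) U0 Y this m z(3)]
  obtain a b u where u: "\<tau> (mscale a x + mscale b y) \<noteq> 0" "u \<in> U" "u \<noteq> 0"
    "\<tau> ((mscale a x + mscale b y) * u) = 0" by blast
  then show False using all[OF _ refl u(1,4)] U by blast
qed

section \<open>Zero divisors and the possible pairs (p, a)\<close>

lemma zero_divisors:
  fixes u :: "'p::finite \<Rightarrow> ('n, 'k) mpoly"
  assumes u: "\<And>i. u i \<in> V" "\<And>c. \<tau> (\<Sum>i\<in>UNIV. mscale (c i) (u i)) = 0 \<Longrightarrow> \<forall>i. c i = 0"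
    and a: "br (homog 2) < 2 * CARD('p) - 2"
  obtains l x where "l \<in> V" "x \<in> V" "\<tau> l \<noteq> 0" "\<tau> x \<noteq> 0" "\<tau> (l * x) = 0"
proof -
  have "mpoly.fin_dim (\<tau> ` homog 2)"
    by (rule mpoly.fin_dim_endo_image) (auto simp: \<tau>_lin fin_dim_homog)
  then obtain B where B: "B \<subseteq> \<tau> ` homog 2" "\<tau> ` homog 2 \<subseteq> mpoly.span B" "card B = br (homog 2)" "finite B"
    unfolding br_def using mpoly.fin_dim_basis by metis
  have "\<exists>c. \<tau> (u i * u j) = (\<Sum>b\<in>B. mscale (c b) b)" for i j
  proof -
    have "u i * u j \<in> homog 2" using homog_mult[OF u(1) u(1), of i j] by (simp add: numeral_2_eq_2)
    then have "\<tau> (u i * u j) \<in> mpoly.span ((\<lambda>b. b) ` B)" using B(2) by auto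
    then show ?thesis using mpoly.span_image_sum[OF _ B(4), of _ "\<lambda>b. b"] by blast
  qed
  note ex = this
  define \<gamma> where "\<gamma> i j = (SOME c. \<tau> (u i * u j) = (\<Sum>b\<in>B. mscale (c b) b))" for i j
  have \<gamma>: "\<tau> (u i * u j) = (\<Sum>b\<in>B. mscale (\<gamma> i j b) b)" for i j
    unfolding \<gamma>_def using ex by (rule someI_ex)
  define \<beta> where "\<beta> b i j = \<gamma> i j b" for b i j
  have \<beta>: "\<tau> (u i * u j) = (\<Sum>b\<in>B. mscale (\<beta> b i j) b)" for i j by (simp add: \<gamma> \<beta>_def)
  have "card B < 2 * CARD('p) - 2" using a B(3) by simp
  from bilinear_zero[OF B(4) this, of \<beta>]
  obtain l x :: "'p \<Rightarrow> 'k" where lx: "\<exists>i. l i \<noteq> 0" "\<exists>i. x i \<noteq> 0"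
    "\<And>b. b \<in> B \<Longrightarrow> (\<Sum>i\<in>UNIV. \<Sum>j\<in>UNIV. \<beta> b i j * l i * x j) = 0"
    by blast
  define L where "L = (\<Sum>i\<in>UNIV. mscale (l i) (u i))"
  define X where "X = (\<Sum>i\<in>UNIV. mscale (x i) (u i))"
  have sum: "\<tau> (\<Sum>i\<in>I. g i) = (\<Sum>i\<in>I. \<tau> (g i))" for I :: "'p set" and g
    by (rule additive_eq_sum) (rule \<tau>_add)
  have "L * X = (\<Sum>i\<in>UNIV. \<Sum>j\<in>UNIV. mscale (l i * x j) (u i * u j))"
    by (simp add: L_def X_def sum_product mult_ac)
  then have "\<tau> (L * X) = (\<Sum>i\<in>UNIV. \<Sum>j\<in>UNIV. \<Sum>b\<in>B. mscale (\<beta> b i j * l i * x j) b)"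
    by (simp only: sum \<tau>_scale \<beta>) (simp add: sum_distrib_left mult_ac)
  also have "\<dots> = (\<Sum>b\<in>B. \<Sum>i\<in>UNIV. \<Sum>j\<in>UNIV. mscale (\<beta> b i j * l i * x j) b)"
    by (subst sum.swap[of _ B], subst sum.swap[of _ B]) simp
  also have "\<dots> = (\<Sum>b\<in>B. mscale (\<Sum>i\<in>UNIV. \<Sum>j\<in>UNIV. \<beta> b i j * l i * x j) b)"
    by (simp only: mconst_sum sum_distrib_right)
  also have "\<dots> = 0" using lx(3) by simp
  finally have "\<tau> (L * X) = 0" .
  moreover have "L \<in> V" "X \<in> V" unfolding L_def X_def by (intro homog_sum homog_scale u)+
  moreover have "\<tau> L \<noteq> 0" "\<tau> X \<noteq> 0" using lx u(2) unfolding L_def X_def by blast+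
  ultimately show thesis using that by blast
qed

text \<open>\<open>bilinear_zero\<close> indexes its unknowns by a type, so a basis of the degree 1
  part of the quotient is transported to a type with p elements.\<close>

lemma zero_divisors_card:
  assumes p: "CARD('p::finite) = br V" and a: "br (homog 2) < 2 * br V - 2"
  obtains l x where "l \<in> V" "x \<in> V" "\<tau> l \<noteq> 0" "\<tau> x \<noteq> 0" "\<tau> (l * x) = 0"
proof -
  have "mpoly.fin_dim (\<tau> ` V)"
    by (rule mpoly.fin_dim_endo_image) (auto simp: \<tau>_lin fin_dim_homog)
  then obtain B where B: "B \<subseteq> \<tau> ` V" "mpoly.independent B" "card B = br V" "finite B"
    unfolding br_def using mpoly.fin_dim_basis by metis
  obtain h :: "'p \<Rightarrow> ('n, 'k) mpoly" where h: "bij_betw h UNIV B"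
    using finite_same_card_bij[of "UNIV :: 'p set" B] B p by auto
  have "\<forall>i. \<exists>u. u \<in> V \<and> \<tau> u = h i"
  proof
    fix i
    have "h i \<in> \<tau> ` V" using bij_betwE[OF h] subsetD[OF B(1)] by simp
    then show "\<exists>u. u \<in> V \<and> \<tau> u = h i" by (metis (no_types) imageE)
  qed
  then obtain u where u: "\<And>i. u i \<in> V" "\<And>i. \<tau> (u i) = h i" by metis
  have ind: "\<forall>i. c i = 0" if z: "\<tau> (\<Sum>i\<in>UNIV. mscale (c i) (u i)) = 0" for c
  proof
    fix i
    have "(\<Sum>b\<in>B. mscale (c (the_inv h b)) b) = (\<Sum>i\<in>UNIV. mscale (c (the_inv h (h i))) (h i))"
      using h by (intro sum.reindex_bij_betw[symmetric])
    also have "\<dots> = (\<Sum>i\<in>UNIV. mscale (c i) (h i))"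
      using h by (intro sum.cong) (auto simp: bij_betw_def the_inv_f_f)
    also have "\<dots> = \<tau> (\<Sum>i\<in>UNIV. mscale (c i) (u i))"
      by (simp add: additive_eq_sum[of \<tau>, OF \<tau>_add] \<tau>_scale u)
    finally have "(\<Sum>b\<in>B. mscale (c (the_inv h b)) b) = 0" using z by simp
    then have "c (the_inv h (h i)) = 0"
      using mpoly.independentD[OF B(2,4) order_refl, of "\<lambda>b. c (the_inv h b)" "h i"] h by (auto simp: bij_betw_def)
    then show "c i = 0" using h by (auto simp: bij_betw_def the_inv_f_f)
  qed
  show thesis by (rule zero_divisors[OF u(1) ind]) (use a p that in auto)
qed

text \<open>A quartic with \<Phi> nonzero is a sum of products of two variables with a quadric, and
  one of these quadrics survives in the quotient.\<close>

lemma br_homog_2_pos: "br (homog 2) > 0"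
proof -
  obtain p where p: "\<Phi> p \<noteq> 0" using nonzero by blast
  obtain N where N: "p = (\<Sum>t\<le>N. hcomp t p)" using sum_hcomp_ex by blast
  have "\<Phi> (\<Sum>t\<le>N. hcomp t p) \<noteq> 0" using p N by simp
  then obtain t where t: "\<Phi> (hcomp t p) \<noteq> 0" unfolding \<Phi>_sum by (meson sum.not_neutral_contains_not_neutral)
  then have "t = 4" using \<Phi>_homog[OF hcomp_homog] by metis
  then obtain q where q: "hcomp t p = (\<Sum>i\<in>UNIV. mvar i * q i)" "\<And>i. q i \<in> homog 3"
    using hcomp_homog[of 4 p] by (metis homog_Suc eval_nat_numeral(2,3) semiring_norm(26,27,28) numeral_3_eq_3)
  have "\<exists>r. q i = (\<Sum>j\<in>UNIV. mvar j * r j) \<and> (\<forall>j. r j \<in> homog 2)" for i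
    using q(2)[of i] by (metis homog_Suc numeral_3_eq_3 numeral_2_eq_2)
  then obtain r where r: "\<And>i. q i = (\<Sum>j\<in>UNIV. mvar j * r i j)" "\<And>i j. r i j \<in> homog 2" by metis
  have "(\<Sum>i\<in>UNIV. \<Sum>j\<in>UNIV. \<Phi> (mvar i * (mvar j * r i j))) \<noteq> 0"
    using t unfolding q(1) r(1) by (simp add: sum_distrib_left \<Phi>_sum)
  then obtain i j where "\<Phi> (mvar i * (mvar j * r i j)) \<noteq> 0"
    by (meson sum.not_neutral_contains_not_neutral)
  then have "\<Phi> (r i j * (mvar i * mvar j)) \<noteq> 0" by (simp add: mult_ac)
  then have nz: "\<tau> (r i j) \<noteq> 0" unfolding \<tau>_eq_0_iff by blast
  have f: "mpoly.fin_dim (\<tau> ` homog 2)"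
    by (rule mpoly.fin_dim_endo_image) (auto simp: \<tau>_lin fin_dim_homog)
  have "1 = mpoly.dim {\<tau> (r i j)}" using nz mpoly.dim_eq_card_independent[of "{\<tau> (r i j)}"] by simp
  also have "\<dots> \<le> br (homog 2)" unfolding br_def by (rule mpoly.dim_mono_subset[OF f]) (use r in auto)
  finally show ?thesis by simp
qed

lemma br_range:
  assumes p6: "br V \<le> 6"
  shows "br V = 4 \<and> br (homog 2) = 6 \<or> br V = 5 \<and> br (homog 2) \<in> {8..10} \<or> br V = 6 \<and> br (homog 2) \<in> {9..15}"
proof -
  define p where "p = br V"
  define a where "a = br (homog 2)"
  have ub: "2 * a \<le> p * (p - 1)" using br_homog_2_le by (simp add: a_def p_def)
  have a0: "a > 0" using br_homog_2_pos by (simp add: a_def)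
  \<comment> \<open>(x v)(y v') = (x y)(v v'): if X annihilates Y, then X V and Y V are orthogonal
    under \<Phi>.\<close>
  have orth: "br (mprod X V) + br (mprod Y V) \<le> a"
    if XY: "X \<subseteq> V" "Y \<subseteq> V" "\<And>x y. x \<in> X \<Longrightarrow> y \<in> Y \<Longrightarrow> \<tau> (x * y) = 0" for X Y
    unfolding a_def
  proof (rule orthogonal_br)
    show "mpoly.subspace (mprod X V)" "mprod X V \<subseteq> homog 2" "mprod Y V \<subseteq> homog 2"
      using mprod_homog[OF XY(1) order_refl] mprod_homog[OF XY(2) order_refl] by (auto simp: numeral_2_eq_2)
    fix z w assume "z \<in> mprod X V" "w \<in> mprod Y V"
    have *: "\<Phi> (x * v * w) = 0" if "x \<in> X" "v \<in> V" for x v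
    proof -
      have "mprod Y V \<subseteq> {w. \<Phi> (x * v * w) = 0}"
      proof (rule mprod_least)
        show "mpoly.subspace {w. \<Phi> (x * v * w) = 0}"
          by (auto simp: mpoly.subspace_def distrib_left \<Phi>_add mult_lin \<Phi>_scale)
        fix y v' assume "y \<in> Y"
        then have "\<Phi> (x * y * (v * v')) = 0" using XY(3) that unfolding \<tau>_eq_0_iff by blast
        then show "y * v' \<in> {w. \<Phi> (x * v * w) = 0}" by (simp add: mult_ac)
      qed
      then show ?thesis using \<open>w \<in> mprod Y V\<close> by blast
    qed
    have "mprod X V \<subseteq> {z. \<Phi> (z * w) = 0}"
    proof (rule mprod_least)
      show "mpoly.subspace {z. \<Phi> (z * w) = 0}"
        by (auto simp: mpoly.subspace_def distrib_right \<Phi>_add \<Phi>_scale mult.assoc)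
      show "x * v \<in> {z. \<Phi> (z * w) = 0}" if "x \<in> X" "v \<in> V" for x v using *[OF that] by simp
    qed
    then show "\<Phi> (z * w) = 0" using \<open>z \<in> mprod X V\<close> by blast
  qed
  have zd: "\<exists>l x. l \<in> V \<and> x \<in> V \<and> \<tau> l \<noteq> 0 \<and> \<tau> x \<noteq> 0 \<and> \<tau> (l * x) = 0" if az: "a < 2 * p - 2"
  proof -
    have "p \<ge> 2" using az by simp
    \<comment> \<open>The type argument of \<open>zero_divisors_card\<close> has to be a fixed type
      for each value of p.\<close>
    then consider "p = CARD(2)" | "p = CARD(3)" | "p = CARD(4)" | "p = CARD(5)" | "p = CARD(6)"
      using p6 p_def by (simp, linarith)
    then show ?thesis
    proof cases
      case 1 show ?thesis by (rule zero_divisors_card[where 'p = 2]) (use 1 az in \<open>auto simp: a_def p_def\<close>)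
    next
      case 2 show ?thesis by (rule zero_divisors_card[where 'p = 3]) (use 2 az in \<open>auto simp: a_def p_def\<close>)
    next
      case 3 show ?thesis by (rule zero_divisors_card[where 'p = 4]) (use 3 az in \<open>auto simp: a_def p_def\<close>)
    next
      case 4 show ?thesis by (rule zero_divisors_card[where 'p = 5]) (use 4 az in \<open>auto simp: a_def p_def\<close>)
    next
      case 5 show ?thesis by (rule zero_divisors_card[where 'p = 6]) (use 5 az in \<open>auto simp: a_def p_def\<close>)
    qed
  qed
  define c where "c l = br (mprod {l} V)" for l
  \<comment> \<open>Of two elements annihilating each other, one takes at most half of a.\<close>
  have zdc: "\<exists>l\<in>V. \<tau> l \<noteq> 0 \<and> 2 * c l \<le> a" if az: "a < 2 * p - 2"
  proof -
    obtain l x where lx: "l \<in> V" "x \<in> V" "\<tau> l \<noteq> 0" "\<tau> x \<noteq> 0" "\<tau> (l * x) = 0" using zd[OF az] by blast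
    have "c l + c x \<le> a" using orth[of "{l}" "{x}"] lx by (simp add: c_def)
    then have "2 * c l \<le> a \<or> 2 * c x \<le> a" by linarith
    then show ?thesis using lx by blast
  qed
  have a6: "a \<ge> 6" if "a < 2 * p - 2" using zdc[OF that] br_mult_V by (force simp: c_def)
  \<comment> \<open>Let Z be the annihilator of an l with 2 \<open>c l\<close> <= a <= 8. Its image
    has dimension p - \<open>c l\<close> >= 2, and a pair in Z forces 5 + \<open>c l\<close> <= a.
    Only \<open>c l\<close> = 3, a = 8, p = 6 remains, and Z has image of dimension 3.\<close>
  have small: False if small: "a < 2 * p - 2" "a \<le> 8" "p \<ge> 5"
  proof -
    obtain l where l: "l \<in> V" "\<tau> l \<noteq> 0" "2 * c l \<le> a" using zdc small by blast
    define Z where "Z = {z\<in>V. \<tau> (l * z) = 0}"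
    have Z: "mpoly.subspace Z" "Z \<subseteq> V"
      using mpoly.subspace_endo_kernel[OF _ _ subspace_homog, of "\<lambda>v. \<tau> (l * v)"] by (auto simp: Z_def \<tau>_lin mult_lin)
    define k where "k = mpoly.dim {v\<in>V. \<tau> v = 0}"
    have dV: "mpoly.dim V = p + k" using dim_V_kernel by (simp add: p_def k_def)
    have kerZ: "{z\<in>Z. \<tau> z = 0} = {v\<in>V. \<tau> v = 0}" by (auto simp: Z_def \<tau>_mult')
    have dZ: "mpoly.dim Z = br Z + k" using br_nullity[OF Z] by (simp add: kerZ k_def)
    have "mpoly.dim V = c l + mpoly.dim Z"
      using mult_nullity[OF subspace_homog order_refl, of 1 l] by (simp add: c_def Z_def mprod_single subspace_homog)
    then have brZ: "br Z + c l = p" using dV dZ by simp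
    have c3: "c l \<ge> 3" using br_mult_V l by (simp add: c_def)
    have "br Z \<ge> 2" using brZ l(3) small p6 p_def c3 by linarith
    then obtain z1 z2 where z: "z1 \<in> Z" "z2 \<in> Z" "tind z1 z2" using tind_exists Z(2) by metis
    have zV: "z1 \<in> V" "z2 \<in> V" using z Z by auto
    have Y5: "br (mprod {z1, z2} V) \<ge> 5" by (rule linear_pair_br[OF zV z(3)])
    have Yc: "br (mprod X V) + c l \<le> a" if "X \<subseteq> Z" for X
      using orth[of X "{l}"] that Z l by (auto simp: c_def Z_def mult.commute)
    have "5 + c l \<le> a" using Yc[of "{z1, z2}"] z Y5 by simp
    then have eq: "c l = 3" "a = 8" using c3 small(2) by auto
    then have p: "p = 6" using small(1) p6 p_def small(3) by auto
    define Y where "Y = mprod Z V"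
    have Y: "mpoly.subspace Y" "Y \<subseteq> homog 2" "br Y \<le> 5"
      using Yc[of Z] eq mprod_homog[OF Z(2) order_refl] by (auto simp: Y_def numeral_2_eq_2)
    \<comment> \<open>Two independent pairs annihilating each other would need 5 + 5 <= 8.\<close>
    have not2: False if m: "m1 \<in> V" "m2 \<in> V" "tind m1 m2" "n1 \<in> V" "n2 \<in> V" "tind n1 n2"
      "\<And>m n. m \<in> {m1, m2} \<Longrightarrow> n \<in> {n1, n2} \<Longrightarrow> \<tau> (m * n) = 0" for m1 m2 n1 n2
      using orth[of "{m1, m2}" "{n1, n2}"] linear_pair_br[OF m(1-3)] linear_pair_br[OF m(4-6)] m eq by auto
    \<comment> \<open>The annihilator R of Z contains l, and \<open>not2\<close> limits its image to
      dimension 1. A complement U of R then has dimension at least 5, while Y has image of dimension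
      at most 5; so the pencil of z1 and z2 from U to Y has a singular member.\<close>
    define R where "R = {m\<in>V. \<forall>z\<in>Z. \<tau> (z * m) = 0}"
    have R: "mpoly.subspace R" "R \<subseteq> V"
      using subspace_homog[of 1] by (auto simp: R_def mpoly.subspace_def mult_lin \<tau>_lin)
    have "br R \<le> 1"
    proof (rule ccontr)
      assume "\<not> br R \<le> 1"
      then obtain m1 m2 where "m1 \<in> R" "m2 \<in> R" "tind m1 m2" using tind_exists[of R 1] R(2) by (metis not_less_eq_eq Suc_1 One_nat_def)
      then show False using not2[OF zV z(3), of m1 m2] z by (auto simp: R_def)
    qed
    moreover have "{v\<in>R. \<tau> v = 0} = {v\<in>V. \<tau> v = 0}" by (auto simp: R_def \<tau>_mult')
    ultimately have dR: "mpoly.dim R \<le> 1 + k" using br_nullity[OF R] by (simp add: k_def)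
    obtain U where U: "mpoly.subspace U" "U \<subseteq> V" "U \<inter> R = {0}" "mpoly.dim V = mpoly.dim U + mpoly.dim R"
      using mpoly.complement_exists[OF subspace_homog fin_dim_homog R] by metis
    have dU: "mpoly.dim U \<ge> 5" using U(4) dV dR p by simp
    have U0: "U \<noteq> {0}" using dU by auto
    have mem: "z1 * u \<in> Y" "z2 * u \<in> Y" if "u \<in> U" for u
      using that U z by (auto simp: Y_def intro!: mprodI)
    have "br Y \<le> mpoly.dim U" using Y dU by simp
    then obtain s t m where m: "\<tau> (mscale s z1 + mscale t z2) \<noteq> 0" "m \<in> U" "m \<noteq> 0"
      "\<tau> ((mscale s z1 + mscale t z2) * m) = 0"
      using pencil[OF U(1,2) U0 Y(1,2) _ mem z(3)] by metis
    define w where "w = mscale s z1 + mscale t z2"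
    have w: "w \<in> Z" "\<tau> w \<noteq> 0" "\<tau> (w * m) = 0"
      using m z Z(1) by (auto simp: w_def intro: mpoly.subspace_add mpoly.subspace_scale)
    have mV: "m \<in> V" "m \<notin> R" using m U by auto
    have lR: "l \<in> R" using l by (auto simp: R_def Z_def mult.commute)
    \<comment> \<open>l lies in R, m does not, and R contains the kernel of \<tau> on linear
      forms.\<close>
    have lm: "tind l m" unfolding tind_def
    proof (intro allI impI)
      fix s t assume st: "\<tau> (mscale s l + mscale t m) = 0"
      have "mscale s l + mscale t m \<in> V" using l mV by (intro homog_add homog_scale)
      then have "mscale s l + mscale t m \<in> R" using st by (auto simp: R_def \<tau>_mult')
      then have "mscale s l + mscale t m - mscale s l \<in> R" using R lR by (intro mpoly.subspace_diff mpoly.subspace_scale)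
      then have tm: "mscale t m \<in> R" by simp
      have t: "t = 0"
      proof (rule ccontr)
        assume "t \<noteq> 0"
        then have "mscale (1 / t) (mscale t m) = m" using mconst_inverse by (metis mult.assoc mult_1)
        then show False using mpoly.subspace_scale[OF R(1) tm, of "1 / t"] mV(2) by simp
      qed
      then have "mscale s (\<tau> l) = 0" using st by (simp add: \<tau>_lin)
      then show "s = 0 \<and> t = 0" using t l(2) by (metis mpoly.scale_eq_0_iff)
    qed
    \<comment> \<open>\<open>Zm\<close> is annihilated by the pair l, m, so \<open>not2\<close>
      bounds its image by 1. Hence m Z has image of dimension at least 3 - 1 = 2, and its two
      independent quadrics make m Y at least 3-dimensional.\<close>
    define Zm where "Zm = {z\<in>Z. \<tau> (m * z) = 0}"
    have Zm: "mpoly.subspace Zm" "Zm \<subseteq> V"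
      using mpoly.subspace_endo_kernel[OF _ _ Z(1), of "\<lambda>v. \<tau> (m * v)"] Z by (auto simp: Zm_def \<tau>_lin mult_lin)
    have "br Zm \<le> 1"
    proof (rule ccontr)
      assume "\<not> br Zm \<le> 1"
      then obtain n1 n2 where n: "n1 \<in> Zm" "n2 \<in> Zm" "tind n1 n2" using tind_exists[of Zm 1] Zm(2) by (metis not_less_eq_eq Suc_1 One_nat_def)
      then show False using not2[OF l(1) mV(1) lm, of n1 n2] Zm(2) by (auto simp: Zm_def Z_def)
    qed
    moreover have "{v\<in>Zm. \<tau> v = 0} = {v\<in>V. \<tau> v = 0}" using Zm(2) kerZ unfolding Zm_def by (blast intro: \<tau>_mult')
    ultimately have "mpoly.dim Zm \<le> 1 + k" using br_nullity[OF Zm] by (simp add: k_def)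
    then have "br ((\<lambda>z. m * z) ` Z) \<ge> 2"
      using mult_nullity[OF Z, of m] dZ brZ eq p by (simp add: Zm_def)
    moreover have mZ: "(\<lambda>z. m * z) ` Z \<subseteq> homog 2"
      using Z homog_mult[OF mV(1)] by (fastforce simp: numeral_2_eq_2)
    ultimately obtain q1 q2 where q: "q1 \<in> (\<lambda>z. m * z) ` Z" "q2 \<in> (\<lambda>z. m * z) ` Z" "tind q1 q2"
      using tind_exists by metis
    have "br (mprod {q1, q2} V) \<ge> 3" using quadric_pair_br[of q1 q2] q mZ by blast
    moreover have "mprod {q1, q2} V \<subseteq> (\<lambda>z. m * z) ` Y"
      unfolding Y_def mult_image_mprod by (rule mprod_mono) (use q in auto)
    moreover have "(\<lambda>z. m * z) ` Y \<subseteq> homog 3"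
      using Y(2) homog_mult[OF mV(1)] by (fastforce simp: numeral_3_eq_3 numeral_2_eq_2)
    ultimately have "br ((\<lambda>z. m * z) ` Y) \<ge> 3" using br_mono by (meson le_trans)
    \<comment> \<open>m also kills w V, of dimension at least 3, so Y would need dimension 3 + 3 >
      5.\<close>
    moreover have "br ((\<lambda>z. m * z) ` Y) + br (mprod {w} V) \<le> br Y"
    proof (rule mult_br[OF Y(1,2)])
      show "mprod {w} V \<subseteq> Y" unfolding Y_def by (rule mprod_mono) (use w in auto)
      fix x assume "x \<in> mprod {w} V"
      then have "x \<in> (\<lambda>x. w * x) ` V" using mprod_single[OF subspace_homog] by blast
      then obtain v where "x = w * v" by blast
      then have "m * x = w * m * v" by (simp add: mult_ac)
      then show "\<tau> (m * x) = 0" using \<tau>_mult[OF w(3)] by simp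
    qed
    ultimately show False using Y(3) br_mult_V[of w] w Z by auto
  qed
  have "p = 0 \<or> p = 1 \<or> p = 2 \<or> p = 3 \<or> p = 4 \<or> p = 5 \<or> p = 6" using p6 p_def by linarith
  then have "p = 4 \<and> a = 6 \<or> p = 5 \<and> a \<in> {8..10} \<or> p = 6 \<and> a \<in> {9..15}"
  proof (elim disjE)
    assume p: "p = 4"
    then have "a \<le> 6" using ub by simp
    moreover have "a \<ge> 6" using a6 p by (cases "a < 6") auto
    ultimately show ?thesis using p by simp
  next
    assume p: "p = 5"
    then have "a \<le> 10" using ub by simp
    moreover have "a \<ge> 8" using small p by (cases "a < 8") auto
    ultimately show ?thesis using p by simp
  next
    assume p: "p = 6"
    then have "a \<le> 15" using ub by simp
    moreover have "a \<ge> 9" using small p by (cases "a < 9") auto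
    ultimately show ?thesis using p by simp
  \<comment> \<open>For p <= 1 the upper bound contradicts a > 0; for p = 2 and p = 3 it gives a < 2
    p - 2, and then \<open>a6\<close> demands a >= 6.\<close>
  qed (use ub a0 a6 in auto)
  then show ?thesis by (simp only: a_def p_def)
qed

end

section \<open>Hilbert functions of quadratic complete intersections\<close>

text \<open>Models the quotient by W inside the same space, so that rank and nullity for
  endomorphisms apply to quotients.\<close>

lemma (in vector_space) exists_linear_with_kernel:
  assumes "subspace W"
  obtains \<pi> :: "'b \<Rightarrow> 'b" where "\<And>x y. \<pi> (x + y) = \<pi> x + \<pi> y" "\<And>c x. \<pi> (c *s x) = c *s \<pi> x"
    "\<And>x. \<pi> x = 0 \<longleftrightarrow> x \<in> W"
proof -
  interpret VP: vector_space_pair scale scale by unfold_locales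
  obtain B where B: "B \<subseteq> W" "independent B" "W \<subseteq> span B" using basis_exists[of W] by metis
  have W: "span B = W" using B assms by (simp add: span_subspace)
  obtain C where C: "B \<subseteq> C" "independent C" "UNIV \<subseteq> span C"
    using maximal_independent_subset_extend[of B UNIV] B by auto
  define \<pi> where "\<pi> = VP.construct C (\<lambda>b. if b \<in> B then 0 else b)"
  have lin: "Vector_Spaces.linear scale scale \<pi>" unfolding \<pi>_def by (rule VP.linear_construct[OF C(2)])
  have add: "\<pi> (x + y) = \<pi> x + \<pi> y" and sc: "\<pi> (c *s x) = c *s \<pi> x" for c x y
    using VP.linear_add[OF lin] VP.linear_scale[OF lin] by auto
  have basis: "\<pi> b = (if b \<in> B then 0 else b)" if "b \<in> C" for b
    unfolding \<pi>_def using VP.construct_basis[OF C(2) that] by simp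
  have z: "\<pi> x = 0" if "x \<in> span B" for x
    using that by (induction rule: span_induct_alt) (use C in \<open>auto simp: add sc basis endo_0\<close>)
  have i: "\<pi> x = x" if "x \<in> span (C - B)" for x
    using that by (induction rule: span_induct_alt) (auto simp: add sc basis endo_0)
  have "x \<in> W" if "\<pi> x = 0" for x
  proof -
    have "x \<in> span (B \<union> (C - B))" using C(3) Un_absorb1[OF C(1)] by auto
    then obtain y z' where "y \<in> span B" "z' \<in> span (C - B)" "x = y + z'" unfolding span_Un by blast
    then show ?thesis using that z i by (simp add: add W)
  qed
  then show thesis using that[of \<pi>] add sc z W by metis
qed

lemma ideal_insert_homog_small:
  fixes F :: "('n::finite, 'k::field) mpoly set"
  assumes F: "F \<subseteq> (\<Union>t. homog t)" and g: "g \<in> homog d" and t: "t < d"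
  shows "ideal_gen (insert g F) \<inter> homog t = ideal_gen F \<inter> homog t"
proof -
  have "p \<in> ideal_gen F" if p: "p \<in> ideal_gen (insert g F)" "p \<in> homog t" for p
  proof -
    obtain c where "p - c * g \<in> ideal_gen F" using p(1) unfolding mem_ideal_insert by blast
    then have "hcomp t (p - c * g) \<in> ideal_gen F" by (rule hcomp_in_ideal[OF F])
    then show ?thesis using p(2) hcomp_mult[OF g, of t c] t by (simp add: hcomp_diff mult.commute)
  qed
  then show ?thesis using ideal_gen_mono[of F "insert g F"] by blast
qed

text \<open>Multiplication by g maps degree u onto the degree u + d part of (F, g)/(F), with kernel
  the colon ideal (F) : g in degree u.\<close>

lemma dim_ideal_insert:
  fixes F :: "('n::finite, 'k::field) mpoly set"
  assumes F: "F \<subseteq> (\<Union>t. homog t)" and g: "g \<in> homog d"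
  shows "mpoly.dim (ideal_gen (insert g F) \<inter> homog (u + d)) + mpoly.dim {h \<in> homog u. g * h \<in> ideal_gen F}
    = mpoly.dim (ideal_gen F \<inter> homog (u + d)) + mpoly.dim (homog u :: ('n, 'k) mpoly set)"
proof -
  have sI: "mpoly.subspace (ideal_gen G)" for G :: "('n, 'k) mpoly set" by (rule subspace_ideal) simp
  obtain \<pi> :: "('n, 'k) mpoly \<Rightarrow> ('n, 'k) mpoly" where \<pi>: "\<And>x y. \<pi> (x + y) = \<pi> x + \<pi> y"
    "\<And>c x. \<pi> (mscale c x) = mscale c (\<pi> x)" "\<And>x. \<pi> x = 0 \<longleftrightarrow> x \<in> ideal_gen F"
    using mpoly.exists_linear_with_kernel[OF sI] by metis
  define T where "T = ideal_gen (insert g F) \<inter> homog (u + d)"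
  have T: "mpoly.subspace T" "mpoly.fin_dim T"
    by (auto simp: T_def intro: mpoly.subspace_inter sI subspace_homog fin_dim_homog_subset)
  have "ideal_gen F \<subseteq> ideal_gen (insert g F)" by (rule ideal_gen_mono) auto
  then have "{x\<in>T. \<pi> x = 0} = ideal_gen F \<inter> homog (u + d)" by (auto simp: T_def \<pi>(3))
  then have 1: "mpoly.dim T = mpoly.dim (\<pi> ` T) + mpoly.dim (ideal_gen F \<inter> homog (u + d))"
    using mpoly.rank_nullity[of \<pi>, OF \<pi>(1,2) T] by simp
  have "\<pi> ` T = (\<lambda>h. \<pi> (g * h)) ` homog u"
  proof (intro equalityI image_subsetI)
    fix p assume p: "p \<in> T"
    then have "p \<in> ideal_gen (insert g F)" by (simp add: T_def)
    then obtain c where "p - c * g \<in> ideal_gen F" unfolding mem_ideal_insert by blast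
    then have "hcomp (u + d) (p - c * g) \<in> ideal_gen F" by (rule hcomp_in_ideal[OF F])
    moreover have "hcomp (u + d) (p - c * g) = p - g * hcomp u c"
      using p hcomp_mult[OF g, of "u + d" c] by (simp add: T_def hcomp_diff mult.commute)
    ultimately have "\<pi> (p - g * hcomp u c) = 0" by (simp add: \<pi>(3))
    then have "\<pi> p = \<pi> (g * hcomp u c)" using mpoly.endo_diff[of \<pi>, OF \<pi>(1,2)] by simp
    then show "\<pi> p \<in> (\<lambda>h. \<pi> (g * h)) ` homog u" using hcomp_homog by blast
  next
    fix h :: "('n, 'k) mpoly" assume h: "h \<in> homog u"
    have "h * g \<in> ideal_gen (insert g F)" by (intro ideal_mult ring_ideal.span_base) simp
    then have "g * h \<in> T" using homog_mult[OF h g] by (simp add: T_def mult.commute)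
    then show "\<pi> (g * h) \<in> \<pi> ` T" by blast
  qed
  moreover have "mpoly.dim (homog u :: ('n, 'k) mpoly set)
      = mpoly.dim ((\<lambda>h. \<pi> (g * h)) ` homog u) + mpoly.dim {h \<in> homog u. \<pi> (g * h) = 0}"
    by (rule mpoly.rank_nullity) (simp_all add: \<pi>(1,2) mult_lin subspace_homog fin_dim_homog)
  ultimately show ?thesis using 1 by (simp add: T_def \<pi>(3))
qed

lemma hilbert_fun_insert:
  fixes F :: "('n::finite, 'k::field) mpoly set"
  assumes F: "F \<subseteq> (\<Union>t. homog t)" and g: "g \<in> homog d"
  shows "hilbert_fun (ideal_gen (insert g F)) (u + d) + mpoly.dim (homog u :: ('n, 'k) mpoly set)
      = hilbert_fun (ideal_gen F) (u + d) + mpoly.dim {h \<in> homog u. g * h \<in> ideal_gen F}"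
    "t < d \<Longrightarrow> hilbert_fun (ideal_gen (insert g F)) t = hilbert_fun (ideal_gen F) t"
proof -
  have h: "hilbert_fun (ideal_gen G) t + mpoly.dim (ideal_gen G \<inter> homog t) = mpoly.dim (homog t :: ('n, 'k) mpoly set)"
    for G :: "('n, 'k) mpoly set" and t by (rule hilbert_fun_eq) simp
  show "hilbert_fun (ideal_gen (insert g F)) (u + d) + mpoly.dim (homog u :: ('n, 'k) mpoly set)
      = hilbert_fun (ideal_gen F) (u + d) + mpoly.dim {h \<in> homog u. g * h \<in> ideal_gen F}"
    using dim_ideal_insert[OF F g, of u] h[of F "u + d"] h[of "insert g F" "u + d"] by linarith
  show "t < d \<Longrightarrow> hilbert_fun (ideal_gen (insert g F)) t = hilbert_fun (ideal_gen F) t"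
    using ideal_insert_homog_small[OF F g, of t] h[of F t] h[of "insert g F" t] by simp
qed

text \<open>The standard monomials of the ideal generated by the squares of the variables in X, the
  model for a regular sequence of |X| quadrics.\<close>

definition partial_squarefree :: "'n set \<Rightarrow> nat \<Rightarrow> ('n::finite \<Rightarrow>\<^sub>0 nat) set" where
  "partial_squarefree X t = {m. mdeg m = t \<and> (\<forall>i\<in>X. lookup m i < 2)}"

lemma finite_partial_squarefree: "finite (partial_squarefree X t)"
  unfolding partial_squarefree_def by (rule finite_subset[OF _ finite_mdeg[of t]]) auto

text \<open>Multiplication by the square of the variable x is a bijection onto the monomials with
  exponent at least 2 at x, because X does not restrict that exponent.\<close>

lemma partial_squarefree_insert:
  assumes "x \<notin> X"
  shows "card (partial_squarefree (insert x X) (u + 2)) + card (partial_squarefree X u)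
      = card (partial_squarefree X (u + 2))"
    "t < 2 \<Longrightarrow> partial_squarefree (insert x X) t = partial_squarefree X t"
proof -
  define f where "f m = m + single x 2" for m :: "'a \<Rightarrow>\<^sub>0 nat"
  have inj: "inj_on f M" for M by (rule inj_onI) (simp add: f_def)
  have sp: "partial_squarefree X (u + 2) = partial_squarefree (insert x X) (u + 2) \<union> f ` partial_squarefree X u"
  proof (intro equalityI subsetI)
    fix m assume m: "m \<in> partial_squarefree X (u + 2)"
    show "m \<in> partial_squarefree (insert x X) (u + 2) \<union> f ` partial_squarefree X u"
    proof (cases "lookup m x < 2")
      case True
      then show ?thesis using m by (simp add: partial_squarefree_def)
    next
      case False
      define m' where "m' = m - single x 2"
      have eq: "m = m' + single x 2"
        by (rule poly_mapping_eqI) (use False in \<open>auto simp: m'_def lookup_add lookup_minus lookup_single when_def\<close>)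
      then have "mdeg m = mdeg m' + 2" by (simp add: mdeg_add)
      then have "m' \<in> partial_squarefree X u"
        using m by (auto simp: partial_squarefree_def m'_def lookup_minus intro: le_less_trans[OF diff_le_self])
      then show ?thesis using eq by (auto simp: f_def)
    qed
  next
    fix m assume "m \<in> partial_squarefree (insert x X) (u + 2) \<union> f ` partial_squarefree X u"
    then show "m \<in> partial_squarefree X (u + 2)"
      using assms by (auto simp: partial_squarefree_def f_def mdeg_add lookup_add lookup_single when_def)
  qed
  have disj: "partial_squarefree (insert x X) (u + 2) \<inter> f ` partial_squarefree X u = {}"
    by (auto simp: partial_squarefree_def f_def lookup_add)
  show "card (partial_squarefree (insert x X) (u + 2)) + card (partial_squarefree X u)
      = card (partial_squarefree X (u + 2))"
    unfolding sp using disj finite_partial_squarefree card_image[OF inj]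
    by (subst card_Un_disjoint) auto
  assume t: "t < 2"
  have "lookup m x \<le> mdeg m" for m :: "'a \<Rightarrow>\<^sub>0 nat" unfolding mdeg_def by (rule member_le_sum) auto
  then show "partial_squarefree (insert x X) t = partial_squarefree X t"
    using t by (auto simp: partial_squarefree_def intro: le_less_trans)
qed

definition nth_ideal :: "('n, 'k::field) mpoly list \<Rightarrow> nat \<Rightarrow> ('n, 'k) mpoly set" where
  "nth_ideal fs i = ideal_gen (set (take i fs))"

lemma nth_ideal_Suc:
  "i < length fs \<Longrightarrow> nth_ideal fs (Suc i) = ideal_gen (insert (fs ! i) (set (take i fs)))"
  by (simp add: nth_ideal_def take_Suc_conv_app_nth)

text \<open>By regularity the colon ideal at each step is the previous ideal, so the Hilbert
  function obeys the same recursion as the number of standard monomials.\<close>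

lemma regular_quadrics_hilbert_fun:
  fixes fs :: "('n::finite, 'k::field) mpoly list"
  assumes fs: "set fs \<subseteq> homog 2" and reg: "regular_sequence fs" and len: "length fs \<le> CARD('n)"
  obtains X :: "'n set" where "card X = length fs"
    "\<And>t. hilbert_fun (ideal_gen (set fs)) t = card (partial_squarefree X t)"
proof -
  have "\<exists>X :: 'n set. card X = i \<and> (\<forall>t. hilbert_fun (nth_ideal fs i) t = card (partial_squarefree X t))"
    if "i \<le> length fs" for i
    using that
  proof (induction i)
    case 0
    have "hilbert_fun (nth_ideal fs 0) t = card (partial_squarefree ({} :: 'n set) t)" for t
    proof -
      have "mpoly.dim ({0} \<inter> homog t :: ('n, 'k) mpoly set) = 0" by simp
      then have "hilbert_fun (nth_ideal fs 0) t = mpoly.dim (homog t :: ('n, 'k) mpoly set)"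
        using hilbert_fun_eq[of "nth_ideal fs 0" t] by (simp add: nth_ideal_def)
      also have "(homog t :: ('n, 'k) mpoly set) = {p. keys p \<subseteq> {m. mdeg m = t}}" by (auto simp: homog_def)
      also have "mpoly.dim \<dots> = card {m :: 'n \<Rightarrow>\<^sub>0 nat. mdeg m = t}" by (rule dim_monomials[OF finite_mdeg])
      finally show ?thesis by (simp add: partial_squarefree_def)
    qed
    then show ?case by (intro exI[of _ "{}"]) auto
  next
    case (Suc i)
    then obtain X :: "'n set" where X: "card X = i"
      "\<And>t. hilbert_fun (nth_ideal fs i) t = card (partial_squarefree X t)" by auto
    have "X \<noteq> UNIV" using X(1) Suc.prems len by auto
    then obtain x where x: "x \<notin> X" by blast
    define F where "F = set (take i fs)"
    have F: "F \<subseteq> (\<Union>t. homog t)" using fs set_take_subset[of i fs] by (fastforce simp: F_def)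
    have f: "fs ! i \<in> homog 2" using fs Suc.prems by auto
    have i: "i < length fs" using Suc.prems by simp
    have I: "nth_ideal fs (Suc i) = ideal_gen (insert (fs ! i) F)" "nth_ideal fs i = ideal_gen F"
      unfolding F_def by (rule nth_ideal_Suc[OF i]) (simp add: nth_ideal_def)
    have "hilbert_fun (nth_ideal fs (Suc i)) t = card (partial_squarefree (insert x X) t)" for t
    proof (cases "t < 2")
      case True
      then show ?thesis using hilbert_fun_insert(2)[OF F f] I X partial_squarefree_insert(2)[OF x] by metis
    next
      case False
      then obtain u where u: "t = u + 2" by (metis add.commute le_Suc_ex not_less)
      have "{h \<in> homog u. fs ! i * h \<in> ideal_gen F} = ideal_gen F \<inter> homog u"
      proof -
        have "h \<in> ideal_gen F" if "fs ! i * h \<in> ideal_gen F" for h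
          using reg i that unfolding regular_sequence_def F_def by blast
        then show ?thesis using ideal_mult by blast
      qed
      then show ?thesis
        using hilbert_fun_insert(1)[OF F f, of u] I X u partial_squarefree_insert(1)[OF x, of u]
          hilbert_fun_eq[of "ideal_gen F" u] by simp
    qed
    then show ?case using x X(1) by (intro exI[of _ "insert x X"]) auto
  qed
  from this[of "length fs"] show thesis using that by (auto simp: nth_ideal_def)
qed

lemma bij_squarefree:
  "bij_betw keys (partial_squarefree (UNIV :: 'n::finite set) t) {\<sigma>. \<sigma> \<subseteq> UNIV \<and> card \<sigma> = t}"
proof (rule bij_betw_byWitness[where f' = "\<lambda>\<sigma>. Abs_poly_mapping (\<lambda>i. if i \<in> \<sigma> then 1 else 0)"])
  show "\<forall>m\<in>partial_squarefree (UNIV :: 'n set) t. Abs_poly_mapping (\<lambda>i. if i \<in> keys m then 1 else 0) = m"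
  proof
    fix m assume "m \<in> partial_squarefree (UNIV :: 'n set) t"
    then have "lookup m i = 0 \<or> lookup m i = 1" for i
      by (auto simp: partial_squarefree_def less_2_cases_iff)
    then have "(if i \<in> keys m then 1 else 0) = lookup m i" for i by (metis in_keys_iff)
    then show "Abs_poly_mapping (\<lambda>i. if i \<in> keys m then 1 else 0) = m"
      by (intro poly_mapping_eqI) (simp add: lookup_Abs_finite)
  qed
  show "\<forall>\<sigma>\<in>{\<sigma>. \<sigma> \<subseteq> UNIV \<and> card \<sigma> = t}. keys (Abs_poly_mapping (\<lambda>i::'n. if i \<in> \<sigma> then 1 else 0 :: nat)) = \<sigma>"
    by (auto simp: in_keys_iff lookup_Abs_finite split: if_splits)
  show "keys ` partial_squarefree UNIV t \<subseteq> {\<sigma>::'n set. \<sigma> \<subseteq> UNIV \<and> card \<sigma> = t}"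
  proof (rule image_subsetI)
    fix m :: "'n \<Rightarrow>\<^sub>0 nat" assume m: "m \<in> partial_squarefree UNIV t"
    then have lt: "lookup m i < 2" for i by (simp add: partial_squarefree_def)
    have "t = (\<Sum>i\<in>UNIV. lookup m i)" using m by (simp add: partial_squarefree_def mdeg_def)
    also have "\<dots> = (\<Sum>i\<in>keys m. lookup m i)" by (rule sum.mono_neutral_right) (auto simp: in_keys_iff)
    also have "\<dots> = (\<Sum>i\<in>keys m. 1)"
    proof (rule sum.cong)
      fix i assume "i \<in> keys m"
      then show "lookup m i = 1" using lt[of i] by (auto simp: in_keys_iff less_2_cases_iff)
    qed simp
    finally show "keys m \<in> {\<sigma>. \<sigma> \<subseteq> UNIV \<and> card \<sigma> = t}" by simp
  qed
  show "(\<lambda>\<sigma>. Abs_poly_mapping (\<lambda>i. if i \<in> \<sigma> then 1 else 0)) ` {\<sigma>::'n set. \<sigma> \<subseteq> UNIV \<and> card \<sigma> = t}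
      \<subseteq> partial_squarefree UNIV t"
    by (auto simp: partial_squarefree_def mdeg_def lookup_Abs_finite sum.If_cases)
qed

lemma card_squarefree: "card (partial_squarefree (UNIV :: 'n::finite set) t) = CARD('n) choose t"
  using bij_betw_same_card[OF bij_squarefree[where 'n = 'n and t = t]] n_subsets[of "UNIV :: 'n set" t] by simp

section \<open>The socle of a quadratic complete intersection\<close>

text \<open>Koszul cochains on the variables are functions on sets of variables.\<close>

definition ksign :: "'n::{finite,linorder} \<Rightarrow> 'n set \<Rightarrow> ('n, 'k::field) mpoly" where
  "ksign i \<sigma> = (- 1) ^ card {k\<in>\<sigma>. k < i}"

text \<open>Exterior multiplication by the sum of x_i e_i, where v has coefficient
  \<open>v \<sigma>\<close> at the basis element of \<sigma>. Cohomological degree is the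
  cardinality of the set.\<close>

definition kd :: "('n::{finite,linorder} set \<Rightarrow> ('n, 'k::field) mpoly) \<Rightarrow> 'n set \<Rightarrow> ('n, 'k) mpoly" where
  "kd v \<sigma> = (\<Sum>i\<in>\<sigma>. ksign i \<sigma> * (mvar i * v (\<sigma> - {i})))"

lemma ksign_square: "ksign i \<sigma> * (ksign i \<sigma> * p) = p"
  by (cases "even (card {k\<in>\<sigma>. k < i})") (auto simp: ksign_def)

lemma ksign_swap:
  assumes "i \<in> \<sigma>" "j \<in> \<sigma>" "i \<noteq> j"
  shows "ksign i \<sigma> * ksign j (\<sigma> - {i}) = (- (ksign j \<sigma> * ksign i (\<sigma> - {j})) :: ('n::{finite,linorder}, 'k::field) mpoly)"
proof -
  have *: "ksign i \<sigma> * ksign j (\<sigma> - {i}) = (- (ksign j \<sigma> * ksign i (\<sigma> - {j})) :: ('n, 'k) mpoly)"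
    if "i \<in> \<sigma>" "i < j" for i j and \<sigma> :: "'n set"
  proof -
    have "{k\<in>\<sigma> - {j}. k < i} = {k\<in>\<sigma>. k < i}" using that by auto
    then have 1: "ksign i (\<sigma> - {j}) = (ksign i \<sigma> :: ('n, 'k) mpoly)" by (simp add: ksign_def)
    have "{k\<in>\<sigma>. k < j} = insert i {k\<in>\<sigma> - {i}. k < j}" using that by auto
    then have "card {k\<in>\<sigma>. k < j} = Suc (card {k\<in>\<sigma> - {i}. k < j})" by simp
    then have "ksign j \<sigma> = (- ksign j (\<sigma> - {i}) :: ('n, 'k) mpoly)" by (simp add: ksign_def)
    with 1 show ?thesis by (simp add: mult.commute)
  qed
  show ?thesis
  proof (cases "i < j")
    case False
    then have "ksign j \<sigma> * ksign i (\<sigma> - {j}) = (- (ksign i \<sigma> * ksign j (\<sigma> - {i})) :: ('n, 'k) mpoly)"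
      using *[of j \<sigma> i] assms by auto
    then show ?thesis by simp
  qed (use * assms in blast)
qed

lemma kd_add: "kd (\<lambda>\<sigma>. v \<sigma> + w \<sigma>) \<sigma> = kd v \<sigma> + kd w \<sigma>"
  by (simp add: kd_def distrib_left sum.distrib)

lemma kd_mult: "kd (\<lambda>\<sigma>. p * v \<sigma>) \<sigma> = p * kd v \<sigma>"
  by (simp add: kd_def sum_distrib_left mult_ac)

lemma kd_diff: "kd (\<lambda>\<sigma>. v \<sigma> - w \<sigma>) \<sigma> = kd v \<sigma> - kd w \<sigma>"
  by (simp add: kd_def right_diff_distrib sum_subtractf)

lemma kd_cong:
  assumes "\<And>\<rho>. Suc (card \<rho>) = card \<sigma> \<Longrightarrow> v \<rho> = w \<rho>"
  shows "kd v \<sigma> = kd w \<sigma>"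
  unfolding kd_def by (intro sum.cong refl) (use assms card_Suc_Diff1 finite in \<open>metis\<close>)

lemma kd_in_ideal:
  assumes "\<And>\<rho>. Suc (card \<rho>) = card \<sigma> \<Longrightarrow> v \<rho> \<in> ideal_gen F"
  shows "kd v \<sigma> \<in> ideal_gen F"
  unfolding kd_def
  by (intro ring_ideal.span_sum ideal_mult assms) (meson card_Suc_Diff1 finite)

lemma kd_kd: "kd (kd v) \<sigma> = 0"
proof -
  define a where "a i j = ksign i \<sigma> * ksign j (\<sigma> - {i}) * (mvar i * mvar j * v (\<sigma> - {i} - {j}))" for i j
  have anti: "a i j = - a j i" if "i \<in> \<sigma>" "j \<in> \<sigma>" "i \<noteq> j" for i j
  proof -
    have eq: "\<sigma> - {i} - {j} = \<sigma> - {j} - {i}" by blast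
    show ?thesis unfolding a_def ksign_swap[OF that] eq by (simp add: mult.commute[of "mvar i" "mvar j"])
  qed
  have "kd (kd v) \<sigma> = (\<Sum>i\<in>\<sigma>. \<Sum>j\<in>\<sigma> - {i}. a i j)"
    by (simp add: kd_def a_def sum_distrib_left mult_ac)
  also have "\<dots> = (\<Sum>(i, j)\<in>{(i, j). i \<in> \<sigma> \<and> j \<in> \<sigma> \<and> i \<noteq> j}. a i j)"
    by (subst sum.Sigma) (auto intro!: sum.cong)
  also have "{(i, j). i \<in> \<sigma> \<and> j \<in> \<sigma> \<and> i \<noteq> j}
      = {(i, j). i \<in> \<sigma> \<and> j \<in> \<sigma> \<and> i < j} \<union> {(i, j). i \<in> \<sigma> \<and> j \<in> \<sigma> \<and> j < i}" by auto
  also have "(\<Sum>(i, j)\<in>\<dots>. a i j) = (\<Sum>(i, j)\<in>{(i, j). i \<in> \<sigma> \<and> j \<in> \<sigma> \<and> i < j}. a i j)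
      + (\<Sum>(i, j)\<in>{(i, j). i \<in> \<sigma> \<and> j \<in> \<sigma> \<and> j < i}. a i j)"
    by (rule sum.union_disjoint) auto
  also have "(\<Sum>(i, j)\<in>{(i, j). i \<in> \<sigma> \<and> j \<in> \<sigma> \<and> j < i}. a i j)
      = (\<Sum>(i, j)\<in>{(i, j). i \<in> \<sigma> \<and> j \<in> \<sigma> \<and> i < j}. - a i j)"
  proof -
    have "{(i, j). i \<in> \<sigma> \<and> j \<in> \<sigma> \<and> j < i} = prod.swap ` {(i, j). i \<in> \<sigma> \<and> j \<in> \<sigma> \<and> i < j}" by auto
    then have "(\<Sum>(i, j)\<in>{(i, j). i \<in> \<sigma> \<and> j \<in> \<sigma> \<and> j < i}. a i j)
        = (\<Sum>(i, j)\<in>{(i, j). i \<in> \<sigma> \<and> j \<in> \<sigma> \<and> i < j}. a j i)"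
      by (simp add: sum.reindex split_def)
    also have "\<dots> = (\<Sum>(i, j)\<in>{(i, j). i \<in> \<sigma> \<and> j \<in> \<sigma> \<and> i < j}. - a i j)"
    proof (rule sum.cong, rule refl, clarify)
      fix i j assume "i \<in> \<sigma>" "j \<in> \<sigma>" "i < j"
      then show "a j i = - a i j" by (intro anti) auto
    qed
    finally show ?thesis .
  qed
  finally show ?thesis by (simp add: sum_negf split_def)
qed

text \<open>Monomials divisible by the variable are divided by it, all others are dropped: a left
  inverse of multiplication that commutes with the other variables.\<close>

definition divvar :: "'n \<Rightarrow> ('n, 'k::field) mpoly \<Rightarrow> ('n, 'k) mpoly" where
  "divvar i p = Poly_Mapping.map_key (\<lambda>m. m + single i 1) p"

lemma lookup_divvar: "lookup (divvar i p) m = lookup p (m + single i 1)"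
proof -
  have "inj (\<lambda>m. m + single i (1::nat))" by (rule injI) simp
  then show ?thesis by (simp add: divvar_def map_key.rep_eq)
qed

lemma lookup_mvar_times:
  "lookup (mvar i * p) m = (if lookup m i = 0 then 0 else lookup p (m - single i 1))"
proof -
  have "mvar i * p = (\<Sum>m'\<in>keys p. single (single i 1 + m') (lookup p m'))"
    by (subst mpoly_eq_sum_single[of p]) (simp add: mvar_def sum_distrib_left mult_single)
  then have "lookup (mvar i * p) m = (\<Sum>m'\<in>keys p. if single i 1 + m' = m then lookup p m' else 0)"
    by (simp add: lookup_sum lookup_single when_def)
  also have "\<dots> = (\<Sum>m'\<in>keys p. if lookup m i \<noteq> 0 \<and> m' = m - single i 1 then lookup p m' else 0)"
  proof (intro sum.cong refl if_cong)
    fix m'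
    show "single i 1 + m' = m \<longleftrightarrow> lookup m i \<noteq> 0 \<and> m' = m - single i 1"
    proof
      assume "lookup m i \<noteq> 0 \<and> m' = m - single i 1"
      then show "single i 1 + m' = m"
        by (intro poly_mapping_eqI) (auto simp: lookup_add lookup_minus lookup_single when_def)
    qed (auto simp: lookup_add)
  qed
  also have "\<dots> = (if lookup m i = 0 then 0 else lookup p (m - single i 1))"
    by (auto simp: in_keys_iff)
  finally show ?thesis .
qed

lemma divvar_add: "divvar i (p + q) = divvar i p + divvar i q"
  by (rule poly_mapping_eqI) (simp add: lookup_divvar lookup_add)

lemma divvar_0 [simp]: "divvar i 0 = 0"
  by (rule poly_mapping_eqI) (simp add: lookup_divvar)

lemma divvar_uminus: "divvar i (- p) = - divvar i p"
  by (rule poly_mapping_eqI) (simp add: lookup_divvar)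

lemma divvar_sum: "divvar i (\<Sum>k\<in>I. f k) = (\<Sum>k\<in>I. divvar i (f k))"
  by (rule additive_eq_sum) (rule divvar_add)

lemma divvar_ksign: "divvar i (ksign k \<sigma> * p) = ksign k \<sigma> * divvar i p"
  by (cases "even (card {l\<in>\<sigma>. l < k})") (auto simp: ksign_def divvar_uminus)

lemma divvar_mvar_same: "divvar i (mvar i * p) = p"
  by (rule poly_mapping_eqI) (simp add: lookup_divvar lookup_mvar_times lookup_add)

lemma divvar_mvar: "k \<noteq> i \<Longrightarrow> divvar i (mvar k * p) = mvar k * divvar i p"
proof (rule poly_mapping_eqI)
  fix m assume "k \<noteq> i"
  have "m + single i 1 - single k 1 = m - single k 1 + single i (1::nat)" if "lookup m k \<noteq> 0"
    by (rule poly_mapping_eqI)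
      (use that \<open>k \<noteq> i\<close> in \<open>auto simp: lookup_add lookup_minus lookup_single when_def\<close>)
  then show "lookup (divvar i (mvar k * p)) m = lookup (mvar k * divvar i p) m"
    using \<open>k \<noteq> i\<close> by (simp add: lookup_divvar lookup_mvar_times lookup_add lookup_single_not_eq)
qed

text \<open>Contraction with the variable \<open>i\<close>, followed by division by it, is a homotopy between the identity
  and the part of a cochain that involves \<open>i\<close> but is free of the variable.\<close>

lemma koszul_homotopy:
  fixes v :: "'n::{finite,linorder} set \<Rightarrow> ('n, 'k::field) mpoly" and i :: 'n
  assumes v: "\<And>\<sigma>. kd v \<sigma> = 0"
  defines "h \<equiv> \<lambda>\<sigma>. if i \<in> \<sigma> then 0 else ksign i (insert i \<sigma>) * divvar i (v (insert i \<sigma>))"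
  shows "kd h \<tau> = (if i \<in> \<tau> then mvar i * divvar i (v \<tau>) else v \<tau>)"
proof (cases "i \<in> \<tau>")
  case True
  have "kd h \<tau> = (\<Sum>k\<in>\<tau>. if k = i then mvar i * divvar i (v \<tau>) else 0)"
    unfolding kd_def
  proof (rule sum.cong)
    fix k assume "k \<in> \<tau>"
    show "ksign k \<tau> * (mvar k * h (\<tau> - {k})) = (if k = i then mvar i * divvar i (v \<tau>) else 0)"
    proof (cases "k = i")
      case True
      have "insert i (\<tau> - {i}) = \<tau>" using \<open>i \<in> \<tau>\<close> by blast
      then have "h (\<tau> - {k}) = ksign i \<tau> * divvar i (v \<tau>)" using True by (simp add: h_def)
      then show ?thesis
        using True by (simp only: mult.left_commute[of "mvar i" "ksign i \<tau>"] ksign_square) simp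
    qed (use \<open>i \<in> \<tau>\<close> in \<open>simp add: h_def\<close>)
  qed simp
  also have "\<dots> = mvar i * divvar i (v \<tau>)" using True by simp
  finally show ?thesis using True by simp
next
  case False
  define \<sigma> where "\<sigma> = insert i \<tau>"
  define s where "s = (\<Sum>k\<in>\<tau>. ksign k \<sigma> * (mvar k * divvar i (v (\<sigma> - {k}))))"
  \<comment> \<open>Dividing the cocycle condition at insert i \<tau> by the variable i isolates
    \<open>v \<tau>\<close>; the remaining terms are those of \<open>kd h \<tau>\<close> up to
    sign.\<close>
  have "0 = divvar i (kd v \<sigma>)" by (simp add: v)
  also have "kd v \<sigma> = ksign i \<sigma> * (mvar i * v \<tau>) + (\<Sum>k\<in>\<tau>. ksign k \<sigma> * (mvar k * v (\<sigma> - {k})))"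
    using False by (simp add: kd_def \<sigma>_def)
  also have "divvar i \<dots> = ksign i \<sigma> * v \<tau> + (\<Sum>k\<in>\<tau>. divvar i (ksign k \<sigma> * (mvar k * v (\<sigma> - {k}))))"
    by (simp add: divvar_add divvar_sum divvar_ksign divvar_mvar_same)
  also have "(\<Sum>k\<in>\<tau>. divvar i (ksign k \<sigma> * (mvar k * v (\<sigma> - {k})))) = s"
    unfolding s_def
  proof (rule sum.cong)
    fix k assume "k \<in> \<tau>"
    then have "k \<noteq> i" using False by blast
    then show "divvar i (ksign k \<sigma> * (mvar k * v (\<sigma> - {k}))) = ksign k \<sigma> * (mvar k * divvar i (v (\<sigma> - {k})))"
      by (simp add: divvar_ksign divvar_mvar)
  qed simp
  finally have s: "ksign i \<sigma> * v \<tau> = - s" by (simp add: eq_neg_iff_add_eq_0)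
  have "kd h \<tau> = (\<Sum>k\<in>\<tau>. - (ksign i \<sigma> * (ksign k \<sigma> * (mvar k * divvar i (v (\<sigma> - {k}))))))"
    unfolding kd_def
  proof (rule sum.cong)
    fix k assume k: "k \<in> \<tau>"
    then have ki: "k \<noteq> i" using False by blast
    have ins: "insert i (\<tau> - {k}) = \<sigma> - {k}" "\<sigma> - {i} = \<tau>" using ki False by (auto simp: \<sigma>_def)
    let ?D = "mvar k * divvar i (v (\<sigma> - {k}))"
    have "ksign k \<tau> * (mvar k * h (\<tau> - {k})) = ksign i \<sigma> * (ksign i \<sigma> * (ksign k \<tau> * (ksign i (\<sigma> - {k}) * ?D)))"
      using False by (simp add: h_def ins ksign_square mult.left_commute[of "mvar k"])
    also have "\<dots> = ksign i \<sigma> * ((ksign i \<sigma> * ksign k (\<sigma> - {i})) * (ksign i (\<sigma> - {k}) * ?D))"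
      by (simp add: ins mult.assoc)
    also have "ksign i \<sigma> * ksign k (\<sigma> - {i}) = - (ksign k \<sigma> * ksign i (\<sigma> - {k}) :: ('n, 'k) mpoly)"
      by (rule ksign_swap) (use k ki in \<open>auto simp: \<sigma>_def\<close>)
    also have "ksign i \<sigma> * (\<dots> * (ksign i (\<sigma> - {k}) * ?D)) = - (ksign i \<sigma> * (ksign k \<sigma> * ?D))"
      by (simp add: mult.assoc ksign_square)
    finally show "ksign k \<tau> * (mvar k * h (\<tau> - {k})) = - (ksign i \<sigma> * (ksign k \<sigma> * ?D))" .
  qed simp
  also have "\<dots> = - (ksign i \<sigma> * s)" by (simp add: s_def sum_negf sum_distrib_left)
  also have "\<dots> = ksign i \<sigma> * (ksign i \<sigma> * v \<tau>)" by (simp add: s)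
  also have "\<dots> = v \<tau>" by (rule ksign_square)
  finally show ?thesis using False by simp
qed

text \<open>Induction over X: a coboundary can be subtracted so that v vanishes outside the
  supersets of X. Each new variable uses the homotopy; at sets containing it nothing is left to
  correct unless they contain all of X. Only the top set escapes.\<close>

lemma koszul_exact:
  fixes v :: "'n::{finite,linorder} set \<Rightarrow> ('n, 'k::field) mpoly"
  assumes v: "\<And>\<sigma>. kd v \<sigma> = 0"
  obtains u where "\<And>\<tau>. \<tau> \<noteq> UNIV \<Longrightarrow> v \<tau> = kd u \<tau>"
proof -
  have "\<exists>u. \<forall>\<tau>. \<not> X \<subseteq> \<tau> \<longrightarrow> v \<tau> = kd u \<tau>" for X :: "'n set"
    using finite[of X]
  proof (induction X)
    case (insert i X)
    then obtain u where u: "\<And>\<tau>. \<not> X \<subseteq> \<tau> \<Longrightarrow> v \<tau> = kd u \<tau>" by blast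
    define w where "w \<tau> = v \<tau> - kd u \<tau>" for \<tau>
    have w: "kd w \<sigma> = 0" for \<sigma> unfolding w_def by (simp add: kd_diff v kd_kd)
    define h where "h = (\<lambda>\<sigma>. if i \<in> \<sigma> then 0 else ksign i (insert i \<sigma>) * divvar i (w (insert i \<sigma>)))"
    have "v \<tau> = kd (\<lambda>\<sigma>. u \<sigma> + h \<sigma>) \<tau>" if "\<not> insert i X \<subseteq> \<tau>" for \<tau>
    proof -
      have kh: "kd h \<tau> = (if i \<in> \<tau> then mvar i * divvar i (w \<tau>) else w \<tau>)"
        unfolding h_def by (rule koszul_homotopy[OF w])
      have "kd h \<tau> = w \<tau>"
      proof (cases "i \<in> \<tau>")
        case True
        then have "w \<tau> = 0" using that u by (auto simp: w_def)
        then show ?thesis using kh by simp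
      qed (use kh in simp)
      then show ?thesis by (simp add: kd_add w_def)
    qed
    then show ?case by blast
  qed simp
  from this[of UNIV] show thesis using that by blast
qed

section \<open>Koszul cohomology modulo a regular sequence of quadrics\<close>

locale quadratic_regular =
  fixes fs :: "('n::{finite,linorder}, 'k::field) mpoly list"
  assumes fs: "set fs \<subseteq> homog 2" and reg: "regular_sequence fs"
begin

lemma regular:
  assumes "i < length fs" "fs ! i * p \<in> nth_ideal fs i"
  shows "p \<in> nth_ideal fs i"
  using assms reg by (auto simp: regular_sequence_def nth_ideal_def)

lemma homog_gens: "set (take i fs) \<subseteq> (\<Union>t. homog t)"
  using fs set_take_subset[of i fs] by fastforce

lemma mem_nth_ideal_Suc:
  assumes "i < length fs"
  shows "p \<in> nth_ideal fs (Suc i) \<longleftrightarrow> (\<exists>w. p - fs ! i * w \<in> nth_ideal fs i)"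
  unfolding nth_ideal_Suc[OF assms] mem_ideal_insert by (simp add: nth_ideal_def mult.commute)

text \<open>One step of the comparison of Koszul cohomology over \<open>S/(f\<^sub>1,\<dots>,f\<^sub>i\<^sub>+\<^sub>1)\<close> in degree \<open>j\<close> with that over
  \<open>S/(f\<^sub>1,\<dots>,f\<^sub>i)\<close> in degrees \<open>j\<close> and \<open>j + 1\<close>.\<close>

lemma koszul_step:
  assumes i: "i < length fs"
    and w: "\<And>\<sigma>. card \<sigma> = Suc j \<Longrightarrow> kd v \<sigma> - fs ! i * w \<sigma> \<in> nth_ideal fs i"
    and ex1: "(\<And>\<sigma>. card \<sigma> = Suc (Suc j) \<Longrightarrow> kd w \<sigma> \<in> nth_ideal fs i)
      \<Longrightarrow> \<exists>u. \<forall>\<sigma>. card \<sigma> = Suc j \<longrightarrow> w \<sigma> - kd u \<sigma> \<in> nth_ideal fs i"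
    and ex2: "\<And>v'. (\<And>\<sigma>. card \<sigma> = Suc j \<Longrightarrow> kd v' \<sigma> \<in> nth_ideal fs i)
      \<Longrightarrow> \<exists>u. \<forall>\<sigma>. card \<sigma> = j \<longrightarrow> v' \<sigma> - kd u \<sigma> \<in> nth_ideal fs i"
  shows "\<exists>u. \<forall>\<sigma>. card \<sigma> = j \<longrightarrow> v \<sigma> - kd u \<sigma> \<in> nth_ideal fs (Suc i)"
proof -
  let ?f = "fs ! i"
  \<comment> \<open>Applying \<open>kd\<close> to kd v - f w leaves -f times kd w in the ideal, and
    regularity cancels f. This is the connecting map of the long exact sequence.\<close>
  have "kd w \<sigma> \<in> nth_ideal fs i" if "card \<sigma> = Suc (Suc j)" for \<sigma>
  proof (rule regular[OF i])
    have "kd (\<lambda>\<rho>. kd v \<rho> - ?f * w \<rho>) \<sigma> \<in> nth_ideal fs i"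
      unfolding nth_ideal_def by (rule kd_in_ideal) (use w that in \<open>simp add: nth_ideal_def\<close>)
    then have "- (?f * kd w \<sigma>) \<in> nth_ideal fs i" by (simp add: kd_diff kd_kd kd_mult)
    then show "?f * kd w \<sigma> \<in> nth_ideal fs i" using ring_ideal.span_neg by (fastforce simp: nth_ideal_def)
  qed
  then obtain w' where w': "\<And>\<sigma>. card \<sigma> = Suc j \<Longrightarrow> w \<sigma> - kd w' \<sigma> \<in> nth_ideal fs i" using ex1 by blast
  have "kd (\<lambda>\<sigma>. v \<sigma> - ?f * w' \<sigma>) \<sigma> \<in> nth_ideal fs i" if "card \<sigma> = Suc j" for \<sigma>
  proof -
    have "(kd v \<sigma> - ?f * w \<sigma>) + ?f * (w \<sigma> - kd w' \<sigma>) \<in> nth_ideal fs i"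
      using w[OF that] w'[OF that] ideal_mult unfolding nth_ideal_def by (intro ring_ideal.span_add) auto
    moreover have "(kd v \<sigma> - ?f * w \<sigma>) + ?f * (w \<sigma> - kd w' \<sigma>) = kd v \<sigma> - ?f * kd w' \<sigma>"
      by (simp add: algebra_simps)
    ultimately show ?thesis by (simp only: kd_diff kd_mult)
  qed
  then obtain u where u: "\<And>\<sigma>. card \<sigma> = j \<Longrightarrow> v \<sigma> - ?f * w' \<sigma> - kd u \<sigma> \<in> nth_ideal fs i" using ex2 by blast
  have "v \<sigma> - kd u \<sigma> \<in> nth_ideal fs (Suc i)" if "card \<sigma> = j" for \<sigma>
    unfolding mem_nth_ideal_Suc[OF i] using u[OF that] by (intro exI[of _ "w' \<sigma>"]) (simp add: algebra_simps)
  then show ?thesis by blast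
qed

text \<open>Depth sensitivity: cohomology vanishes below degree n - i, since each element of the
  sequence costs one degree.\<close>

lemma koszul_vanishing:
  assumes "i \<le> length fs" "j + i < CARD('n)" "\<And>\<sigma>. card \<sigma> = Suc j \<Longrightarrow> kd v \<sigma> \<in> nth_ideal fs i"
  shows "\<exists>u. \<forall>\<sigma>. card \<sigma> = j \<longrightarrow> v \<sigma> - kd u \<sigma> \<in> nth_ideal fs i"
  using assms
proof (induction i arbitrary: j v)
  case 0
  \<comment> \<open>Exactness over the polynomial ring is stated for cocycles at all sets, so v is
    cut off outside cardinality j.\<close>
  define v' where "v' \<sigma> = (if card \<sigma> = j then v \<sigma> else 0)" for \<sigma>
  have "kd v' \<sigma> = 0" for \<sigma>
  proof (cases "card \<sigma> = Suc j")
    case True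
    have "kd v' \<sigma> = kd v \<sigma>" by (rule kd_cong) (use True in \<open>simp add: v'_def\<close>)
    then show ?thesis using 0(3)[OF True] by (simp add: nth_ideal_def)
  next
    case False
    have "kd v' \<sigma> = kd (\<lambda>_. 0) \<sigma>" by (rule kd_cong) (use False in \<open>auto simp: v'_def\<close>)
    then show ?thesis by (simp add: kd_def)
  qed
  then obtain u where u: "\<And>\<tau>. \<tau> \<noteq> UNIV \<Longrightarrow> v' \<tau> = kd u \<tau>" using koszul_exact by blast
  have "v \<sigma> - kd u \<sigma> \<in> nth_ideal fs 0" if "card \<sigma> = j" for \<sigma>
  proof -
    have "\<sigma> \<noteq> UNIV" using that 0(2) by auto
    then show ?thesis using u[of \<sigma>] that by (simp add: v'_def nth_ideal_def)
  qed
  then show ?case by blast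
next
  case (Suc i)
  have i: "i < length fs" using Suc.prems(1) by simp
  have "\<forall>\<sigma>. \<exists>w. card \<sigma> = Suc j \<longrightarrow> kd v \<sigma> - fs ! i * w \<in> nth_ideal fs i"
    using Suc.prems(3) mem_nth_ideal_Suc[OF i] by blast
  then obtain w where w: "\<And>\<sigma>. card \<sigma> = Suc j \<Longrightarrow> kd v \<sigma> - fs ! i * w \<sigma> \<in> nth_ideal fs i" by metis
  show ?case
  proof (rule koszul_step[OF i w])
    show "\<exists>u. \<forall>\<sigma>. card \<sigma> = Suc j \<longrightarrow> w \<sigma> - kd u \<sigma> \<in> nth_ideal fs i"
      if "\<And>\<sigma>. card \<sigma> = Suc (Suc j) \<Longrightarrow> kd w \<sigma> \<in> nth_ideal fs i"
      using Suc.IH[of "Suc j" w] Suc.prems that by simp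
    show "\<exists>u. \<forall>\<sigma>. card \<sigma> = j \<longrightarrow> v' \<sigma> - kd u \<sigma> \<in> nth_ideal fs i"
      if "\<And>\<sigma>. card \<sigma> = Suc j \<Longrightarrow> kd v' \<sigma> \<in> nth_ideal fs i" for v'
      using Suc.IH[of j v'] Suc.prems that by simp
  qed
qed

text \<open>In the first degree not covered, j = n - i, classes of polynomial degree D < i still
  vanish. Passing to i - 1 raises the degree by 1 through a variable and lowers it by 2 through the
  quadric, so D and i drop together until D = 0, where the quotient w must be 0.\<close>

lemma koszul_vanishing_top:
  assumes "i \<le> length fs" "j + i = CARD('n)" "D < i" "\<And>\<sigma>. v \<sigma> \<in> homog D"
    "\<And>\<sigma>. card \<sigma> = Suc j \<Longrightarrow> kd v \<sigma> \<in> nth_ideal fs i"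
  shows "\<exists>u. \<forall>\<sigma>. card \<sigma> = j \<longrightarrow> v \<sigma> - kd u \<sigma> \<in> nth_ideal fs i"
  using assms
proof (induction i arbitrary: j v D)
  case 0
  then show ?case by simp
next
  case (Suc i)
  have i: "i < length fs" using Suc.prems(1) by simp
  have f: "fs ! i \<in> homog 2" using fs i by auto
  have hkd: "kd v \<sigma> \<in> homog (Suc D)" for \<sigma>
  proof -
    have h: "ksign k \<sigma> * (mvar k * v (\<sigma> - {k})) \<in> homog (Suc D)" for k
    proof -
      have "mvar k * v (\<sigma> - {k}) \<in> homog (Suc D)"
        using homog_mult[OF homog_mvar Suc.prems(4), of k "\<sigma> - {k}"] by simp
      then show ?thesis
        by (cases "even (card {l\<in>\<sigma>. l < k})") (auto simp: ksign_def intro: homog_uminus)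
    qed
    then show ?thesis unfolding kd_def by (intro homog_sum h)
  qed
  \<comment> \<open>The true degree of w is D - 1; for D = 0 truncated subtraction would allow
    constants, so w = 0 is recorded separately.\<close>
  have "\<exists>w. w \<in> homog (D - 1) \<and> (D = 0 \<longrightarrow> w = 0) \<and> kd v \<sigma> - fs ! i * w \<in> nth_ideal fs i"
    if s: "card \<sigma> = Suc j" for \<sigma>
  proof -
    obtain c where c: "kd v \<sigma> - fs ! i * c \<in> nth_ideal fs i"
      using Suc.prems(5)[OF s] mem_nth_ideal_Suc[OF i] by blast
    then have "hcomp (Suc D) (kd v \<sigma> - fs ! i * c) \<in> nth_ideal fs i"
      unfolding nth_ideal_def by (rule hcomp_in_ideal[OF homog_gens])
    then have "kd v \<sigma> - fs ! i * (if D = 0 then 0 else hcomp (D - 1) c) \<in> nth_ideal fs i"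
      using hcomp_mult[OF f, of "Suc D" c] hkd[of \<sigma>] by (cases D) (auto simp: hcomp_diff)
    then show ?thesis using hcomp_homog by (intro exI[of _ "if D = 0 then 0 else hcomp (D - 1) c"]) auto
  qed
  then obtain w0 where w0: "\<And>\<sigma>. card \<sigma> = Suc j \<Longrightarrow> w0 \<sigma> \<in> homog (D - 1) \<and> (D = 0 \<longrightarrow> w0 \<sigma> = 0)
      \<and> kd v \<sigma> - fs ! i * w0 \<sigma> \<in> nth_ideal fs i" by metis
  define w where "w \<sigma> = (if card \<sigma> = Suc j then w0 \<sigma> else 0)" for \<sigma>
  have w: "w \<sigma> \<in> homog (D - 1)" "D = 0 \<Longrightarrow> w \<sigma> = 0" for \<sigma> using w0[of \<sigma>] by (auto simp: w_def)
  have w': "kd v \<sigma> - fs ! i * w \<sigma> \<in> nth_ideal fs i" if "card \<sigma> = Suc j" for \<sigma>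
    using w0[OF that] that by (simp add: w_def)
  show ?case
  proof (rule koszul_step[OF i w'])
    show "\<exists>u. \<forall>\<sigma>. card \<sigma> = Suc j \<longrightarrow> w \<sigma> - kd u \<sigma> \<in> nth_ideal fs i"
      if "\<And>\<sigma>. card \<sigma> = Suc (Suc j) \<Longrightarrow> kd w \<sigma> \<in> nth_ideal fs i"
    proof (cases "D = 0")
      case True
      then show ?thesis
        using w(2) by (intro exI[of _ "\<lambda>_. 0"]) (auto simp: kd_def nth_ideal_def ring_ideal.span_zero)
    next
      case False
      then show ?thesis using Suc.IH[of "Suc j" "D - 1" w] Suc.prems(1-3) that w(1) by simp
    qed
    show "\<exists>u. \<forall>\<sigma>. card \<sigma> = j \<longrightarrow> v' \<sigma> - kd u \<sigma> \<in> nth_ideal fs i"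
      if "\<And>\<sigma>. card \<sigma> = Suc j \<Longrightarrow> kd v' \<sigma> \<in> nth_ideal fs i" for v'
      using koszul_vanishing[of i j v'] Suc.prems that by simp
  qed
qed

text \<open>As a 0-cochain, u is a cocycle modulo the ideal, and coboundaries in degree 0 are empty
  sums; so vanishing for i = n, j = 0, D = t says that u is in the ideal.\<close>

lemma socle:
  assumes len: "length fs = CARD('n)" and u: "u \<in> homog t" "t < CARD('n)"
    and soc: "\<And>i. mvar i * u \<in> ideal_gen (set fs)"
  shows "u \<in> ideal_gen (set fs)"
proof -
  define v where "v \<sigma> = (if \<sigma> = {} then u else 0)" for \<sigma> :: "'n set"
  have "\<exists>u. \<forall>\<sigma>. card \<sigma> = 0 \<longrightarrow> v \<sigma> - kd u \<sigma> \<in> nth_ideal fs (length fs)"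
  proof (rule koszul_vanishing_top)
    fix \<sigma> :: "'n set" assume "card \<sigma> = Suc 0"
    then obtain k where "\<sigma> = {k}" by (metis card_1_singletonE One_nat_def)
    then show "kd v \<sigma> \<in> nth_ideal fs (length fs)"
      using soc[of k] by (simp add: kd_def v_def nth_ideal_def ideal_mult)
  qed (use len u in \<open>auto simp: v_def\<close>)
  then show ?thesis by (auto simp: v_def kd_def nth_ideal_def)
qed

end

section \<open>Duality for almost complete intersections\<close>

context quadratic_regular
begin

lemma hilbert_fun_ci:
  assumes "length fs = CARD('n)"
  shows "hilbert_fun (ideal_gen (set fs)) t = CARD('n) choose t"
proof -
  obtain X :: "'n set" where X: "card X = length fs"
    "\<And>t. hilbert_fun (ideal_gen (set fs)) t = card (partial_squarefree X t)"
    using regular_quadrics_hilbert_fun[OF fs reg] assms by (metis order_refl)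
  have "X = UNIV" by (rule card_subset_eq) (use X(1) assms in auto)
  then show ?thesis using X(2) card_squarefree by metis
qed

text \<open>In degree n the quotient is one-dimensional, and \<epsilon> is the coordinate of the
  component of degree n along a generator b. Absence of socle below degree n makes the pairing (p,
  v) -> \<epsilon> (p v) perfect.\<close>

lemma gorenstein_functional:
  assumes len: "length fs = CARD('n)"
  shows "\<exists>\<epsilon> :: ('n, 'k) mpoly \<Rightarrow> 'k. (\<forall>p q. \<epsilon> (p + q) = \<epsilon> p + \<epsilon> q) \<and> (\<forall>c p. \<epsilon> (mscale c p) = c * \<epsilon> p)
    \<and> (\<forall>p t. p \<in> homog t \<longrightarrow> t \<noteq> CARD('n) \<longrightarrow> \<epsilon> p = 0) \<and> (\<forall>p\<in>ideal_gen (set fs). \<epsilon> p = 0)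
    \<and> (\<forall>p t. p \<in> homog t \<longrightarrow> (\<forall>v. \<epsilon> (p * v) = 0) \<longrightarrow> p \<in> ideal_gen (set fs))
    \<and> (\<forall>t>CARD('n). homog t \<subseteq> ideal_gen (set fs))"
proof -
  let ?n = "CARD('n)" and ?I = "ideal_gen (set fs)"
  have h: "hilbert_fun ?I t + mpoly.dim (?I \<inter> homog t) = mpoly.dim (homog t :: ('n, 'k) mpoly set)" for t
    by (rule hilbert_fun_eq) simp
  have sI: "mpoly.subspace (?I \<inter> homog t)" for t
    by (intro mpoly.subspace_inter subspace_ideal subspace_homog) simp
  have hom: "set fs \<subseteq> (\<Union>t. homog t)" using fs by auto
  have large: "homog t \<subseteq> ?I" if "t > ?n" for t
  proof -
    have "mpoly.dim (?I \<inter> homog t) = mpoly.dim (homog t :: ('n, 'k) mpoly set)"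
      using h[of t] hilbert_fun_ci[OF len, of t] that by (simp add: binomial_eq_0)
    then have "?I \<inter> homog t = homog t" by (intro mpoly.subspace_dim_eq sI) (auto simp: fin_dim_homog)
    then show ?thesis by blast
  qed
  obtain U where U: "mpoly.subspace U" "U \<subseteq> homog ?n" "U \<inter> (?I \<inter> homog ?n) = {0}"
    "mpoly.dim (homog ?n :: ('n, 'k) mpoly set) = mpoly.dim U + mpoly.dim (?I \<inter> homog ?n)"
    "\<And>x. x \<in> homog ?n \<Longrightarrow> \<exists>u\<in>U. \<exists>r\<in>?I \<inter> homog ?n. x = u + r"
    using mpoly.complement_exists[OF subspace_homog fin_dim_homog sI[of ?n]] by (metis inf_le2)
  have "mpoly.dim U = 1" using U(4) h[of ?n] hilbert_fun_ci[OF len, of ?n] by simp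
  then obtain B where B: "B \<subseteq> U" "mpoly.independent B" "U \<subseteq> mpoly.span B" "card B = 1"
    using mpoly.fin_dim_basis[OF fin_dim_homog_subset[OF U(2)]] by metis
  then obtain b where b: "B = {b}" by (metis card_1_singletonE)
  have b0: "b \<noteq> 0" "b \<in> U" using B b by auto
  have ex: "\<exists>c. hcomp ?n p - mscale c b \<in> ?I" for p :: "('n, 'k) mpoly"
  proof -
    obtain u r where ur: "u \<in> U" "r \<in> ?I" "hcomp ?n p = u + r" using U(5)[OF hcomp_homog] by blast
    have "u \<in> mpoly.span {b}" using ur(1) B(3) b by blast
    then obtain c where "u = mscale c b" by (auto simp: mpoly.span_singleton)
    then show ?thesis using ur by (intro exI[of _ c]) simp
  qed
  then obtain \<epsilon> where \<epsilon>: "\<And>p. hcomp ?n p - mscale (\<epsilon> p) b \<in> ?I" by metis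
  have uniq: "c = \<epsilon> p" if "hcomp ?n p - mscale c b \<in> ?I" for p c
  proof -
    have "(hcomp ?n p - mscale (\<epsilon> p) b) - (hcomp ?n p - mscale c b) \<in> ?I" by (rule ring_ideal.span_diff[OF \<epsilon> that])
    moreover have "(hcomp ?n p - mscale (\<epsilon> p) b) - (hcomp ?n p - mscale c b) = mscale (c - \<epsilon> p) b"
      by (simp add: algebra_simps)
    ultimately have "mscale (c - \<epsilon> p) b \<in> ?I" by simp
    moreover have "mscale (c - \<epsilon> p) b \<in> U" using U(1) b0 by (intro mpoly.subspace_scale)
    ultimately have "mscale (c - \<epsilon> p) b = 0" using U(2,3) by blast
    then have "c - \<epsilon> p = 0" using b0(1) mpoly.scale_eq_0_iff by metis
    then show ?thesis by simp
  qed
  have zero: "\<epsilon> p = 0 \<longleftrightarrow> hcomp ?n p \<in> ?I" for p using \<epsilon>[of p] uniq[of p 0] by auto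
  \<comment> \<open>Descending induction on the degree: the assumption on p passes to its multiples
    by variables, these lie in the ideal, and then \<open>socle\<close> applies.\<close>
  have nd: "p \<in> ?I" if "p \<in> homog t" "\<And>v. \<epsilon> (p * v) = 0" for p t
    using that
  proof (induction "?n - t" arbitrary: t p)
    case 0
    show ?case
    proof (cases "t = ?n")
      case True
      then show ?thesis using 0(2) zero[of p] 0(3)[of 1] by simp
    next
      case False
      then show ?thesis using large[of t] 0(1,2) by auto
    qed
  next
    case (Suc d)
    show ?case
    proof (rule socle[OF len Suc.prems(1)])
      show "t < ?n" using Suc(2) by simp
      fix i
      show "mvar i * p \<in> ?I"
      proof (rule Suc(1))
        show "d = ?n - Suc t" using Suc(2) by simp
        show "mvar i * p \<in> homog (Suc t)" using homog_mult[OF homog_mvar Suc.prems(1)] by simp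
        show "\<epsilon> (mvar i * p * v) = 0" for v using Suc.prems(2)[of "mvar i * v"] by (simp add: mult_ac)
      qed
    qed
  qed
  show ?thesis
  proof (intro exI[of _ \<epsilon>] conjI allI ballI impI)
    show "\<epsilon> (p + q) = \<epsilon> p + \<epsilon> q" for p q
      using ring_ideal.span_add[OF \<epsilon>[of p] \<epsilon>[of q]]
      by (intro uniq[symmetric]) (simp add: hcomp_add algebra_simps)
    show "\<epsilon> (mscale c p) = c * \<epsilon> p" for c p
    proof -
      have "hcomp ?n (mscale c p) - mscale (c * \<epsilon> p) b = mconst c * (hcomp ?n p - mscale (\<epsilon> p) b)"
        by (simp add: hcomp_scale right_diff_distrib mult.assoc)
      then have "hcomp ?n (mscale c p) - mscale (c * \<epsilon> p) b \<in> ?I" using ideal_mult[OF \<epsilon>[of p]] by simp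
      then show ?thesis by (rule uniq[symmetric])
    qed
    show "\<epsilon> p = 0" if "p \<in> homog t" "t \<noteq> ?n" for p t
      unfolding zero using hcomp_of_homog[OF that(1), of ?n] that(2) by (simp add: ring_ideal.span_zero)
    show "\<epsilon> p = 0" if "p \<in> ?I" for p unfolding zero by (rule hcomp_in_ideal[OF hom that])
    show "p \<in> ?I" if "p \<in> homog t" "\<forall>v. \<epsilon> (p * v) = 0" for p t using nd that by blast
    show "homog t \<subseteq> ?I" if "t > ?n" for t by (rule large[OF that])
  qed
qed

end

text \<open>\<Phi> pairs degrees t and 4 - t perfectly after both kernels of \<tau> are divided
  out.\<close>

lemma (in quartic) br_symmetric:
  assumes "t \<le> 4"
  shows "br (homog (4 - t)) = br (homog t)"
proof -
  have "{v\<in>homog (4 - t). \<forall>x\<in>homog t. \<Phi> (x * v) = 0} = {v\<in>homog (4 - t). \<tau> v = 0}"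
    using \<tau>_eq_0_homog[of _ "4 - t"] assms by (auto simp: mult.commute)
  then show ?thesis
    using perp_dim[OF subspace_homog order_refl assms] br_nullity[OF subspace_homog order_refl, of "4 - t"] by simp
qed

lemma (in quartic) br_homog_0: "br (homog 0) = 1"
proof -
  have one: "\<tau> 1 \<noteq> 0" using nonzero by (auto simp: \<tau>_eq_0_iff)
  have "\<tau> ` homog 0 = mpoly.span {\<tau> 1}"
  proof (intro equalityI subsetI)
    fix p assume "p \<in> \<tau> ` homog 0"
    then obtain s where s: "s \<in> homog 0" "p = \<tau> s" by blast
    have "p = mscale (lookup s 0) (\<tau> 1)"
      using homog_zero_iff[OF s(1)] \<tau>_scale[of "lookup s 0" 1] s(2) by simp
    then show "p \<in> mpoly.span {\<tau> 1}" by (auto simp: mpoly.span_singleton)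
  next
    fix p assume "p \<in> mpoly.span {\<tau> 1}"
    then obtain c where "p = mscale c (\<tau> 1)" by (auto simp: mpoly.span_singleton)
    then have "p = \<tau> (mconst c)" using \<tau>_scale[of c 1] by simp
    then show "p \<in> \<tau> ` homog 0" using homog_mconst by blast
  qed
  then show ?thesis using one mpoly.dim_eq_card_independent[of "{\<tau> 1}"] by (simp add: br_def)
qed

text \<open>The sequence 1, p, a, p, 1 shifted by the degree of g. On the algebraic side it is what
  g removes from the complete intersection, on the combinatorial side the number of nonfaces of size
  t.\<close>

definition face_defect :: "nat \<Rightarrow> nat \<Rightarrow> nat \<Rightarrow> nat" where
  "face_defect p a t = (if t = 2 \<or> t = 6 then 1 else if t = 3 \<or> t = 5 then p else if t = 4 then a else 0)"

definition admissible :: "nat \<Rightarrow> nat \<Rightarrow> bool" where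
  "admissible p a \<longleftrightarrow> p = 4 \<and> a = 6 \<or> p = 5 \<and> a \<in> {8..10} \<or> p = 6 \<and> a \<in> {9..15}"

lemma almost_ci_hilbert_fun:
  fixes fs :: "(6, 'k::alg_closed_field) mpoly list"
  assumes len: "length fs = 6" and fs: "set fs \<subseteq> homog 2" and reg: "regular_sequence fs"
    and g: "g \<in> homog 2" "g \<notin> ideal_gen (set fs)"
  obtains p a where "admissible p a"
    "\<And>t. hilbert_fun (ideal_gen (insert g (set fs))) t + face_defect p a t = 6 choose t"
proof -
  interpret quadratic_regular fs by unfold_locales (fact fs reg)+
  let ?I = "ideal_gen (set fs)"
  have len': "length fs = CARD(6)" using len by simp
  from gorenstein_functional[OF len'] obtain \<epsilon> :: "(6, 'k) mpoly \<Rightarrow> 'k" where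
    "\<forall>p q. \<epsilon> (p + q) = \<epsilon> p + \<epsilon> q" "\<forall>c p. \<epsilon> (mscale c p) = c * \<epsilon> p"
    "\<forall>p t. p \<in> homog t \<longrightarrow> t \<noteq> CARD(6) \<longrightarrow> \<epsilon> p = 0" "\<forall>p\<in>?I. \<epsilon> p = 0"
    "\<forall>p t. p \<in> homog t \<longrightarrow> (\<forall>v. \<epsilon> (p * v) = 0) \<longrightarrow> p \<in> ?I" "\<forall>t>CARD(6). homog t \<subseteq> ?I"
    by (elim exE conjE)
  note \<epsilon> = this[rule_format]
  \<comment> \<open>Shifting \<epsilon> by g makes the kernel of \<tau> on forms the colon ideal (f)
    : g, as \<open>colon\<close> shows; the degree drops from 6 to 4.\<close>
  define \<Phi> where "\<Phi> s = \<epsilon> (g * s)" for s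
  interpret Q: quartic \<Phi> "set fs"
  proof
    show "\<Phi> (p + q) = \<Phi> p + \<Phi> q" for p q by (simp add: \<Phi>_def distrib_left \<epsilon>)
    show "\<Phi> (mscale c p) = c * \<Phi> p" for c p by (simp add: \<Phi>_def mult_lin \<epsilon>)
    show "\<Phi> p = 0" if "p \<in> homog t" "t \<noteq> 4" for p t
      unfolding \<Phi>_def using that by (intro \<epsilon>(3)[OF homog_mult[OF g(1)]]) auto
    show "set fs \<subseteq> homog 2" by (rule fs)
    show "\<Phi> (f * p) = 0" if "f \<in> set fs" for f p
    proof -
      have "(g * p) * f \<in> ?I" by (intro ideal_mult ring_ideal.span_base that)
      then show ?thesis using \<epsilon>(4) by (simp add: \<Phi>_def mult_ac)
    qed
    show "\<exists>N. \<forall>t\<ge>N. homog t \<subseteq> ?I" using \<epsilon>(6) by (intro exI[of _ 7]) auto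
    show "\<exists>p. \<Phi> p \<noteq> 0" using \<epsilon>(5)[OF g(1)] g(2) by (auto simp: \<Phi>_def)
  qed
  have colon: "{h \<in> homog u. g * h \<in> ?I} = {h \<in> homog u. Q.\<tau> h = 0}" for u
  proof -
    have "g * h \<in> ?I \<longleftrightarrow> Q.\<tau> h = 0" if "h \<in> homog u" for h
    proof
      assume "g * h \<in> ?I"
      then have "v * (g * h) \<in> ?I" for v by (rule ideal_mult)
      then show "Q.\<tau> h = 0" using \<epsilon>(4) by (simp add: Q.\<tau>_eq_0_iff \<Phi>_def mult_ac)
    next
      assume "Q.\<tau> h = 0"
      then have "\<epsilon> (g * h * v) = 0" for v by (simp add: Q.\<tau>_eq_0_iff \<Phi>_def mult.assoc)
      then show "g * h \<in> ?I" by (rule \<epsilon>(5)[OF homog_mult[OF g(1) that]])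
    qed
    then show ?thesis by blast
  qed
  have hom: "set fs \<subseteq> (\<Union>t. homog t)" using fs by auto
  define p where "p = Q.br (homog 1)"
  define a where "a = Q.br (homog 2)"
  have step: "hilbert_fun (ideal_gen (insert g (set fs))) (u + 2) + Q.br (homog u) = 6 choose (u + 2)" for u
    using hilbert_fun_insert(1)[OF hom g(1), of u] hilbert_fun_ci[OF len', of "u + 2"]
      Q.br_nullity[OF subspace_homog order_refl, of u] colon[of u] by simp
  have br: "Q.br (homog u) = face_defect p a (u + 2)" for u
  proof -
    have "Q.br (homog 4) = 1" "Q.br (homog 3) = p"
      using Q.br_symmetric[of 0] Q.br_symmetric[of 1] Q.br_homog_0 by (simp_all add: p_def)
    moreover have "Q.br (homog u) = 0" if "u > 4"
    proof -
      have "Q.\<tau> ` homog u \<subseteq> {0}"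
        using Q.\<Phi>_mult_large[OF _ that] by (auto simp: Q.\<tau>_eq_0_iff mult.commute)
      then have "mpoly.dim (Q.\<tau> ` homog u) \<le> mpoly.dim ({0} :: (6, 'k) mpoly set)"
        by (intro mpoly.dim_mono_subset mpoly.fin_dim_finite) auto
      then show ?thesis by (simp add: Q.br_def)
    qed
    moreover have "u = 0 \<or> u = 1 \<or> u = 2 \<or> u = 3 \<or> u = 4 \<or> u > 4" by linarith
    ultimately show ?thesis using Q.br_homog_0 by (auto simp: face_defect_def p_def a_def)
  qed
  have "p \<le> mpoly.dim (homog 1 :: (6, 'k) mpoly set)" using Q.dim_V_kernel by (simp add: p_def)
  then have "p \<le> 6" using dim_homog_1_le[where 'n = 6 and 'k = 'k] by simp
  then have adm: "admissible p a" using Q.br_range by (simp add: admissible_def p_def a_def)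
  show thesis
  proof (rule that[OF adm])
    fix t
    show "hilbert_fun (ideal_gen (insert g (set fs))) t + face_defect p a t = 6 choose t"
    proof (cases "t < 2")
      case True
      then show ?thesis
        using hilbert_fun_insert(2)[OF hom g(1) True] hilbert_fun_ci[OF len', of t] by (simp add: face_defect_def)
    next
      case False
      then obtain u where "t = u + 2" by (metis add.commute le_Suc_ex not_less)
      then show ?thesis using step[of u] br[of u] by simp
    qed
  qed
qed

section \<open>Squarefree monomial ideals\<close>

lemma keys_add_nat: "keys (m + m') = keys m \<union> keys m'" for m m' :: "'n \<Rightarrow>\<^sub>0 nat"
  by (auto simp: in_keys_iff lookup_add)

lemma monomial_ideal_keys:
  fixes M :: "('n \<Rightarrow>\<^sub>0 nat) set"
  assumes M: "\<And>m m'. m \<in> M \<Longrightarrow> m' + m \<in> M"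
  shows "ideal_gen ((\<lambda>m. single m (1::'k::field)) ` M) = {p. keys p \<subseteq> M}"
proof (intro equalityI subsetI)
  fix p assume "p \<in> ideal_gen ((\<lambda>m. single m (1::'k)) ` M)"
  then have "keys p \<subseteq> M"
  proof (induction rule: ring_ideal.span_induct_alt)
    case (step c x y)
    then obtain m where m: "m \<in> M" "x = single m 1" by blast
    have "keys (c * x) \<subseteq> {a + b |a b. a \<in> keys c \<and> b \<in> keys x}" by (rule keys_mult)
    also have "\<dots> \<subseteq> M" using m M by auto
    finally show ?case using step keys_add[of "c * x" y] by blast
  qed simp
  then show "p \<in> {p. keys p \<subseteq> M}" by simp
next
  fix p :: "('n, 'k) mpoly" assume "p \<in> {p. keys p \<subseteq> M}"
  then have "(\<Sum>m\<in>keys p. mscale (lookup p m) (single m 1)) \<in> ideal_gen ((\<lambda>m. single m (1::'k)) ` M)"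
    by (intro ring_ideal.span_sum ideal_mult ring_ideal.span_base) auto
  then show "p \<in> ideal_gen ((\<lambda>m. single m (1::'k)) ` M)" using mpoly_eq_sum_scale[of p] by simp
qed

text \<open>U is the set of nonfaces of a simplicial complex. The standard monomials of the
  Stanley-Reisner ideal together with all squares are the squarefree ones supported on
  faces.\<close>

lemma squarefree_ideal:
  fixes U :: "'n::finite set set"
  assumes U: "\<And>\<sigma> \<rho>. \<sigma> \<in> U \<Longrightarrow> \<sigma> \<subseteq> \<rho> \<Longrightarrow> \<rho> \<in> U"
  obtains L :: "('n, 'k::field) mpoly set" where "homogeneous_ideal L" "\<And>i. mvar i ^ 2 \<in> L"
    "\<And>t. hilbert_fun L t + card {\<sigma>\<in>U. card \<sigma> = t} = CARD('n) choose t"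
proof -
  define M where "M = {m :: 'n \<Rightarrow>\<^sub>0 nat. (\<exists>i. lookup m i \<ge> 2) \<or> keys m \<in> U}"
  have M: "m' + m \<in> M" if "m \<in> M" for m m'
    using that U[of "keys m" "keys (m' + m)"] by (auto simp: M_def keys_add_nat lookup_add intro: trans_le_add2)
  define L where "L = ideal_gen ((\<lambda>m. single m (1::'k)) ` M)"
  have L: "L = {p. keys p \<subseteq> M}" unfolding L_def by (rule monomial_ideal_keys[OF M])
  have "homogeneous_ideal L"
    unfolding homogeneous_ideal_def L_def
    by (rule exI[of _ "(\<lambda>m. single m (1::'k)) ` M"]) (auto intro: homog_single)
  moreover have "mvar i ^ 2 \<in> L" for i
  proof -
    have "mvar i ^ 2 = (single (single i 2) 1 :: ('n, 'k) mpoly)"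
      by (simp add: mvar_def power2_eq_square mult_single numeral_2_eq_2 flip: single_add)
    moreover have "single i 2 \<in> M" by (auto simp: M_def intro!: exI[of _ i])
    ultimately show ?thesis by (simp add: L)
  qed
  moreover have "hilbert_fun L t + card {\<sigma>\<in>U. card \<sigma> = t} = CARD('n) choose t" for t
  proof -
    let ?D = "{m :: 'n \<Rightarrow>\<^sub>0 nat. mdeg m = t}"
    have "L \<inter> homog t = {p. keys p \<subseteq> M \<inter> ?D}" by (auto simp: L homog_def)
    then have 1: "mpoly.dim (L \<inter> homog t) = card (M \<inter> ?D)"
      using dim_monomials[of "M \<inter> ?D"] finite_mdeg[of t] by (metis finite_Int)
    have "homog t = {p :: ('n, 'k) mpoly. keys p \<subseteq> ?D}" by (auto simp: homog_def)
    then have "mpoly.dim (homog t :: ('n, 'k) mpoly set) = card ?D" using dim_monomials[OF finite_mdeg] by metis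
    moreover have "is_ideal L" by (simp add: L_def)
    ultimately have "hilbert_fun L t + card (M \<inter> ?D) = card ?D" using hilbert_fun_eq[of L t] 1 by simp
    moreover have "card ?D = card (M \<inter> ?D) + card (?D - M)"
      using card_Int_Diff[OF finite_mdeg[of t], of M] by (simp add: Int_commute)
    ultimately have h: "hilbert_fun L t = card (?D - M)" by simp
    have e: "(\<exists>i. lookup m i \<ge> 2) \<longleftrightarrow> \<not> (\<forall>i\<in>UNIV. lookup m i < 2)" for m :: "'n \<Rightarrow>\<^sub>0 nat"
      by (meson UNIV_I not_le)
    have "?D - M = {m \<in> partial_squarefree UNIV t. keys m \<notin> U}"
      unfolding M_def partial_squarefree_def e by blast
    also have "card \<dots> = card {\<sigma>. card \<sigma> = t \<and> \<sigma> \<notin> U}"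
    proof (rule bij_betw_same_card)
      show "bij_betw keys {m \<in> partial_squarefree UNIV t. keys m \<notin> U} {\<sigma> :: 'n set. card \<sigma> = t \<and> \<sigma> \<notin> U}"
      proof -
        have b: "inj_on keys (partial_squarefree (UNIV :: 'n set) t)"
          "keys ` partial_squarefree (UNIV :: 'n set) t = {\<sigma>. card \<sigma> = t}"
          using bij_squarefree[where 'n = 'n and t = t] by (auto simp: bij_betw_def)
        have "keys ` {m \<in> partial_squarefree UNIV t. keys m \<notin> U} = keys ` partial_squarefree UNIV t \<inter> {\<sigma>. \<sigma> \<notin> U}"
          by blast
        then show ?thesis using b unfolding bij_betw_def by (auto intro: inj_on_subset)
      qed
    qed
    finally have h': "hilbert_fun L t = card {\<sigma>. card \<sigma> = t \<and> \<sigma> \<notin> U}" using h by simp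
    have "card {\<sigma> :: 'n set. card \<sigma> = t \<and> \<sigma> \<notin> U} + card {\<sigma>\<in>U. card \<sigma> = t}
        = card ({\<sigma> :: 'n set. card \<sigma> = t \<and> \<sigma> \<notin> U} \<union> {\<sigma>\<in>U. card \<sigma> = t})"
      by (rule card_Un_disjoint[symmetric]) auto
    also have "{\<sigma> :: 'n set. card \<sigma> = t \<and> \<sigma> \<notin> U} \<union> {\<sigma>\<in>U. card \<sigma> = t} = {\<sigma>. \<sigma> \<subseteq> UNIV \<and> card \<sigma> = t}" by auto
    also have "card \<dots> = CARD('n) choose t" by (rule n_subsets) simp
    finally show ?thesis by (simp add: h')
  qed
  ultimately show thesis using that by blast
qed

lemma card_supersets:
  fixes G :: "'n::finite set"
  assumes "card G \<le> k"
  shows "card {\<sigma>. card \<sigma> = k \<and> G \<subseteq> \<sigma>} = (CARD('n) - card G) choose (k - card G)"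
proof -
  have "bij_betw (\<lambda>\<sigma>. \<sigma> - G) {\<sigma>. card \<sigma> = k \<and> G \<subseteq> \<sigma>} {\<rho>. \<rho> \<subseteq> - G \<and> card \<rho> = k - card G}"
  proof (rule bij_betw_byWitness[where f' = "\<lambda>\<rho>. \<rho> \<union> G"])
    show "(\<lambda>\<rho>. \<rho> \<union> G) ` {\<rho>. \<rho> \<subseteq> - G \<and> card \<rho> = k - card G} \<subseteq> {\<sigma>. card \<sigma> = k \<and> G \<subseteq> \<sigma>}"
    proof (rule image_subsetI)
      fix \<rho> assume \<rho>: "\<rho> \<in> {\<rho>. \<rho> \<subseteq> - G \<and> card \<rho> = k - card G}"
      then have "card (\<rho> \<union> G) = card \<rho> + card G" by (intro card_Un_disjoint) auto
      then show "\<rho> \<union> G \<in> {\<sigma>. card \<sigma> = k \<and> G \<subseteq> \<sigma>}" using \<rho> assms by simp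
    qed
  qed (auto simp: card_Diff_subset)
  then have "card {\<sigma>. card \<sigma> = k \<and> G \<subseteq> \<sigma>} = card {\<rho>. \<rho> \<subseteq> - G \<and> card \<rho> = k - card G}"
    by (rule bij_betw_same_card)
  also have "\<dots> = card (- G) choose (k - card G)" by (rule n_subsets) simp
  finally show ?thesis by (simp add: Compl_eq_Diff_UNIV card_Diff_subset)
qed

lemma subset_card_between:
  assumes "finite B" "A \<subseteq> B" "card A \<le> n" "n \<le> card B"
  obtains T where "A \<subseteq> T" "T \<subseteq> B" "card T = n"
proof -
  have fA: "finite A" using assms finite_subset by blast
  have "n - card A \<le> card (B - A)" using assms fA by (simp add: card_Diff_subset)
  then obtain C where C: "C \<subseteq> B - A" "card C = n - card A" "finite C" using obtain_subset_with_card_n by metis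
  have "card (A \<union> C) = card A + card C" by (rule card_Un_disjoint) (use C fA in auto)
  then show thesis using that[of "A \<union> C"] C assms by auto
qed

lemma upset_of_levels:
  fixes T :: "nat \<Rightarrow> 'n::finite set set"
  assumes T: "\<And>k \<sigma>. \<sigma> \<in> T k \<Longrightarrow> card \<sigma> = k" "\<And>k \<sigma> x. \<sigma> \<in> T k \<Longrightarrow> x \<notin> \<sigma> \<Longrightarrow> insert x \<sigma> \<in> T (Suc k)"
  shows "\<exists>U. (\<forall>\<sigma>\<in>U. \<forall>\<rho>. \<sigma> \<subseteq> \<rho> \<longrightarrow> \<rho> \<in> U) \<and> (\<forall>k. {\<sigma>\<in>U. card \<sigma> = k} = T k)"
proof -
  define U where "U = (\<Union>k. T k)"
  have "\<sigma> \<union> \<rho> \<in> U" if "\<sigma> \<in> U" for \<sigma> \<rho>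
    using finite[of \<rho>]
  proof (induction \<rho>)
    case (insert x \<rho>)
    then obtain k where k: "\<sigma> \<union> \<rho> \<in> T k" by (auto simp: U_def)
    show ?case
    proof (cases "x \<in> \<sigma>")
      case True
      then have "\<sigma> \<union> insert x \<rho> = \<sigma> \<union> \<rho>" by blast
      then show ?thesis using insert by simp
    next
      case False
      then have "insert x (\<sigma> \<union> \<rho>) \<in> T (Suc k)" using T(2)[OF k, of x] insert by blast
      then show ?thesis by (auto simp: U_def)
    qed
  qed (use that in simp)
  then have "\<rho> \<in> U" if "\<sigma> \<in> U" "\<sigma> \<subseteq> \<rho>" for \<sigma> \<rho> using that by (metis sup.absorb2)
  moreover have "{\<sigma>\<in>U. card \<sigma> = k} = T k" for k using T(1) by (auto simp: U_def)
  ultimately show ?thesis by blast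
qed

text \<open>The nonfaces contain the edge \<open>P\<close>; for \<open>p = 5\<close> also the triangle \<open>Q\<close> and for \<open>p = 6\<close> also \<open>R\<close>,
  for sets of five or six vertices the nonfaces are those containing \<open>v\<close>, or all of them, respectively,
  and the number of nonfaces with four vertices is free in between.\<close>

lemma admissible_upset:
  assumes "admissible p a"
  shows "\<exists>U :: 6 set set. (\<forall>\<sigma>\<in>U. \<forall>\<rho>. \<sigma> \<subseteq> \<rho> \<longrightarrow> \<rho> \<in> U) \<and> (\<forall>k. card {\<sigma>\<in>U. card \<sigma> = k} = face_defect p a k)"
proof -
  obtain xs :: "6 list" where xs: "set xs = UNIV" "distinct xs"
    using finite_distinct_list[of "UNIV :: 6 set"] by auto
  have "length xs = 6" using distinct_card[OF xs(2)] xs(1) by simp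
  then obtain v b c d e f where xs': "xs = [v, b, c, d, e, f]"
    by (auto simp: numeral_eq_Suc length_Suc_conv)
  have dist: "distinct [v, b, c, d, e, f]" using xs xs' by simp
  define N where "N G k = {\<sigma> :: 6 set. card \<sigma> = k \<and> G \<subseteq> \<sigma>}" for G k
  \<comment> \<open>\<open>w j k\<close> counts the k-sets containing a given j-set; the case
    distinction keeps truncated subtraction harmless.\<close>
  define w where "w j k = (if j \<le> k then (6 - j) choose (k - j) else 0)" for j k :: nat
  have cN: "card (N G k) = w (card G) k" for G k
  proof (cases "card G \<le> k")
    case False
    have "G \<subseteq> \<sigma> \<Longrightarrow> card G \<le> card \<sigma>" for \<sigma> :: "6 set" by (rule card_mono) auto
    then have "N G k = {}" using False by (auto simp: N_def)
    then show ?thesis using False by (simp add: w_def)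
  qed (use card_supersets[of G k] in \<open>simp add: N_def w_def\<close>)
  have NN: "N G k \<inter> N H k = N (G \<union> H) k" for G H k by (auto simp: N_def)
  have cU: "card (X \<union> Y) = card X + card Y - card (X \<inter> Y)" for X Y :: "6 set set"
    using card_Un_Int[of X Y] by simp
  \<comment> \<open>\<open>Q\<close> and \<open>R\<close> share one vertex with \<open>P\<close> and
    two with each other, which keeps the number of 4-sets minimal: 6 + 3 - 1 = 8 with
    \<open>Q\<close> and 8 + 3 - 2 = 9 with \<open>R\<close>. All three contain v, as the case p = 5
    requires.\<close>
  define P Q R where "P = {v, b}" and "Q = {v, c, d}" and "R = {v, c, e}"
  have cards: "card P = 2" "card Q = 3" "card R = 3" "card (P \<union> Q) = 4" "card (P \<union> R) = 4" "card (Q \<union> R) = 4"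
    "card (P \<union> R \<union> (Q \<union> R)) = 5" "card {v} = 1"
  proof -
    have "distinct [f, e, d, c, b, v]" using dist by auto
    then show "card P = 2" "card Q = 3" "card R = 3" "card (P \<union> Q) = 4" "card (P \<union> R) = 4" "card (Q \<union> R) = 4"
      "card (P \<union> R \<union> (Q \<union> R)) = 5" "card {v} = 1"
      using dist by (simp_all add: P_def Q_def R_def card_insert_if)
  qed
  have c2: "card (N P k \<union> N Q k) = w 2 k + w 3 k - w 4 k" for k
    by (simp add: cU NN cN cards)
  have c3: "card (N P k \<union> N Q k \<union> N R k) = (w 2 k + w 3 k - w 4 k) + w 3 k - (w 4 k + w 4 k - w 5 k)" for k
  proof -
    have "(N P k \<union> N Q k) \<inter> N R k = N (P \<union> R) k \<union> N (Q \<union> R) k" by (auto simp: N_def)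
    moreover have "card (N (P \<union> R) k \<union> N (Q \<union> R) k) = w 4 k + w 4 k - w 5 k"
      unfolding cU[of "N (P \<union> R) k"] NN cN cards by (rule refl)
    ultimately show ?thesis unfolding cU[of "N P k \<union> N Q k"] c2 cN cards by simp
  qed
  have Nins: "insert x \<sigma> \<in> N G (Suc k)" if "\<sigma> \<in> N G k" "x \<notin> \<sigma>" for x \<sigma> G k using that by (auto simp: N_def)
  have Ncard: "card \<sigma> = k" if "\<sigma> \<in> N G k" for \<sigma> G k using that by (simp add: N_def)
  have k7: "k = 0 \<or> k = 1 \<or> k = 2 \<or> k = 3 \<or> k = 4 \<or> k = 5 \<or> k = 6 \<or> k > 6" for k :: nat by linarith
  have w0: "w j k = 0" if "k > 6" "j \<le> 6" for j k using that by (simp add: w_def binomial_eq_0)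
  have wv: "w 0 4 = 15" "w 0 5 = 6" "w 0 6 = 1" "w 1 4 = 10" "w 1 5 = 5" "w 1 6 = 1"
    "w 2 0 = 0" "w 2 1 = 0" "w 2 2 = 1" "w 2 3 = 4" "w 2 4 = 6" "w 2 5 = 4" "w 2 6 = 1"
    "w 3 0 = 0" "w 3 1 = 0" "w 3 2 = 0" "w 3 3 = 1" "w 3 4 = 3" "w 3 5 = 3" "w 3 6 = 1"
    "w 4 0 = 0" "w 4 1 = 0" "w 4 2 = 0" "w 4 3 = 0" "w 4 4 = 1" "w 4 5 = 2" "w 4 6 = 1"
    "w 5 0 = 0" "w 5 1 = 0" "w 5 2 = 0" "w 5 3 = 0" "w 5 4 = 0" "w 5 5 = 1" "w 5 6 = 1"
    by (simp_all add: w_def numeral_eq_Suc)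
  have fin: "finite X" for X :: "6 set set" by simp
  have main: ?thesis if T: "\<And>k \<sigma>. \<sigma> \<in> T k \<Longrightarrow> card \<sigma> = k"
    "\<And>k \<sigma> x. \<sigma> \<in> T k \<Longrightarrow> x \<notin> \<sigma> \<Longrightarrow> insert x \<sigma> \<in> T (Suc k)" "\<And>k. card (T k) = face_defect p a k"
    for T :: "nat \<Rightarrow> 6 set set"
  proof -
    from upset_of_levels[of T, OF T(1,2)]
    obtain U where U: "\<forall>\<sigma>\<in>U. \<forall>\<rho>. \<sigma> \<subseteq> \<rho> \<longrightarrow> \<rho> \<in> U" "\<forall>k. {\<sigma>\<in>U. card \<sigma> = k} = T k" by blast
    then show ?thesis using T(3) by (intro exI[of _ U]) simp
  qed
  \<comment> \<open>Below size 4 only what \<open>L\<close> contains, above size 4 all of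
    \<open>N G\<close>: then any choice between the two at size 4 is upward closed.\<close>
  have interpolate: ?thesis
    if L: "\<And>k. L k \<subseteq> N G k" "\<And>\<sigma> x k. \<sigma> \<in> L k \<Longrightarrow> x \<notin> \<sigma> \<Longrightarrow> insert x \<sigma> \<in> L (Suc k)"
    and a: "card (L 4) \<le> a" "a \<le> card (N G 4)"
    and other: "\<And>k. k \<noteq> 4 \<Longrightarrow> card (if k \<ge> 5 then N G k else L k) = face_defect p a k"
    for L :: "nat \<Rightarrow> 6 set set" and G
  proof -
    obtain T4 where T4: "L 4 \<subseteq> T4" "T4 \<subseteq> N G 4" "card T4 = a"
      using subset_card_between[OF fin L(1) a] by metis
    define T where "T k = (if k = 4 then T4 else if k \<ge> 5 then N G k else L k)" for k
    show ?thesis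
    proof (rule main[of T])
      have TN: "T k \<subseteq> N G k" for k using T4(2) L(1) by (auto simp: T_def)
      then show "card \<sigma> = k" if "\<sigma> \<in> T k" for \<sigma> k using that Ncard by blast
      show "insert x \<sigma> \<in> T (Suc k)" if s: "\<sigma> \<in> T k" "x \<notin> \<sigma>" for x \<sigma> k
      proof (cases "k \<ge> 4")
        case True
        then have "\<sigma> \<in> N G k" using s(1) TN by blast
        then show ?thesis using True Nins s(2) by (simp add: T_def)
      next
        case False
        then have "insert x \<sigma> \<in> L (Suc k)" using s L(2) by (simp add: T_def)
        then show ?thesis using False T4(1) by (cases "k = 3") (auto simp: T_def)
      qed
      show "card (T k) = face_defect p a k" for k
        using other[of k] T4(3) by (cases "k = 4") (simp_all add: T_def face_defect_def)
    qed
  qed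
  consider "p = 4" "a = 6" | "p = 5" "8 \<le> a" "a \<le> 10" | "p = 6" "9 \<le> a" "a \<le> 15"
    using assms by (auto simp: admissible_def)
  then show ?thesis
  proof cases
    case 1
    have "card (N P k) = face_defect p a k" for k
      using k7[of k] 1 unfolding cN cards by (elim disjE) (simp_all add: wv w0 face_defect_def del: One_nat_def)
    then show ?thesis by (intro main[of "N P"] Nins) (auto simp: N_def)
  next
    case 2
    show ?thesis
    proof (rule interpolate[of "\<lambda>k. N P k \<union> N Q k" "{v}"])
      show "card (if k \<ge> 5 then N {v} k else N P k \<union> N Q k) = face_defect p a k" if "k \<noteq> 4" for k
        using k7[of k] 2(1) that
        by (elim disjE) (simp_all add: c2 cN cards wv w0 face_defect_def del: One_nat_def)
      show "N P k \<union> N Q k \<subseteq> N {v} k" for k by (auto simp: N_def P_def Q_def)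
      show "insert x \<sigma> \<in> N P (Suc k) \<union> N Q (Suc k)" if "\<sigma> \<in> N P k \<union> N Q k" "x \<notin> \<sigma>" for \<sigma> x k
        using that Nins by blast
    qed (use 2 in \<open>simp_all add: c2 cN cards wv del: One_nat_def\<close>)
  next
    case 3
    show ?thesis
    proof (rule interpolate[of "\<lambda>k. N P k \<union> N Q k \<union> N R k" "{}"])
      show "card (if k \<ge> 5 then N {} k else N P k \<union> N Q k \<union> N R k) = face_defect p a k" if "k \<noteq> 4" for k
        using k7[of k] 3(1) that
        by (elim disjE) (simp_all add: c3 cN cards wv w0 face_defect_def del: One_nat_def)
      show "N P k \<union> N Q k \<union> N R k \<subseteq> N {} k" for k by (auto simp: N_def)
      show "insert x \<sigma> \<in> N P (Suc k) \<union> N Q (Suc k) \<union> N R (Suc k)"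
        if "\<sigma> \<in> N P k \<union> N Q k \<union> N R k" "x \<notin> \<sigma>" for \<sigma> x k
        using that Nins by blast
    qed (use 3 in \<open>simp_all add: c3 cN cards wv\<close>)
  qed
qed

section \<open>Passage to the algebraic closure\<close>

interpretation ac: vector_space "\<lambda>(c::'k::field) (z::'k alg_closure). to_ac c * z"
  by unfold_locales (auto simp: algebra_simps)

declare ac.scale_scale [simp del]

definition acbasis :: "'k::field alg_closure set" where
  "acbasis = (SOME B. ac.independent B \<and> ac.span B = UNIV)"

lemma acbasis:
  "ac.independent (acbasis :: 'a::field alg_closure set)" "ac.span (acbasis :: 'a alg_closure set) = UNIV"
proof -
  obtain B :: "'a alg_closure set" where "ac.independent B" "UNIV \<subseteq> ac.span B"
    using ac.basis_exists[of UNIV] by metis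
  then have "\<exists>B :: 'a alg_closure set. ac.independent B \<and> ac.span B = UNIV" by blast
  from someI_ex[OF this]
  show "ac.independent (acbasis :: 'a alg_closure set)" "ac.span (acbasis :: 'a alg_closure set) = UNIV"
    by (simp_all add: acbasis_def)
qed

definition accoord :: "'k::field alg_closure \<Rightarrow> 'k alg_closure \<Rightarrow> 'k" where
  "accoord b z = ac.representation acbasis z b"

lemma accoord_add: "accoord b (y + z) = accoord b y + accoord b z"
  unfolding accoord_def using acbasis by (subst ac.representation_add) auto

lemma accoord_scale: "accoord b (to_ac c * z) = c * accoord b z"
  unfolding accoord_def using acbasis by (subst ac.representation_scale) auto

lemma accoord_0 [simp]: "accoord b 0 = 0"
  using accoord_scale[of b 0 0] by simp

lemma accoord_finite: "finite {b. accoord b z \<noteq> 0}"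
  unfolding accoord_def by (rule ac.finite_representation)

lemma accoord_sum: "(\<Sum>b | accoord b z \<noteq> 0. to_ac (accoord b z) * b) = z"
  unfolding accoord_def using acbasis by (intro ac.sum_nonzero_representation_eq) auto

section \<open>Base change by coordinates\<close>

definition mp_ac :: "('n, 'k::field) mpoly \<Rightarrow> ('n, 'k alg_closure) mpoly" where
  "mp_ac p = Poly_Mapping.map to_ac p"

text \<open>Polynomials over the closure form a free module over those with coefficients in K, with
  basis \<open>acbasis\<close>; this is the coordinate at b.\<close>

definition mp_coord :: "'k::field alg_closure \<Rightarrow> ('n, 'k alg_closure) mpoly \<Rightarrow> ('n, 'k) mpoly" where
  "mp_coord b p = Poly_Mapping.map (accoord b) p"

lemma lookup_mp_ac: "lookup (mp_ac p) m = to_ac (lookup p m)"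
  by (simp add: mp_ac_def map.rep_eq when_def)

lemma lookup_mp_coord: "lookup (mp_coord b p) m = accoord b (lookup p m)"
  by (simp add: mp_coord_def map.rep_eq when_def)

lemma mp_ac_add: "mp_ac (p + q) = mp_ac p + mp_ac q"
  by (rule poly_mapping_eqI) (simp add: lookup_mp_ac lookup_add)

lemma mp_coord_add: "mp_coord b (p + q) = mp_coord b p + mp_coord b q"
  by (rule poly_mapping_eqI) (simp add: lookup_mp_coord lookup_add accoord_add)

lemma mp_ac_single: "mp_ac (single m c) = single m (to_ac c)"
  by (rule poly_mapping_eqI) (simp add: lookup_mp_ac lookup_single when_def)

lemma mp_coord_single: "mp_coord b (single m c) = single m (accoord b c)"
  by (rule poly_mapping_eqI) (simp add: lookup_mp_coord lookup_single when_def)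

lemma mp_ac_mult: "mp_ac (p * q) = mp_ac p * mp_ac q"
  by (rule additive_mult_on_single[of mp_ac]) (simp_all add: mp_ac_add mult_single mp_ac_single)

lemma mp_ac_0 [simp]: "mp_ac 0 = 0"
  by (rule poly_mapping_eqI) (simp add: lookup_mp_ac)

lemma mp_coord_0 [simp]: "mp_coord b 0 = 0"
  by (rule poly_mapping_eqI) (simp add: lookup_mp_coord)

lemma mp_ac_const: "mp_ac (mconst c) = mconst (to_ac c)"
  by (simp add: mconst_def mp_ac_single)

lemma mp_coord_mult: "mp_coord b (mp_ac p * q) = p * mp_coord b q"
proof -
  have 1: "mp_coord b (single m (to_ac c) * q) = single m c * mp_coord b q" for m c
  proof -
    have "mp_coord b (single m (to_ac c) * q)
        = mp_coord b (\<Sum>m'\<in>keys q. single (m + m') (to_ac c * lookup q m'))"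
      by (subst mpoly_eq_sum_single[of q]) (simp add: sum_distrib_left mult_single)
    also have "\<dots> = (\<Sum>m'\<in>keys q. single m c * mp_coord b (single m' (lookup q m')))"
      by (simp add: additive_eq_sum[of "mp_coord b", OF mp_coord_add] mp_coord_single accoord_scale mult_single)
    also have "\<dots> = single m c * mp_coord b (\<Sum>m'\<in>keys q. single m' (lookup q m'))"
      by (simp add: additive_eq_sum[of "mp_coord b", OF mp_coord_add] sum_distrib_left)
    also have "(\<Sum>m'\<in>keys q. single m' (lookup q m')) = q" by (rule mpoly_eq_sum_single[symmetric])
    finally show ?thesis .
  qed
  have "mp_ac p = (\<Sum>m\<in>keys p. single m (to_ac (lookup p m)))"
    by (subst mpoly_eq_sum_single[of p]) (simp add: additive_eq_sum[of mp_ac, OF mp_ac_add] mp_ac_single)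
  then have "mp_coord b (mp_ac p * q) = (\<Sum>m\<in>keys p. single m (lookup p m) * mp_coord b q)"
    by (simp add: sum_distrib_right additive_eq_sum[of "mp_coord b", OF mp_coord_add] 1)
  also have "\<dots> = (\<Sum>m\<in>keys p. single m (lookup p m)) * mp_coord b q" by (simp add: sum_distrib_right)
  also have "(\<Sum>m\<in>keys p. single m (lookup p m)) = p" by (rule mpoly_eq_sum_single[symmetric])
  finally show ?thesis .
qed

lemma mp_coord_scale: "mp_coord b (mconst z * mp_ac p) = mconst (accoord b z) * p"
  using mp_coord_mult[of b p "mconst z"] by (simp add: mconst_def mp_coord_single mult.commute)

lemma mp_coord_sum:
  obtains B where "finite B" "p = (\<Sum>b\<in>B. mconst b * mp_ac (mp_coord b p))"
proof -
  define B where "B = (\<Union>m\<in>keys p. {b. accoord b (lookup p m) \<noteq> 0})"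
  have fin: "finite B" by (simp add: B_def accoord_finite)
  have "p = (\<Sum>b\<in>B. mconst b * mp_ac (mp_coord b p))"
  proof (rule poly_mapping_eqI)
    fix m
    have "lookup p m = (\<Sum>b | accoord b (lookup p m) \<noteq> 0. to_ac (accoord b (lookup p m)) * b)"
      by (simp add: accoord_sum)
    also have "\<dots> = (\<Sum>b\<in>B. to_ac (accoord b (lookup p m)) * b)"
    proof (rule sum.mono_neutral_left[OF fin])
      show "{b. accoord b (lookup p m) \<noteq> 0} \<subseteq> B"
        by (cases "m \<in> keys p") (auto simp: B_def in_keys_iff)
    qed auto
    also have "\<dots> = lookup (\<Sum>b\<in>B. mconst b * mp_ac (mp_coord b p)) m"
      by (simp add: lookup_sum lookup_mconst_times lookup_mp_ac lookup_mp_coord mult.commute)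
    finally show "lookup p m = lookup (\<Sum>b\<in>B. mconst b * mp_ac (mp_coord b p)) m" .
  qed
  then show thesis using that fin by blast
qed

lemma mp_coord_eq_0D:
  assumes "\<And>b. accoord b z = 0"
  shows "z = 0"
  using accoord_sum[of z] assms by simp

text \<open>Coordinates are linear over polynomials with coefficients in K, and h is the finite
  combination of its coordinates. This replaces faithful flatness: the transfer of regularity and of
  dimensions rests on it.\<close>

lemma mem_ideal_ac: "h \<in> ideal_gen (mp_ac ` F) \<longleftrightarrow> (\<forall>b. mp_coord b h \<in> ideal_gen F)"
proof
  assume "h \<in> ideal_gen (mp_ac ` F)"
  then show "\<forall>b. mp_coord b h \<in> ideal_gen F"
  proof (induction rule: ring_ideal.span_induct_alt)
    case (step c x y)
    then obtain f where f: "f \<in> F" "x = mp_ac f" by blast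
    show ?case
    proof
      fix b
      have "mp_coord b (c * x + y) = mp_coord b c * f + mp_coord b y"
        using mp_coord_mult[of b f c] by (simp add: mp_coord_add f mult.commute)
      then show "mp_coord b (c * x + y) \<in> ideal_gen F"
        using step f by (auto intro: ring_ideal.span_add ideal_mult ring_ideal.span_base)
    qed
  qed (simp add: ring_ideal.span_zero)
next
  assume h: "\<forall>b. mp_coord b h \<in> ideal_gen F"
  have ac: "mp_ac p \<in> ideal_gen (mp_ac ` F)" if "p \<in> ideal_gen F" for p
    using that
  proof (induction rule: ring_ideal.span_induct_alt)
    case (step c x y)
    then have "mp_ac c * mp_ac x + mp_ac y \<in> ideal_gen (mp_ac ` F)"
      by (intro ring_ideal.span_add ideal_mult ring_ideal.span_base[of "mp_ac x"]) auto
    then show ?case by (simp add: mp_ac_add mp_ac_mult)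
  qed (simp add: ring_ideal.span_zero)
  obtain B where "h = (\<Sum>b\<in>B. mconst b * mp_ac (mp_coord b h))" using mp_coord_sum[of h] by blast
  also have "\<dots> \<in> ideal_gen (mp_ac ` F)" using h by (intro ring_ideal.span_sum ideal_mult ac) blast
  finally show "h \<in> ideal_gen (mp_ac ` F)" .
qed

lemma mp_ac_in_ideal: "mp_ac p \<in> ideal_gen (mp_ac ` F) \<longleftrightarrow> p \<in> ideal_gen F"
proof
  assume "mp_ac p \<in> ideal_gen (mp_ac ` F)"
  then have *: "mp_coord b (mp_ac p) \<in> ideal_gen F" for b by (simp add: mem_ideal_ac)
  \<comment> \<open>The number 1 need not be a basis element, so only a nonzero coordinate of it is
    available, to be divided out.\<close>
  obtain b :: "'b alg_closure" where b: "accoord b 1 \<noteq> 0" using mp_coord_eq_0D[of 1] by auto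
  have "mconst (accoord b 1) * p \<in> ideal_gen F" using *[of b] mp_coord_scale[of b 1 p] by simp
  then have "mconst (1 / accoord b 1) * (mconst (accoord b 1) * p) \<in> ideal_gen F" by (rule ideal_mult)
  moreover have "mconst (1 / accoord b 1) * (mconst (accoord b 1) * p) = p"
    by (simp add: mconst_inverse[OF b] flip: mult.assoc)
  ultimately show "p \<in> ideal_gen F" by simp
next
  assume "p \<in> ideal_gen F"
  then have "q * p \<in> ideal_gen F" for q by (rule ideal_mult)
  then show "mp_ac p \<in> ideal_gen (mp_ac ` F)"
    unfolding mem_ideal_ac using mp_coord_scale[of _ 1 p] by simp
qed

lemma regular_sequence_ac:
  assumes "regular_sequence fs"
  shows "regular_sequence (map mp_ac fs)"
  unfolding regular_sequence_def
proof (intro conjI allI impI)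
  fix i h assume i: "i < length (map mp_ac fs)"
    and h: "map mp_ac fs ! i * h \<in> ideal_gen (set (take i (map mp_ac fs)))"
  have s: "set (take i (map mp_ac fs)) = mp_ac ` set (take i fs)" by (simp add: take_map)
  have "mp_coord b (mp_ac (fs ! i) * h) \<in> ideal_gen (set (take i fs))" for b
    using h i unfolding s mem_ideal_ac by simp
  then have "fs ! i * mp_coord b h \<in> ideal_gen (set (take i fs))" for b by (simp add: mp_coord_mult)
  then have "mp_coord b h \<in> ideal_gen (set (take i fs))" for b
    using assms i unfolding regular_sequence_def by simp
  then show "h \<in> ideal_gen (set (take i (map mp_ac fs)))" unfolding s mem_ideal_ac by blast
next
  have "1 \<notin> ideal_gen (set fs)"
  proof
    assume "1 \<in> ideal_gen (set fs)"
    then have "p \<in> ideal_gen (set fs)" for p using ideal_mult[of 1 _ p] by simp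
    then show False using assms by (auto simp: regular_sequence_def)
  qed
  then have "mp_ac 1 \<notin> ideal_gen (mp_ac ` set fs)" by (simp add: mp_ac_in_ideal)
  then show "ideal_gen (set (map mp_ac fs)) \<noteq> UNIV" by auto
qed

lemma mp_ac_homog: "p \<in> homog t \<Longrightarrow> mp_ac p \<in> homog t"
  by (auto simp: homog_def in_keys_iff lookup_mp_ac)

lemma mp_coord_homog: "p \<in> homog t \<Longrightarrow> mp_coord b p \<in> homog t"
  by (fastforce simp: homog_def in_keys_iff lookup_mp_coord)

lemma dim_homog: "mpoly.dim (homog t :: ('n::finite, 'k::field) mpoly set) = card {m :: 'n \<Rightarrow>\<^sub>0 nat. mdeg m = t}"
proof -
  have "homog t = {p :: ('n, 'k) mpoly. keys p \<subseteq> {m. mdeg m = t}}" by (auto simp: homog_def)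
  then show ?thesis using dim_monomials[OF finite_mdeg] by metis
qed

text \<open>A basis over K stays a basis over the closure: spanning and independence are both
  checked on coordinates.\<close>

lemma dim_ideal_ac:
  fixes F :: "('n::finite, 'k::field) mpoly set"
  shows "mpoly.dim (ideal_gen (mp_ac ` F) \<inter> homog t) = mpoly.dim (ideal_gen F \<inter> homog t)"
proof -
  have "mpoly.fin_dim (ideal_gen F \<inter> homog t)" by (rule fin_dim_homog_subset[of _ t]) simp
  then obtain A where A: "A \<subseteq> ideal_gen F \<inter> homog t" "mpoly.independent A" "ideal_gen F \<inter> homog t \<subseteq> mpoly.span A"
    "card A = mpoly.dim (ideal_gen F \<inter> homog t)" "finite A" using mpoly.fin_dim_basis by metis
  have inj: "inj_on mp_ac A"
    by (rule inj_onI, rule poly_mapping_eqI) (metis lookup_mp_ac to_ac_eq_iff)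
  have span: "mp_ac p \<in> mpoly.span (mp_ac ` A)" if "p \<in> mpoly.span A" for p
    using that
  proof (induction rule: mpoly.span_induct_alt)
    case (step c x y)
    then show ?case
      by (auto simp: mp_ac_add mp_ac_mult mp_ac_const intro!: mpoly.span_add mpoly.span_scale intro: mpoly.span_base)
  qed (simp add: mpoly.span_zero)
  show ?thesis
  proof (rule mpoly.dim_unique)
    show "mp_ac ` A \<subseteq> ideal_gen (mp_ac ` F) \<inter> homog t"
      using A(1) by (auto simp: mp_ac_in_ideal intro!: mp_ac_homog)
    show "ideal_gen (mp_ac ` F) \<inter> homog t \<subseteq> mpoly.span (mp_ac ` A)"
    proof
      fix h assume h: "h \<in> ideal_gen (mp_ac ` F) \<inter> homog t"
      then have "mp_coord b h \<in> mpoly.span A" for b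
        using A(3) mp_coord_homog mem_ideal_ac by blast
      then have *: "mp_ac (mp_coord b h) \<in> mpoly.span (mp_ac ` A)" for b by (rule span)
      obtain B where "h = (\<Sum>b\<in>B. mconst b * mp_ac (mp_coord b h))" using mp_coord_sum[of h] by blast
      also have "\<dots> \<in> mpoly.span (mp_ac ` A)" by (intro mpoly.span_sum mpoly.span_scale *)
      finally show "h \<in> mpoly.span (mp_ac ` A)" .
    qed
    show "mpoly.independent (mp_ac ` A)"
      unfolding mpoly.independent_explicit_finite_subsets
    proof (intro allI impI ballI)
      fix T u v assume T: "T \<subseteq> mp_ac ` A" "finite T" "(\<Sum>v\<in>T. mconst (u v) * v) = 0" "v \<in> T"
      then obtain T' where T': "T' \<subseteq> A" "T = mp_ac ` T'" using subset_imageE by meson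
      obtain a where a: "a \<in> T'" "v = mp_ac a" using T(4) T'(2) by blast
      have "(\<Sum>v\<in>T. mconst (u v) * v) = (\<Sum>a\<in>T'. mconst (u (mp_ac a)) * mp_ac a)"
        unfolding T'(2) using inj_on_subset[OF inj T'(1)] by (simp add: sum.reindex)
      then have z: "(\<Sum>a\<in>T'. mconst (u (mp_ac a)) * mp_ac a) = 0" using T(3) by simp
      have "accoord b (u v) = 0" for b
      proof -
        have "(\<Sum>a\<in>T'. mconst (accoord b (u (mp_ac a))) * a) = mp_coord b (\<Sum>a\<in>T'. mconst (u (mp_ac a)) * mp_ac a)"
          by (simp add: additive_eq_sum[of "mp_coord b", OF mp_coord_add] mp_coord_scale)
        also have "\<dots> = 0" by (simp add: z)
        finally show ?thesis
          using mpoly.independentD[OF A(2) finite_subset[OF T'(1) A(5)] T'(1), of "\<lambda>a. accoord b (u (mp_ac a))" a] a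
          by simp
      qed
      then show "u v = 0" by (rule mp_coord_eq_0D)
    qed
    show "card (mp_ac ` A) = mpoly.dim (ideal_gen F \<inter> homog t)" using card_image[OF inj] A(4) by simp
  qed
qed

lemma hilbert_fun_ac:
  fixes F :: "('n::finite, 'k::field) mpoly set"
  shows "hilbert_fun (ideal_gen (mp_ac ` F)) t = hilbert_fun (ideal_gen F) t"
  using hilbert_fun_eq[of "ideal_gen (mp_ac ` F)" t] hilbert_fun_eq[of "ideal_gen F" t]
  by (simp add: dim_ideal_ac dim_homog)

theorem theorem4p3:
  fixes fs :: "(6, 'k::field) mpoly list" and g :: "(6, 'k) mpoly" and I :: "(6, 'k) mpoly set"
  assumes "length fs = 6"
    and "set fs \<subseteq> homog 2"
    and "regular_sequence fs"
    and "g \<in> homog 2"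
    and "g \<notin> ideal_gen (set fs)"
    and "I = ideal_gen (insert g (set fs))"
  shows "\<exists>L :: (6, 'k) mpoly set. homogeneous_ideal L \<and> (\<forall>i. mvar i ^ 2 \<in> L) \<and>
           (\<forall>t. hilbert_fun I t = hilbert_fun L t)"
proof -
  obtain p a where pa: "admissible p a"
    "\<And>t. hilbert_fun (ideal_gen (insert (mp_ac g) (set (map mp_ac fs)))) t + face_defect p a t = 6 choose t"
  proof (rule almost_ci_hilbert_fun[of "map mp_ac fs" "mp_ac g"])
    show "mp_ac g \<notin> ideal_gen (set (map mp_ac fs))" using assms(5) by (simp add: mp_ac_in_ideal)
    show "set (map mp_ac fs) \<subseteq> homog 2" using assms(2) by (auto intro!: mp_ac_homog)
  qed (use assms in \<open>auto intro: mp_ac_homog regular_sequence_ac\<close>)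
  have "insert (mp_ac g) (set (map mp_ac fs)) = mp_ac ` insert g (set fs)" by simp
  then have I: "hilbert_fun I t + face_defect p a t = 6 choose t" for t
    using pa(2)[of t] assms(6) by (simp only: hilbert_fun_ac)
  obtain U :: "6 set set" where U: "\<forall>\<sigma>\<in>U. \<forall>\<rho>. \<sigma> \<subseteq> \<rho> \<longrightarrow> \<rho> \<in> U" "\<forall>k. card {\<sigma>\<in>U. card \<sigma> = k} = face_defect p a k"
    using admissible_upset[OF pa(1)] by blast
  obtain L :: "(6, 'k) mpoly set" where L: "homogeneous_ideal L" "\<And>i. mvar i ^ 2 \<in> L"
    "\<And>t. hilbert_fun L t + card {\<sigma>\<in>U. card \<sigma> = t} = CARD(6) choose t"
    using squarefree_ideal[of U] U(1) by blast
  have "hilbert_fun I t = hilbert_fun L t" for t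
    using I[of t] L(3)[of t] U(2) by simp
  then show ?thesis using L by blast
qed

end
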